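(* Let $N\ge 2$, let $b^-<b^+$ be real constants, let $\Omega=\{x\in\mathbb{R}^N : b^-<x_N<b^+\}$ and $\Gamma^\pm=\{x\in\mathbb{R}^N : x_N=b^\pm\}$. Let $a>0$ and $1<p<\infty$. Suppose that $f^\pm\in L^1_{\mathrm{loc}}(\mathbb{R}^{N-1})$ are such that $$\int_{\mathbb{R}^{N-1}}|f^+(x')-f^-(x')|^p\,dx'<\infty,\qquad |f^-|_{\tilde{W}^{1-1/p,p}_{(a)}(\mathbb{R}^{N-1})}<\infty,\qquad |f^+|_{\tilde{W}^{1-1/p,p}_{(a)}(\mathbb{R}^{N-1})}<\infty .$$ Then there exists $u\in\dot{W}^{1,p}(\Omega)$ such that $\operatorname{Tr}(u)=f^\pm$ on $\Gamma^\pm$ and $$\int_\Omega|\nabla u(x)|^p\,dx\le c\,(b^+-b^-)^{-(p-1)}\int_{\mathbb{R}^{N-1}}|f^+(x')-f^-(x')|^p\,dx'+c\,|f^-|^p_{\tilde{W}^{1-1/p,p}_{(a)}(\mathbb{R}^{N-1})}+c\,|f^+|^p_{\tilde{W}^{1-1/p,p}_{(a)}(\mathbb{R}^{N-1})}$$ for some constant $c=c(a,N,p)>0$. Moreover, the map $(f^-,f^+)\mapsto u$ is linear.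
   Context: Points are written $x=(x',x_N)\in\mathbb{R}^{N-1}\times\mathbb{R}$. $\dot{W}^{1,p}(\Omega)$ is the space of real-valued $u\in L^1_{\mathrm{loc}}(\Omega)$ whose first-order weak derivatives all belong to $L^p(\Omega)$. $\operatorname{Tr}:\dot{W}^{1,p}(\Omega)\to L^p_{\mathrm{loc}}(\partial\Omega)$ is the boundary trace operator: the linear operator that agrees with restriction to $\partial\Omega$ on $\dot{W}^{1,p}(\Omega)\cap C^0(\overline\Omega)$ and satisfies $\int_\Omega u\,\partial_i\psi\,dx=-\int_\Omega\psi\,\partial_iu\,dx+\int_{\partial\Omega}\psi\operatorname{Tr}(u)\nu_i\,d\mathcal{H}^{N-1}$ for all $\psi\in C^1_c(\mathbb{R}^N)$ and all $i=1,\dots,N$, with $\nu$ the outward unit normal (it coincides with the usual Sobolev trace, since $u\in W^{1,p}$ on bounded Lipschitz subdomains of $\Omega$). Functions on $\Gamma^\pm$ are identified with functions of $x'\in\mathbb{R}^{N-1}$. $B'(x',r)$ is the open ball in $\mathbb{R}^{N-1}$ with center $x'$ and radius $r$. For a constant $a>0$ and $f\in L^1_{\mathrm{loc}}(\mathbb{R}^{N-1})$, $$|f|_{\tilde{W}^{1-1/p,p}_{(a)}(\mathbb{R}^{N-1})}:=\left(\int_{\mathbb{R}^{N-1}}\int_{B'(0,a)}\frac{|f(x'+h')-f(x')|^p}{|h'|^{p+N-2}}\,dh'\,dx'\right)^{1/p}.$$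
   Formalization: The constant c depends on a, N, p and an upper bound L for the width b^+ - b^- (any L > 0, one c for all strips of width at most L); with c = c(a,N,p) alone the estimate fails for wide strips, e.g. f^+ = f^- = φ(x'/R) with b^+ - b^- = R large. *)

theory Defs
  imports "HOL-Analysis.Analysis"
begin

text \<open>
  Points of \<open>\<real>\<^sup>N\<close> are pairs \<open>(x', t) :: 'a \<times> real\<close> with \<open>'a\<close> a Euclidean space of dimension
  \<open>N - 1 \<ge> 1\<close>; the norm, inner product, canonical basis and Lebesgue measure of the product type
  are the Euclidean ones. Elements of \<open>L\<^sup>1\<^sub>l\<^sub>o\<^sub>c\<close> are given by Borel representatives.
\<close>

definition Lp_on :: "real \<Rightarrow> 'e::euclidean_space set \<Rightarrow> ('e \<Rightarrow> real) \<Rightarrow> bool" where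
  "Lp_on p S f \<longleftrightarrow> set_borel_measurable lborel S f \<and>
     (\<integral>\<^sup>+x\<in>S. ennreal (\<bar>f x\<bar> powr p) \<partial>lborel) < \<infinity>"

definition Lp_loc_on :: "real \<Rightarrow> 'e::euclidean_space set \<Rightarrow> ('e \<Rightarrow> real) \<Rightarrow> bool" where
  "Lp_loc_on p S f \<longleftrightarrow> set_borel_measurable lborel S f \<and> (\<forall>K. compact K \<and> K \<subseteq> S \<longrightarrow> Lp_on p K f)"

text \<open>\<open>iter_deriv [v\<^sub>1, \<dots>, v\<^sub>k] f\<close> is the iterated directional derivative of \<open>f\<close> along \<open>v\<^sub>k, \<dots>, v\<^sub>1\<close>.\<close>

fun iter_deriv :: "'e::euclidean_space list \<Rightarrow> ('e \<Rightarrow> real) \<Rightarrow> 'e \<Rightarrow> real" where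
  "iter_deriv [] f = f"
| "iter_deriv (v # vs) f = (\<lambda>x. frechet_derivative (iter_deriv vs f) (at x) v)"

definition C_infinity_c :: "'e::euclidean_space set \<Rightarrow> ('e \<Rightarrow> real) set" where
  "C_infinity_c S = {\<phi>. (\<forall>vs x. iter_deriv vs \<phi> differentiable (at x)) \<and>
     compact (closure {x. \<phi> x \<noteq> 0}) \<and> closure {x. \<phi> x \<noteq> 0} \<subseteq> S}"

definition C1_c :: "('e::euclidean_space \<Rightarrow> real) set" where
  "C1_c = {\<psi>. (\<forall>x. \<psi> differentiable (at x)) \<and>
     (\<forall>v. continuous_on UNIV (\<lambda>x. frechet_derivative \<psi> (at x) v)) \<and>
     compact (closure {x. \<psi> x \<noteq> 0})}"

definition weak_gradient :: "'e::euclidean_space set \<Rightarrow> ('e \<Rightarrow> real) \<Rightarrow> ('e \<Rightarrow> 'e) \<Rightarrow> bool" where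
  "weak_gradient S u G \<longleftrightarrow> Lp_loc_on 1 S u \<and>
     (\<forall>i\<in>Basis. Lp_loc_on 1 S (\<lambda>x. G x \<bullet> i) \<and>
        (\<forall>\<phi>\<in>C_infinity_c S.
           (LINT x:S|lborel. u x * frechet_derivative \<phi> (at x) i)
             = - (LINT x:S|lborel. (G x \<bullet> i) * \<phi> x)))"

definition hom_sobolev :: "real \<Rightarrow> 'e::euclidean_space set \<Rightarrow> ('e \<Rightarrow> real) set" where
  "hom_sobolev p S = {u. \<exists>G. weak_gradient S u G \<and> (\<forall>i\<in>Basis. Lp_on p S (\<lambda>x. G x \<bullet> i))}"

definition strip :: "real \<Rightarrow> real \<Rightarrow> ('a::euclidean_space \<times> real) set" where
  "strip b1 b2 = {x. b1 < snd x \<and> snd x < b2}"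

text \<open>
  \<open>has_trace p b1 b2 u g1 g2\<close>: the trace of \<open>u\<close> is \<open>g1\<close> on the bottom boundary \<open>x\<^sub>N = b1\<close> and \<open>g2\<close> on
  the top boundary \<open>x\<^sub>N = b2\<close>, both read as functions of \<open>x'\<close>. On these hyperplanes
  the surface measure is Lebesgue measure in \<open>x'\<close>, and the outward unit normal is \<open>(0, -1)\<close> on the bottom
  and \<open>(0, 1)\<close> on the top. The integration by parts formula determines \<open>g1\<close> and \<open>g2\<close> up to null
  sets; it does not depend on the choice of the (almost everywhere unique) weak gradient \<open>G\<close>.
\<close>

definition has_trace ::
  "real \<Rightarrow> real \<Rightarrow> real \<Rightarrow> ('a::euclidean_space \<times> real \<Rightarrow> real) \<Rightarrow> ('a \<Rightarrow> real) \<Rightarrow> ('a \<Rightarrow> real) \<Rightarrow> bool" where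
  "has_trace p b1 b2 u g1 g2 \<longleftrightarrow>
     u \<in> hom_sobolev p (strip b1 b2) \<and> Lp_loc_on p UNIV g1 \<and> Lp_loc_on p UNIV g2 \<and>
     (\<forall>v. continuous_on (closure (strip b1 b2)) v \<and> (AE x in lborel. x \<in> strip b1 b2 \<longrightarrow> u x = v x)
        \<longrightarrow> (AE x' in lborel. g1 x' = v (x', b1)) \<and> (AE x' in lborel. g2 x' = v (x', b2))) \<and>
     (\<exists>G. weak_gradient (strip b1 b2) u G \<and>
        (\<forall>\<psi>\<in>C1_c. \<forall>i\<in>Basis.
           (LINT x:strip b1 b2|lborel. u x * frechet_derivative \<psi> (at x) i)
             = - (LINT x:strip b1 b2|lborel. \<psi> x * (G x \<bullet> i))
               + ((LINT x'|lborel. \<psi> (x', b1) * g1 x' * ((0, -1) \<bullet> i))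
                  + (LINT x'|lborel. \<psi> (x', b2) * g2 x' * ((0, 1) \<bullet> i)))))"

definition ennreal_powr :: "ennreal \<Rightarrow> real \<Rightarrow> ennreal" where
  "ennreal_powr x r = (if x = \<infinity> then \<infinity> else ennreal (enn2real x powr r))"

text \<open>With \<open>N = DIM('a) + 1\<close>, the exponent \<open>p + N - 2\<close> is \<open>p + DIM('a) - 1\<close>.\<close>

definition screened_seminorm :: "real \<Rightarrow> real \<Rightarrow> ('a::euclidean_space \<Rightarrow> real) \<Rightarrow> ennreal" where
  "screened_seminorm p a f = ennreal_powr
     (\<integral>\<^sup>+x. (\<integral>\<^sup>+h\<in>ball 0 a.
        ennreal (\<bar>f (x + h) - f x\<bar> powr p / norm h powr (p + real DIM('a) - 1)) \<partial>lborel) \<partial>lborel) (1 / p)"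

text \<open>The pairs \<open>(f\<^sup>-, f\<^sup>+)\<close> of admissible boundary data.\<close>

definition boundary_data :: "real \<Rightarrow> real \<Rightarrow> (('a::euclidean_space \<Rightarrow> real) \<times> ('a \<Rightarrow> real)) set" where
  "boundary_data p a = {(f1, f2). Lp_loc_on 1 UNIV f1 \<and> Lp_loc_on 1 UNIV f2 \<and>
     (\<integral>\<^sup>+x. ennreal (\<bar>f2 x - f1 x\<bar> powr p) \<partial>lborel) < \<infinity> \<and>
     screened_seminorm p a f1 < \<infinity> \<and> screened_seminorm p a f2 < \<infinity>}"

end

theory Submission
  imports Defs
begin

text \<open>
  Each boundary function is mollified with the kernel proportional to
  \<open>(max 0 (s\<^sup>2 - |y - x|\<^sup>2))\<^sup>2\<close>, at a scale \<open>s\<close> proportional to the distance to its hyperplane and at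
  most \<open>a\<close>, and the two mollifications are interpolated linearly in the last variable. The gradient
  of the mollification at \<open>(x, s)\<close> and its distance to \<open>f x\<close> divided by \<open>s\<close> are both controlled by
  \<open>s\<^bsup>-n-1\<^esup>\<close> times the integral of \<open>|f y - f x|\<close> over the ball \<open>B(x, s)\<close>, where \<open>n = N - 1\<close>. By Jensen
  and Tonelli the \<open>p\<close>-th power of this quantity integrates to a multiple of the screened seminorm.
  Since also the derivative of the interpolation weight is the reciprocal of the width, this gives the
  energy bound, and at the same time the Hardy-type bound that \<open>|u - f|/dist\<close> is in \<open>L\<^sup>p\<close> near each
  hyperplane. As \<open>dist\<^bsup>-p\<^esup>\<close> is not integrable, the latter forces \<open>u\<close> to converge to \<open>f\<close> along almost
  every vertical line, so that Green's formula reduces to the fundamental theorem of calculus.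
\<close>

section \<open>Mollification at a variable scale\<close>

text \<open>The squared positive part is used because q -> (max 0 q)^2 has an explicit quadratic
  Taylor remainder: averages can be differentiated in centre and scale at once by integrating that
  remainder. The mass of the kernel is never computed, only bounded below. The mollification is a
  quotient of two averages, so it reproduces constants exactly and \<open>f\<close> may be replaced
  by \<open>f - f x\<close> in every estimate. The scale is \<open>\<epsilon>\<close> times the
  distance to the hyperplane with one fixed slope \<open>\<epsilon> = a / L\<close>, so it stays
  below \<open>a\<close> in every strip of width at most \<open>L\<close> without being truncated.
  The constant then depends on \<open>L\<close>, and some bound on the width is unavoidable: take
  equal data on both hyperplanes, a fixed smooth compactly supported profile stretched horizontally
  by a factor tending to infinity. Every extension has energy asymptotically at least the width
  times the integral of |grad f|^p. The first term on the right is zero, and the seminorms do not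
  involve the width and are controlled by the same integral of |grad f|^p.\<close>

lemma Lp_loc_on_UNIV_measurable [measurable_dest]:
  "Lp_loc_on p UNIV f \<Longrightarrow> f \<in> borel_measurable borel"
  unfolding Lp_loc_on_def set_borel_measurable_def by simp

lemma Lp_loc_on_1_set_integrable:
  assumes "Lp_loc_on 1 S f" "compact K" "K \<subseteq> S"
  shows "set_integrable lborel K f"
proof -
  have K: "Lp_on 1 K f" using assms by (auto simp: Lp_loc_on_def)
  then have m: "(\<lambda>x. indicator K x *\<^sub>R f x) \<in> borel_measurable lborel"
    by (auto simp: Lp_on_def set_borel_measurable_def)
  have "(\<integral>\<^sup>+x. ennreal (norm (indicator K x *\<^sub>R f x)) \<partial>lborel) < \<infinity>"
    using K unfolding Lp_on_def
    by (auto simp: indicator_def powr_one_gt_zero_iff if_distrib cong: if_cong elim!: le_less_trans[rotated]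
        intro!: nn_integral_mono)
  then show ?thesis
    unfolding set_integrable_def using m by (intro integrableI_bounded) auto
qed

text \<open>The kernel is Banach-valued so that one statement covers both the scalar kernel of
  \<open>bump_avg\<close> and the vector kernel of \<open>bump_avg_grad\<close>; this is also why
  the averages are written with scalar multiplication.\<close>

lemma Lp_loc_on_1_integrable_mult:
  fixes f :: "'a::euclidean_space \<Rightarrow> real" and k :: "'a \<Rightarrow> 'b::{banach,second_countable_topology}"
  assumes f: "Lp_loc_on 1 UNIV f" and k [measurable]: "k \<in> borel_measurable borel"
    and bd: "\<And>y. norm (k y) \<le> C * indicator (cball x r) y"
  shows "integrable lborel (\<lambda>y. f y *\<^sub>R k y)"
proof (rule Bochner_Integration.integrable_bound)
  note [measurable] = Lp_loc_on_UNIV_measurable[OF f]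
  have "set_integrable lborel (cball x r) f"
    by (rule Lp_loc_on_1_set_integrable[OF f]) auto
  then show "integrable lborel (\<lambda>y. C * \<bar>indicator (cball x r) y *\<^sub>R f y\<bar>)"
    unfolding set_integrable_def by (intro integrable_mult_right integrable_abs)
  show "(\<lambda>y. f y *\<^sub>R k y) \<in> borel_measurable lborel" by measurable
  show "AE y in lborel. norm (f y *\<^sub>R k y) \<le> norm (C * \<bar>indicator (cball x r) y *\<^sub>R f y\<bar>)"
  proof (rule AE_I2)
    fix y
    have "norm (f y *\<^sub>R k y) = \<bar>f y\<bar> * norm (k y)" by simp
    also have "\<dots> \<le> \<bar>f y\<bar> * (C * indicator (cball x r) y)"
      using bd[of y] by (intro mult_left_mono) auto
    also have "\<dots> \<le> norm (C * \<bar>indicator (cball x r) y *\<^sub>R f y\<bar>)"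
      using bd[of y] by (auto simp: indicator_def abs_mult mult.commute intro!: mult_left_mono mult_right_mono)
    finally show "norm (f y *\<^sub>R k y) \<le> norm (C * \<bar>indicator (cball x r) y *\<^sub>R f y\<bar>)" .
  qed
qed

section \<open>The kernel and its first-order expansion in centre and scale\<close>

definition bump :: "'a::euclidean_space \<times> real \<Rightarrow> 'a \<Rightarrow> real" where
  "bump \<xi> y = max 0 ((snd \<xi>)\<^sup>2 - (norm (y - fst \<xi>))\<^sup>2)"

lemma bump_nonneg [simp]: "0 \<le> bump \<xi> y"
  by (simp add: bump_def)

lemma bump_le: "bump \<xi> y \<le> (snd \<xi>)\<^sup>2"
  by (simp add: bump_def)

lemma bump_eq_0: "snd \<xi> \<ge> 0 \<Longrightarrow> y \<notin> ball (fst \<xi>) (snd \<xi>) \<Longrightarrow> bump \<xi> y = 0"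
  by (auto simp: bump_def dist_norm norm_minus_commute max_def not_less power2_eq_iff power_mono)

lemma bump_measurable [measurable]:
  "(\<lambda>z. bump (fst z) (snd z)) \<in> borel_measurable (borel \<Otimes>\<^sub>M borel)"
proof -
  have "(\<lambda>z::('a \<times> real) \<times> 'a. bump (fst z) (snd z)) \<in> borel_measurable borel"
    unfolding bump_def by (intro borel_measurable_continuous_onI continuous_intros)
  then show ?thesis by (simp add: borel_prod)
qed

lemma bump_measurable1 [measurable]: "bump \<xi> \<in> borel_measurable borel"
  unfolding bump_def by (intro borel_measurable_continuous_onI continuous_intros)

text \<open>The derivative 2 max 0 q of (max 0 q)^2 is Lipschitz with constant 2, which bounds the
  first-order remainder by \<delta>^2. The sign cases make this elementary.\<close>

lemma pos_part_square_remainder: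
  fixes q \<delta> :: real
  shows "\<bar>(max 0 (q + \<delta>))\<^sup>2 - (max 0 q)\<^sup>2 - 2 * max 0 q * \<delta>\<bar> \<le> \<delta>\<^sup>2"
proof -
  consider "q \<ge> 0" "q + \<delta> \<ge> 0" | "q \<ge> 0" "q + \<delta> < 0" | "q < 0" "q + \<delta> \<ge> 0" | "q < 0" "q + \<delta> < 0"
    by linarith
  then show ?thesis
  proof cases
    case 1 then show ?thesis by (simp add: max_def power2_eq_square algebra_simps)
  next
    case 2
    \<comment> \<open>With q + \<delta> negative the remainder is - q (q + 2 \<delta>), and
      \<delta>^2 exceeds it by exactly (q + \<delta>)^2.\<close>
    have "(- q * (q + 2 * \<delta>)) \<le> \<delta>\<^sup>2" using zero_le_power2[of "q + \<delta>"]
      by (simp add: power2_eq_square algebra_simps)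
    moreover have "0 \<le> (- q * (q + 2 * \<delta>))" using 2 by (simp add: mult_le_0_iff)
    ultimately show ?thesis using 2 by (simp add: max_def power2_eq_square algebra_simps)
  next
    case 3
    then have "(q + \<delta>)\<^sup>2 \<le> \<delta>\<^sup>2" by (intro power_mono) auto
    then show ?thesis using 3 by (simp add: max_def)
  next
    case 4 then show ?thesis by (simp add: max_def)
  qed
qed

text \<open>The radius |s| + 2 leaves room for a move of the centre and a change of the scale by at
  most 1 each, so both kernels vanish outside that ball. The bound is therefore quadratic in the
  increment and compactly supported in \<open>y\<close>, which makes it integrable against a locally
  integrable function.\<close>

lemma bump_square_remainder:
  fixes x y :: "'a::euclidean_space"
  assumes "norm (h, \<sigma>) \<le> 1"
  shows "\<bar>(bump (x + h, s + \<sigma>) y)\<^sup>2 - (bump (x, s) y)\<^sup>2 - 4 * bump (x, s) y * ((y - x, s) \<bullet> (h, \<sigma>))\<bar>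
    \<le> ((4 * \<bar>s\<bar> + 6)\<^sup>2 + 2 * s\<^sup>2) * indicator (cball x (\<bar>s\<bar> + 2)) y * (norm (h, \<sigma>))\<^sup>2"
    (is "\<bar>?R\<bar> \<le> _ * ?N\<^sup>2")
proof (cases "y \<in> cball x (\<bar>s\<bar> + 2)")
  case False
  then have yx: "norm (y - x) > \<bar>s\<bar> + 2" by (simp add: dist_norm norm_minus_commute)
  have h: "norm h \<le> 1" "\<bar>\<sigma>\<bar> \<le> 1"
    using assms norm_fst_le[of h \<sigma>] norm_snd_le[of \<sigma> h] by auto
  have "norm (y - x) \<le> norm (y - (x + h)) + norm h"
    using norm_triangle_ineq[of "y - (x + h)" h] by simp
  then have "norm (y - (x + h)) \<ge> \<bar>s + \<sigma>\<bar>" using yx h by linarith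
  then have "(s + \<sigma>)\<^sup>2 \<le> (norm (y - (x + h)))\<^sup>2" by (simp add: abs_le_square_iff[symmetric])
  then have "bump (x + h, s + \<sigma>) y = 0" by (simp add: bump_def)
  moreover have "s\<^sup>2 \<le> (norm (y - x))\<^sup>2" using yx by (simp add: abs_le_square_iff[symmetric])
  then have "bump (x, s) y = 0" by (simp add: bump_def)
  ultimately show ?thesis by simp
next
  case True
  then have yx: "norm (y - x) \<le> \<bar>s\<bar> + 2" by (simp add: dist_norm norm_minus_commute)
  have h: "norm h \<le> ?N" "\<bar>\<sigma>\<bar> \<le> ?N"
    using norm_fst_le[of h \<sigma>] norm_snd_le[of \<sigma> h] by auto
  define q where "q = s\<^sup>2 - (norm (y - x))\<^sup>2"
  \<comment> \<open>The increment of s^2 - |y - x|^2. Its linear part gives the derivative in the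
    statement; its quadratic part \<sigma>^2 - |h|^2 is absorbed into the remainder, multiplied by 2
    max 0 q, which is at most 2 s^2.\<close>
  define \<delta> where "\<delta> = 2 * ((y - x, s) \<bullet> (h, \<sigma>)) + (\<sigma>\<^sup>2 - (norm h)\<^sup>2)"
  have q': "(s + \<sigma>)\<^sup>2 - (norm (y - (x + h)))\<^sup>2 = q + \<delta>"
    unfolding q_def \<delta>_def
    unfolding power2_norm_eq_inner by (simp add: inner_diff inner_add inner_commute algebra_simps power2_eq_square)
  have "\<bar>(y - x, s) \<bullet> (h, \<sigma>)\<bar> \<le> norm (y - x, s) * ?N" by (rule Cauchy_Schwarz_ineq2)
  also have "\<dots> \<le> (norm (y - x) + \<bar>s\<bar>) * ?N"
    by (intro mult_right_mono) (auto simp: norm_Pair sqrt_sum_squares_le_sum_abs order_trans[OF sqrt_sum_squares_le_sum_abs])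
  also have "\<dots> \<le> (2 * \<bar>s\<bar> + 2) * ?N" using yx by (intro mult_right_mono) auto
  finally have l1: "\<bar>(y - x, s) \<bullet> (h, \<sigma>)\<bar> \<le> (2 * \<bar>s\<bar> + 2) * ?N" .
  have "\<sigma>\<^sup>2 \<le> ?N\<^sup>2" "(norm h)\<^sup>2 \<le> ?N\<^sup>2" using h by (auto simp: abs_le_square_iff[symmetric])
  moreover have "0 \<le> \<sigma>\<^sup>2" "0 \<le> (norm h)\<^sup>2" by auto
  ultimately have l2: "\<bar>\<sigma>\<^sup>2 - (norm h)\<^sup>2\<bar> \<le> ?N\<^sup>2" by linarith
  have l3: "?N\<^sup>2 \<le> ?N" using assms by (simp add: power2_eq_square mult_left_le)
  have "\<bar>\<delta>\<bar> \<le> 2 * \<bar>(y - x, s) \<bullet> (h, \<sigma>)\<bar> + \<bar>\<sigma>\<^sup>2 - (norm h)\<^sup>2\<bar>" unfolding \<delta>_def by linarith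
  also have "\<dots> \<le> 2 * ((2 * \<bar>s\<bar> + 2) * ?N) + ?N" using l1 l2 l3 by linarith
  also have "\<dots> \<le> (4 * \<bar>s\<bar> + 6) * ?N" by (simp add: algebra_simps)
  finally have "\<bar>\<delta>\<bar> \<le> \<bar>(4 * \<bar>s\<bar> + 6) * ?N\<bar>" by simp
  then have d2: "\<delta>\<^sup>2 \<le> (4 * \<bar>s\<bar> + 6)\<^sup>2 * ?N\<^sup>2" unfolding abs_le_square_iff by (simp add: power_mult_distrib)
  have "max 0 q \<le> s\<^sup>2" by (simp add: q_def)
  then have r2: "\<bar>2 * max 0 q * (\<sigma>\<^sup>2 - (norm h)\<^sup>2)\<bar> \<le> 2 * s\<^sup>2 * ?N\<^sup>2"
    unfolding abs_mult using l2 by (intro mult_mono) auto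
  have "?R = ((max 0 (q + \<delta>))\<^sup>2 - (max 0 q)\<^sup>2 - 2 * max 0 q * \<delta>) + 2 * max 0 q * (\<sigma>\<^sup>2 - (norm h)\<^sup>2)"
    unfolding bump_def fst_conv snd_conv q' q_def[symmetric] by (simp add: \<delta>_def algebra_simps)
  then have "\<bar>?R\<bar> \<le> \<delta>\<^sup>2 + \<bar>2 * max 0 q * (\<sigma>\<^sup>2 - (norm h)\<^sup>2)\<bar>"
    using pos_part_square_remainder[of q \<delta>] by linarith
  also have "\<dots> \<le> (4 * \<bar>s\<bar> + 6)\<^sup>2 * ?N\<^sup>2 + 2 * s\<^sup>2 * ?N\<^sup>2" using d2 r2 by linarith
  finally show ?thesis using True by (simp add: algebra_simps)
qed

section \<open>Unnormalised averages and their gradient\<close>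

definition bump_avg :: "('a::euclidean_space \<Rightarrow> real) \<Rightarrow> 'a \<times> real \<Rightarrow> real" where
  "bump_avg f \<xi> = (\<integral>y. f y *\<^sub>R (bump \<xi> y)\<^sup>2 \<partial>lborel)"

text \<open>The vector kernel is the gradient of the squared bump in (x, s): the factor 2
  \<open>bump\<close> times the gradient (2 (y - x), 2 s) of s^2 - |y - x|^2.\<close>

definition bump_avg_grad :: "('a::euclidean_space \<Rightarrow> real) \<Rightarrow> 'a \<times> real \<Rightarrow> 'a \<times> real" where
  "bump_avg_grad f \<xi> = (\<integral>y. f y *\<^sub>R ((4 * bump \<xi> y) *\<^sub>R (y - fst \<xi>, snd \<xi>)) \<partial>lborel)"

lemma bump_kernel_bound:
  assumes "s \<ge> 0"
  shows "\<bar>(bump (x, s) y)\<^sup>2\<bar> \<le> s ^ 4 * indicator (ball x s) y"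
    and "norm ((4 * bump (x, s) y) *\<^sub>R (y - x, s)) \<le> 8 * s ^ 3 * indicator (ball x s) y"
proof -
  have "bump (x, s) y = 0" if "y \<notin> ball x s" using bump_eq_0[of "(x, s)" y] assms that by simp
  moreover have b: "bump (x, s) y \<le> s\<^sup>2" using bump_le[of "(x,s)"] by simp
  moreover have "(bump (x, s) y)\<^sup>2 \<le> (s\<^sup>2)\<^sup>2" using b by (intro power_mono) auto
  ultimately show "\<bar>(bump (x, s) y)\<^sup>2\<bar> \<le> s ^ 4 * indicator (ball x s) y"
    by (auto simp: indicator_def)
  have "norm ((4 * bump (x, s) y) *\<^sub>R (y - x, s)) \<le> 8 * s ^ 3" if y: "y \<in> ball x s"
  proof -
    have "norm (y - x, s) \<le> norm (y - x) + \<bar>s\<bar>"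
      by (auto simp: norm_Pair order_trans[OF sqrt_sum_squares_le_sum_abs])
    also have "\<dots> \<le> 2 * s" using y assms by (simp add: dist_norm norm_minus_commute)
    finally have "4 * bump (x, s) y * norm (y - x, s) \<le> (4 * s\<^sup>2) * (2 * s)"
      using b by (intro mult_mono) auto
    then show ?thesis by (simp add: power2_eq_square power3_eq_cube del: scaleR_Pair)
  qed
  then show "norm ((4 * bump (x, s) y) *\<^sub>R (y - x, s)) \<le> 8 * s ^ 3 * indicator (ball x s) y"
    using bump_eq_0[of "(x, s)" y] assms by (auto simp: indicator_def)
qed

lemma bump_grad_kernel_measurable [measurable]:
  "(\<lambda>y. (4 * bump \<xi> y) *\<^sub>R (y - fst \<xi>, snd \<xi>)) \<in> borel_measurable borel"
  unfolding bump_def by (intro borel_measurable_continuous_onI continuous_intros)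

lemma bump_integrable:
  assumes f: "Lp_loc_on 1 UNIV f" and s: "snd \<xi> \<ge> 0"
  shows "integrable lborel (\<lambda>y. f y *\<^sub>R (bump \<xi> y)\<^sup>2)"
    and "integrable lborel (\<lambda>y. f y *\<^sub>R ((4 * bump \<xi> y) *\<^sub>R (y - fst \<xi>, snd \<xi>)))"
proof -
  obtain x s where xi: "\<xi> = (x, s)" by force
  have ind: "(indicator (ball x s) y :: real) \<le> indicator (cball x s) y" for y
    by (auto simp: indicator_def)
  have "s ^ 4 * indicator (ball x s) y \<le> s ^ 4 * indicator (cball x s) y"
    "8 * s ^ 3 * indicator (ball x s) y \<le> 8 * s ^ 3 * indicator (cball x s) y" for y
    using ind[of y] s xi by (auto intro!: mult_left_mono)
  note b = order_trans[OF bump_kernel_bound(1) this(1)] order_trans[OF bump_kernel_bound(2) this(2)]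
  show "integrable lborel (\<lambda>y. f y *\<^sub>R (bump \<xi> y)\<^sup>2)"
    by (rule Lp_loc_on_1_integrable_mult[OF f, where C="s^4" and x=x and r=s])
       (use b(1) s xi in auto)
  show "integrable lborel (\<lambda>y. f y *\<^sub>R ((4 * bump \<xi> y) *\<^sub>R (y - fst \<xi>, snd \<xi>)))"
    by (rule Lp_loc_on_1_integrable_mult[OF f, where C="8 * s^3" and x=x and r=s])
       (use b(2) s xi in auto)
qed

text \<open>Integrating the pointwise remainder against |f| leaves an error \<open>C * I\<close>
  times the square of the increment, so no passage to the limit under the integral occurs.
  Increments shorter than \<open>min 1 s\<close> keep the perturbed scale nonnegative, as
  \<open>bump_integrable\<close> demands.\<close>

lemma bump_avg_has_derivative:
  fixes f :: "'a::euclidean_space \<Rightarrow> real"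
  assumes f: "Lp_loc_on 1 UNIV f" and s: "snd \<xi> > 0"
  shows "(bump_avg f has_derivative (\<lambda>v. bump_avg_grad f \<xi> \<bullet> v)) (at \<xi>)"
proof -
  obtain x s where xi: "\<xi> = (x, s)" and s0: "s > 0" using s by (cases \<xi>) auto
  define C where "C = (4 * \<bar>s\<bar> + 6)\<^sup>2 + 2 * s\<^sup>2"
  define I where "I = (\<integral>y. \<bar>f y\<bar> * indicator (cball x (\<bar>s\<bar> + 2)) y \<partial>lborel)"
  note [measurable] = Lp_loc_on_UNIV_measurable[OF f]
  have "integrable lborel (\<lambda>y. f y *\<^sub>R (indicator (cball x (\<bar>s\<bar> + 2)) y :: real))"
    by (rule Lp_loc_on_1_integrable_mult[OF f, where C=1 and x=x and r="\<bar>s\<bar>+2"])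
       (auto intro!: borel_measurable_indicator)
  then have intI: "integrable lborel (\<lambda>y. \<bar>f y\<bar> * indicator (cball x (\<bar>s\<bar> + 2)) y)"
    by (drule_tac integrable_abs) (simp add: abs_mult)
  have bnd: "\<bar>bump_avg f (\<xi> + v) - bump_avg f \<xi> - bump_avg_grad f \<xi> \<bullet> v\<bar> \<le> C * I * (norm v)\<^sup>2"
    if v: "norm v < min 1 s" for v
  proof -
    obtain h \<sigma> where hs: "v = (h, \<sigma>)" by force
    have n1: "norm (h, \<sigma>) \<le> 1" using v hs by simp
    have "\<bar>\<sigma>\<bar> \<le> norm v" using norm_snd_le[of \<sigma> h] hs by simp
    then have "snd (\<xi> + v) \<ge> 0" using v xi hs by auto
    note i1 = bump_integrable(1)[OF f this]
    note i2 = bump_integrable[OF f less_imp_le[OF s]]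
    note i3 = integrable_inner_left[OF i2(2), of v]
    let ?r = "\<lambda>y. f y *\<^sub>R (bump (\<xi> + v) y)\<^sup>2 - f y *\<^sub>R (bump \<xi> y)\<^sup>2
        - (f y *\<^sub>R ((4 * bump \<xi> y) *\<^sub>R (y - fst \<xi>, snd \<xi>))) \<bullet> v"
    have eq: "bump_avg f (\<xi> + v) - bump_avg f \<xi> - bump_avg_grad f \<xi> \<bullet> v = (\<integral>y. ?r y \<partial>lborel)"
      unfolding bump_avg_def bump_avg_grad_def
      by (subst Bochner_Integration.integral_diff, intro Bochner_Integration.integrable_diff i1 i2 i3, rule i3,
          subst Bochner_Integration.integral_diff, rule i1, rule i2, subst integral_inner_left) (use i2 in auto)
    have "\<bar>\<integral>y. ?r y \<partial>lborel\<bar> \<le> (\<integral>y. \<bar>?r y\<bar> \<partial>lborel)" by (rule integral_abs_bound)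
    also have "\<dots> \<le> (\<integral>y. (C * (norm v)\<^sup>2) * (\<bar>f y\<bar> * indicator (cball x (\<bar>s\<bar> + 2)) y) \<partial>lborel)"
    proof (rule integral_mono)
      show "integrable lborel (\<lambda>y. \<bar>?r y\<bar>)"
        by (intro integrable_abs Bochner_Integration.integrable_diff i1 i2 i3)
      show "integrable lborel (\<lambda>y. (C * (norm v)\<^sup>2) * (\<bar>f y\<bar> * indicator (cball x (\<bar>s\<bar> + 2)) y))"
        by (intro integrable_mult_right intI)
      fix y
      have "?r y = f y * ((bump (x + h, s + \<sigma>) y)\<^sup>2 - (bump (x, s) y)\<^sup>2 - 4 * bump (x, s) y * ((y - x, s) \<bullet> (h, \<sigma>)))"
        by (simp add: xi hs algebra_simps)
      then have "\<bar>?r y\<bar> = \<bar>f y\<bar> * \<bar>(bump (x + h, s + \<sigma>) y)\<^sup>2 - (bump (x, s) y)\<^sup>2 - 4 * bump (x, s) y * ((y - x, s) \<bullet> (h, \<sigma>))\<bar>"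
        by (simp only: abs_mult)
      also have "\<dots> \<le> \<bar>f y\<bar> * (((4 * \<bar>s\<bar> + 6)\<^sup>2 + 2 * s\<^sup>2) * indicator (cball x (\<bar>s\<bar> + 2)) y * (norm (h, \<sigma>))\<^sup>2)"
        by (intro mult_left_mono bump_square_remainder n1) auto
      finally show "\<bar>?r y\<bar> \<le> (C * (norm v)\<^sup>2) * (\<bar>f y\<bar> * indicator (cball x (\<bar>s\<bar> + 2)) y)"
        by (simp only: C_def hs mult_ac)
    qed
    also have "\<dots> = C * I * (norm v)\<^sup>2" unfolding I_def by simp
    finally show ?thesis using eq by simp
  qed
  show ?thesis
  proof (rule has_derivativeI_sandwich[where e="min 1 s" and H="\<lambda>\<zeta>. C * I * norm (\<zeta> - \<xi>)"])
    show "0 < min 1 s" using s0 by simp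
    show "bounded_linear (\<lambda>v. bump_avg_grad f \<xi> \<bullet> v)" by (rule bounded_linear_inner_right)
    fix \<zeta> assume z: "\<zeta> \<noteq> \<xi>" "dist \<zeta> \<xi> < min 1 s"
    then have "\<bar>bump_avg f \<zeta> - bump_avg f \<xi> - bump_avg_grad f \<xi> \<bullet> (\<zeta> - \<xi>)\<bar> \<le> C * I * (norm (\<zeta> - \<xi>))\<^sup>2"
      using bnd[of "\<zeta> - \<xi>"] by (simp add: dist_norm)
    then show "norm (bump_avg f \<zeta> - bump_avg f \<xi> - bump_avg_grad f \<xi> \<bullet> (\<zeta> - \<xi>)) / norm (\<zeta> - \<xi>)
        \<le> C * I * norm (\<zeta> - \<xi>)"
      using z by (simp add: field_simps power2_eq_square)
  next
    have "((\<lambda>\<zeta>. C * I * norm (\<zeta> - \<xi>)) \<longlongrightarrow> C * I * norm (\<xi> - \<xi>)) (at \<xi>)"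
      by (intro tendsto_intros)
    then show "((\<lambda>\<zeta>. C * I * norm (\<zeta> - \<xi>)) \<longlongrightarrow> 0) (at \<xi>)" by simp
  qed
qed

section \<open>The vector space of locally integrable functions\<close>

lemma Lp_on_1_of_set_integrable:
  assumes f [measurable]: "f \<in> borel_measurable borel" and K [measurable]: "K \<in> sets borel"
    and int: "set_integrable lborel K f"
  shows "Lp_on 1 K f"
proof -
  have "(\<integral>\<^sup>+x. ennreal (norm (indicator K x *\<^sub>R f x)) \<partial>lborel) < \<infinity>"
    using int unfolding set_integrable_def by (simp add: integrable_iff_bounded)
  moreover have "(\<integral>\<^sup>+x. ennreal (\<bar>f x\<bar> powr 1) * indicator K x \<partial>lborel)
      = (\<integral>\<^sup>+x. ennreal (norm (indicator K x *\<^sub>R f x)) \<partial>lborel)"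
    by (intro nn_integral_cong) (auto simp: indicator_def)
  ultimately show ?thesis unfolding Lp_on_def set_borel_measurable_def by simp
qed

lemma Lp_loc_on_1_iff:
  "Lp_loc_on 1 UNIV f \<longleftrightarrow> f \<in> borel_measurable borel \<and> (\<forall>K. compact K \<longrightarrow> set_integrable lborel K f)"
proof (intro iffI conjI allI impI)
  assume f: "f \<in> borel_measurable borel \<and> (\<forall>K. compact K \<longrightarrow> set_integrable lborel K f)"
  then have "Lp_on 1 K f" if "compact K" for K
    using that by (auto intro: Lp_on_1_of_set_integrable borel_compact)
  then show "Lp_loc_on 1 UNIV f"
    using f unfolding Lp_loc_on_def set_borel_measurable_def by simp
qed (auto intro: Lp_loc_on_UNIV_measurable Lp_loc_on_1_set_integrable)

lemma Lp_loc_on_1_lincomb: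
  assumes f: "Lp_loc_on 1 UNIV f" and g: "Lp_loc_on 1 UNIV g"
  shows "Lp_loc_on 1 UNIV (\<lambda>x. \<alpha> * f x + \<beta> * g x)"
  using assms unfolding Lp_loc_on_1_iff
  by (auto intro!: set_integral_add set_integrable_mult_right borel_measurable_add borel_measurable_times)

lemma Lp_loc_on_1_const: "Lp_loc_on 1 UNIV (\<lambda>x. c)"
  unfolding Lp_loc_on_1_iff set_integrable_def
  using borel_integrable_compact[of _ "\<lambda>_. c"] by auto

lemma Lp_loc_on_1_diff_const:
  assumes f: "Lp_loc_on 1 UNIV f"
  shows "Lp_loc_on 1 UNIV (\<lambda>y. f y - c)"
  using Lp_loc_on_1_lincomb[OF f Lp_loc_on_1_const[of 1], of 1 "- c"] by simp

section \<open>Normalised mollification and its bounds by local L1 norms\<close>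

abbreviation bump_mass :: "'a::euclidean_space \<times> real \<Rightarrow> real" where
  "bump_mass \<equiv> bump_avg (\<lambda>_. 1)"

definition mollify :: "('a::euclidean_space \<Rightarrow> real) \<Rightarrow> 'a \<times> real \<Rightarrow> real" where
  "mollify f \<xi> = bump_avg f \<xi> / bump_mass \<xi>"

definition mollify_grad :: "('a::euclidean_space \<Rightarrow> real) \<Rightarrow> 'a \<times> real \<Rightarrow> 'a \<times> real" where
  "mollify_grad f \<xi> = (1 / bump_mass \<xi>) *\<^sub>R bump_avg_grad f \<xi>
     - (bump_avg f \<xi> / (bump_mass \<xi>)\<^sup>2) *\<^sub>R bump_avg_grad (\<lambda>_. 1) \<xi>"

lemma bump_avg_lincomb:
  assumes "Lp_loc_on 1 UNIV f" "Lp_loc_on 1 UNIV g" "snd \<xi> \<ge> 0"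
  shows "bump_avg (\<lambda>y. \<alpha> * f y + \<beta> * g y) \<xi> = \<alpha> * bump_avg f \<xi> + \<beta> * bump_avg g \<xi>"
proof -
  note i = bump_integrable(1)[OF assms(1,3)] bump_integrable(1)[OF assms(2,3)]
  have "bump_avg (\<lambda>y. \<alpha> * f y + \<beta> * g y) \<xi>
      = (\<integral>y. \<alpha> * (f y *\<^sub>R (bump \<xi> y)\<^sup>2) + \<beta> * (g y *\<^sub>R (bump \<xi> y)\<^sup>2) \<partial>lborel)"
    unfolding bump_avg_def by (simp add: algebra_simps)
  also have "\<dots> = \<alpha> * bump_avg f \<xi> + \<beta> * bump_avg g \<xi>"
    unfolding bump_avg_def using i
    by (subst Bochner_Integration.integral_add) (auto intro!: integrable_mult_right)
  finally show ?thesis .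
qed

lemma mollify_lincomb:
  assumes "Lp_loc_on 1 UNIV f" "Lp_loc_on 1 UNIV g" "snd \<xi> \<ge> 0"
  shows "mollify (\<lambda>y. \<alpha> * f y + \<beta> * g y) \<xi> = \<alpha> * mollify f \<xi> + \<beta> * mollify g \<xi>"
  unfolding mollify_def bump_avg_lincomb[OF assms] by (simp add: add_divide_distrib)

text \<open>On the concentric ball of radius s/2 the bump is at least (3/4) s^2. Its square gives
  (9/16) s^4, and the volume of that ball gives the rest.\<close>

lemma bump_mass_bound:
  fixes x :: "'a::euclidean_space"
  assumes "s > 0"
  shows "bump_mass (x, s) \<ge> 9 / 16 * unit_ball_vol DIM('a) / 2 ^ DIM('a) * s ^ (DIM('a) + 4)"
proof -
  have i: "integrable lborel (\<lambda>y. (bump (x, s) y)\<^sup>2)"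
    using bump_integrable(1)[OF Lp_loc_on_1_const[of 1], of "(x, s)"] assms by simp
  have "9 / 16 * unit_ball_vol DIM('a) / 2 ^ DIM('a) * s ^ (DIM('a) + 4)
      = 9 / 16 * s ^ 4 * measure lborel (ball x (s / 2))"
    using assms by (simp add: content_ball power_add power_divide)
  also have "\<dots> = (\<integral>y. 9 / 16 * s ^ 4 * indicator (ball x (s / 2)) y \<partial>lborel)"
    by simp
  also have "\<dots> \<le> (\<integral>y. (bump (x, s) y)\<^sup>2 \<partial>lborel)"
  proof (rule integral_mono)
    show "integrable lborel (\<lambda>y. 9 / 16 * s ^ 4 * indicat_real (ball x (s / 2)) y)"
      by (intro integrable_mult_right integrable_real_indicator)
         (use assms in \<open>auto simp: emeasure_ball\<close>)
    fix y
    show "9 / 16 * s ^ 4 * indicat_real (ball x (s / 2)) y \<le> (bump (x, s) y)\<^sup>2"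
    proof (cases "y \<in> ball x (s / 2)")
      case True
      then have "(norm (y - x))\<^sup>2 \<le> (s / 2)\<^sup>2"
        by (intro power_mono) (auto simp: dist_norm norm_minus_commute)
      then have "3 / 4 * s\<^sup>2 \<le> bump (x, s) y" by (simp add: bump_def power_divide le_max_iff_disj)
      then have "(3 / 4 * s\<^sup>2)\<^sup>2 \<le> (bump (x, s) y)\<^sup>2" by (intro power_mono) auto
      then show ?thesis using True by (simp add: power_mult_distrib power_divide)
    qed simp
  qed (use i in simp)
  also have "\<dots> = bump_mass (x, s)" by (simp add: bump_avg_def)
  finally show ?thesis .
qed

lemma bump_mass_pos:
  fixes \<xi> :: "'a::euclidean_space \<times> real"
  assumes "snd \<xi> > 0"
  shows "bump_mass \<xi> > 0"
proof -
  obtain x s where xi: "\<xi> = (x, s)" by force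
  have "0 < 9 / 16 * unit_ball_vol DIM('a) / 2 ^ DIM('a) * s ^ (DIM('a) + 4)"
    using assms xi by simp
  also have "\<dots> \<le> bump_mass (x, s)" by (rule bump_mass_bound) (use assms xi in simp)
  finally show ?thesis using xi by simp
qed

lemma mollify_diff_const:
  assumes "Lp_loc_on 1 UNIV f" "snd \<xi> > 0"
  shows "mollify (\<lambda>y. f y - c) \<xi> = mollify f \<xi> - c"
proof -
  have "mollify (\<lambda>y. f y - c) \<xi> = mollify f \<xi> - c * mollify (\<lambda>_. 1) \<xi>"
    using mollify_lincomb[OF assms(1) Lp_loc_on_1_const[of 1], of \<xi> 1 "- c"] assms by simp
  moreover have "mollify (\<lambda>_. 1) \<xi> = 1"
    using bump_mass_pos[OF assms(2)] by (simp add: mollify_def)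
  ultimately show ?thesis by simp
qed

lemma mollify_has_derivative:
  fixes f :: "'a::euclidean_space \<Rightarrow> real"
  assumes f: "Lp_loc_on 1 UNIV f" and s: "snd \<xi> > 0"
  shows "(mollify f has_derivative (\<lambda>v. mollify_grad f \<xi> \<bullet> v)) (at \<xi>)"
proof -
  note A = bump_avg_has_derivative[OF f s]
  note B = bump_avg_has_derivative[OF Lp_loc_on_1_const[of 1] s]
  have "((\<lambda>\<zeta>. bump_avg f \<zeta> / bump_mass \<zeta>) has_derivative (\<lambda>v. mollify_grad f \<xi> \<bullet> v)) (at \<xi>)"
    using bump_mass_pos[OF s]
    by (auto intro!: derivative_eq_intros A B simp: mollify_grad_def inner_diff_left field_simps power2_eq_square fun_eq_iff)
  then show ?thesis by (simp add: mollify_def[abs_def])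
qed

text \<open>Both vectors represent the derivative of \<open>mollify f\<close> minus a constant, so
  they agree by uniqueness of derivatives; no identity between the defining integrals has to be
  computed.\<close>

lemma mollify_grad_diff_const:
  fixes f :: "'a::euclidean_space \<Rightarrow> real"
  assumes f: "Lp_loc_on 1 UNIV f" and s: "snd \<xi> > 0"
  shows "mollify_grad (\<lambda>y. f y - c) \<xi> = mollify_grad f \<xi>"
proof -
  have "(mollify (\<lambda>y. f y - c) has_derivative (\<lambda>v. mollify_grad (\<lambda>y. f y - c) \<xi> \<bullet> v)) (at \<xi>)"
    by (rule mollify_has_derivative[OF Lp_loc_on_1_diff_const[OF f] s])
  moreover have "open {\<zeta> :: 'a \<times> real. snd \<zeta> > 0}"
    by (intro open_Collect_less continuous_intros)
  ultimately have 1: "((\<lambda>\<zeta>. mollify f \<zeta> - c) has_derivative (\<lambda>v. mollify_grad (\<lambda>y. f y - c) \<xi> \<bullet> v)) (at \<xi>)"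
    by (rule has_derivative_transform_within_open) (use s mollify_diff_const[OF f] in auto)
  have 2: "((\<lambda>\<zeta>. mollify f \<zeta> - c) has_derivative (\<lambda>v. mollify_grad f \<xi> \<bullet> v)) (at \<xi>)"
    by (auto intro!: derivative_eq_intros mollify_has_derivative f s)
  have "mollify_grad (\<lambda>y. f y - c) \<xi> \<bullet> v = mollify_grad f \<xi> \<bullet> v" for v
    using has_derivative_unique[OF 1 2] by metis
  then show ?thesis by (metis vector_eq_rdot)
qed

lemma bump_avg_bounds:
  fixes f :: "'a::euclidean_space \<Rightarrow> real"
  assumes f: "Lp_loc_on 1 UNIV f" and s: "s \<ge> 0"
  shows "\<bar>bump_avg f (x, s)\<bar> \<le> s ^ 4 * (LINT y:ball x s|lborel. \<bar>f y\<bar>)"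
    and "norm (bump_avg_grad f (x, s)) \<le> 8 * s ^ 3 * (LINT y:ball x s|lborel. \<bar>f y\<bar>)"
proof -
  have "set_integrable lborel (ball x s) f"
    by (rule set_integrable_subset[OF Lp_loc_on_1_set_integrable[OF f compact_cball[of x s]]]) auto
  then have i: "integrable lborel (\<lambda>y. indicator (ball x s) y * \<bar>f y\<bar>)"
    using set_integrable_abs[of lborel "ball x s" f] by (simp add: set_integrable_def)
  have "\<bar>bump_avg f (x, s)\<bar> \<le> (\<integral>y. s ^ 4 * (indicator (ball x s) y * \<bar>f y\<bar>) \<partial>lborel)"
    unfolding bump_avg_def
  proof (rule order_trans[OF integral_abs_bound], rule integral_mono)
    fix y
    show "\<bar>f y *\<^sub>R (bump (x, s) y)\<^sup>2\<bar> \<le> s ^ 4 * (indicator (ball x s) y * \<bar>f y\<bar>)"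
      using mult_left_mono[OF bump_kernel_bound(1)[OF s, of x y], of "\<bar>f y\<bar>"]
      by (simp add: abs_mult mult_ac)
  qed (use bump_integrable(1)[OF f, of "(x, s)"] s i in \<open>auto intro: integrable_abs integrable_mult_right\<close>)
  then show "\<bar>bump_avg f (x, s)\<bar> \<le> s ^ 4 * (LINT y:ball x s|lborel. \<bar>f y\<bar>)"
    by (simp add: set_lebesgue_integral_def)
  have "norm (bump_avg_grad f (x, s)) \<le> (\<integral>y. (8 * s ^ 3) * (indicator (ball x s) y * \<bar>f y\<bar>) \<partial>lborel)"
    unfolding bump_avg_grad_def
  proof (rule order_trans[OF integral_norm_bound], rule integral_mono)
    fix y
    have "norm (f y *\<^sub>R ((4 * bump (x, s) y) *\<^sub>R (y - x, s))) = \<bar>f y\<bar> * norm ((4 * bump (x, s) y) *\<^sub>R (y - x, s))"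
      by (simp only: norm_scaleR)
    also have "\<dots> \<le> \<bar>f y\<bar> * (8 * s ^ 3 * indicator (ball x s) y)"
      by (intro mult_left_mono bump_kernel_bound(2) s) simp
    finally show "norm (f y *\<^sub>R ((4 * bump (x, s) y) *\<^sub>R (y - fst (x, s), snd (x, s)))) \<le> 8 * s ^ 3 * (indicator (ball x s) y * \<bar>f y\<bar>)"
      by (simp add: mult_ac)
  next
    show "integrable lborel (\<lambda>y. norm (f y *\<^sub>R ((4 * bump (x, s) y) *\<^sub>R (y - fst (x, s), snd (x, s)))))"
      by (rule integrable_norm, rule bump_integrable(2)[OF f]) (use s in simp)
    show "integrable lborel (\<lambda>y. 8 * s ^ 3 * (indicator (ball x s) y * \<bar>f y\<bar>))"
      using i by (rule integrable_mult_right)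
  qed
  then show "norm (bump_avg_grad f (x, s)) \<le> 8 * s ^ 3 * (LINT y:ball x s|lborel. \<bar>f y\<bar>)"
    by (simp add: set_lebesgue_integral_def)
qed

text \<open>A count of powers: the average and its gradient carry s^4 and s^3, while the mass is at
  least a multiple of s^(n+4). The quotients leave s^(-n) and s^(-n-1).\<close>

lemma mollify_L1_bounds:
  "\<exists>C>0. \<forall>f (x::'a::euclidean_space) s. Lp_loc_on 1 UNIV f \<and> s > 0 \<longrightarrow>
     \<bar>mollify f (x, s)\<bar> \<le> C / s ^ DIM('a) * (LINT y:ball x s|lborel. \<bar>f y\<bar>) \<and>
     norm (mollify_grad f (x, s)) \<le> C / s ^ (DIM('a) + 1) * (LINT y:ball x s|lborel. \<bar>f y\<bar>)"
proof -
  define n where "n = DIM('a)"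
  define \<omega> where "\<omega> = unit_ball_vol n"
  define b where "b = 9 / 16 * \<omega> / 2 ^ n"
  have pos: "\<omega> > 0" "b > 0" by (auto simp: \<omega>_def b_def)
  \<comment> \<open>The two summands are the contributions of the two terms of the quotient rule for
    the gradient.\<close>
  define C where "C = 8 / b + 8 * \<omega> / b\<^sup>2"
  have C: "C > 0" "1 / b \<le> C" using pos by (auto simp: C_def add_pos_pos divide_right_mono field_simps add_increasing2)
  have "\<bar>mollify f (x, s)\<bar> \<le> C / s ^ n * (LINT y:ball x s|lborel. \<bar>f y\<bar>) \<and>
     norm (mollify_grad f (x, s)) \<le> C / s ^ (n + 1) * (LINT y:ball x s|lborel. \<bar>f y\<bar>)"
    if f: "Lp_loc_on 1 UNIV f" and s: "s > 0" for f and x :: 'a and s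
  proof -
    define I where "I = (LINT y:ball x s|lborel. \<bar>f y\<bar>)"
    define B where "B = bump_mass (x, s)"
    have I0: "I \<ge> 0" unfolding I_def set_lebesgue_integral_def by (intro integral_nonneg_AE) auto
    have B: "B \<ge> b * s ^ (n + 4)" unfolding B_def b_def \<omega>_def n_def using bump_mass_bound[OF s, of x] by simp
    have bs: "b * s ^ (n + 4) > 0" using pos s by simp
    have A: "\<bar>bump_avg f (x, s)\<bar> \<le> s ^ 4 * I" "norm (bump_avg_grad f (x, s)) \<le> 8 * s ^ 3 * I"
      using bump_avg_bounds[OF f, of s x] s by (auto simp: I_def)
    have "norm (bump_avg_grad (\<lambda>_. 1) (x, s)) \<le> 8 * s ^ 3 * (LINT y:ball x s|lborel. \<bar>1::real\<bar>)"
      using bump_avg_bounds(2)[OF Lp_loc_on_1_const[of 1], of s x] s by simp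
    also have "(LINT y:ball x s|lborel. \<bar>1::real\<bar>) = \<omega> * s ^ n"
      using s by (simp add: set_lebesgue_integral_def content_ball \<omega>_def n_def)
    finally have B': "norm (bump_avg_grad (\<lambda>_. 1) (x, s)) \<le> 8 * s ^ 3 * (\<omega> * s ^ n)" .
    have "\<bar>mollify f (x, s)\<bar> = \<bar>bump_avg f (x, s)\<bar> / B"
      unfolding mollify_def B_def[symmetric] using B bs by simp
    also have "\<dots> \<le> (s ^ 4 * I) / (b * s ^ (n + 4))"
      using A B bs I0 s by (intro frac_le) auto
    also have "\<dots> = (1 / b) / s ^ n * I" using s by (simp add: power_add field_simps)
    also have "\<dots> \<le> C / s ^ n * I" using C I0 s by (intro mult_right_mono divide_right_mono) auto
    finally have 1: "\<bar>mollify f (x, s)\<bar> \<le> C / s ^ n * I" .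
    have "norm (mollify_grad f (x, s)) \<le> norm (bump_avg_grad f (x, s)) / B
        + \<bar>bump_avg f (x, s)\<bar> * norm (bump_avg_grad (\<lambda>_. 1) (x, s)) / B\<^sup>2"
      unfolding mollify_grad_def B_def[symmetric]
      by (rule order_trans[OF norm_triangle_ineq4]) (use B bs in simp)
    also have "\<dots> \<le> (8 * s ^ 3 * I) / (b * s ^ (n + 4)) + (s ^ 4 * I) * (8 * s ^ 3 * (\<omega> * s ^ n)) / (b * s ^ (n + 4))\<^sup>2"
      using A B B' bs I0 s pos by (intro add_mono frac_le mult_mono power_mono) auto
    also have "\<dots> = C / s ^ (n + 1) * I"
      using s pos by (simp add: C_def power_add field_simps power2_eq_square eval_nat_numeral)
    finally show ?thesis using 1 by (simp add: I_def)
  qed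
  then show ?thesis using C(1) unfolding n_def by blast
qed

section \<open>Jensen's inequality on a set of finite measure\<close>

lemma powr_tangent_le:
  fixes p t l :: real
  assumes "p > 1" "t \<ge> 0" "l \<ge> 0"
  shows "p * l powr (p - 1) * t \<le> t powr p + (p - 1) * l powr p"
proof -
  have "t * l powr (p - 1) \<le> t powr p / p + (l powr (p - 1)) powr (p / (p - 1)) / (p / (p - 1))"
    using assms by (intro Youngs_inequality) (auto simp: field_simps)
  also have "(l powr (p - 1)) powr (p / (p - 1)) = l powr p" using assms by (simp add: powr_powr)
  finally show ?thesis using assms by (simp add: field_simps)
qed

text \<open>The tangent-line inequality for t -> t^p is integrated over \<open>S\<close> with the
  mean \<open>l\<close> of |g| as point of tangency. With that choice the linear terms combine to m'
  l^p <= J, which is Jensen's inequality.\<close>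

lemma set_integral_powr_le:
  fixes g :: "'a \<Rightarrow> real"
  assumes p: "p > 1" and g: "set_integrable M S g" and S [measurable]: "S \<in> sets M" "emeasure M S < \<infinity>"
    and m: "measure M S > 0" and [measurable]: "g \<in> borel_measurable M"
  shows "ennreal ((LINT y:S|M. \<bar>g y\<bar>) powr p) \<le>
     ennreal (measure M S powr (p - 1)) * (\<integral>\<^sup>+y\<in>S. ennreal (\<bar>g y\<bar> powr p) \<partial>M)"
proof (cases "(\<integral>\<^sup>+y\<in>S. ennreal (\<bar>g y\<bar> powr p) \<partial>M) = \<infinity>")
  case True
  then show ?thesis using m by (simp add: ennreal_mult_top)
next
  case False
  define I where "I = (LINT y:S|M. \<bar>g y\<bar>)"
  define m' where "m' = measure M S"
  have I0: "I \<ge> 0" unfolding I_def set_lebesgue_integral_def by (intro integral_nonneg_AE) auto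
  define l where "l = I / m'"
  have l: "l \<ge> 0" "I = m' * l" using I0 m by (auto simp: l_def m'_def)
  have eq: "(\<integral>\<^sup>+y\<in>S. ennreal (\<bar>g y\<bar> powr p) \<partial>M) = (\<integral>\<^sup>+y. ennreal (indicator S y * \<bar>g y\<bar> powr p) \<partial>M)"
    by (intro nn_integral_cong) (auto simp: indicator_def)
  have ip: "integrable M (\<lambda>y. indicator S y * \<bar>g y\<bar> powr p)"
    using False eq by (intro integrableI_nonneg) (auto simp: top.not_eq_extremum)
  have ig: "integrable M (\<lambda>y. indicator S y * \<bar>g y\<bar>)"
    using set_integrable_abs[OF g] by (simp add: set_integrable_def)
  have iS: "integrable M (indicator S :: _ \<Rightarrow> real)" using S by (simp add: integrable_indicator_iff)
  define J where "J = (\<integral>y. indicator S y * \<bar>g y\<bar> powr p \<partial>M)"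
  have "p * l powr (p - 1) * I = (\<integral>y. p * l powr (p - 1) * (indicator S y * \<bar>g y\<bar>) \<partial>M)"
    by (simp add: I_def set_lebesgue_integral_def)
  also have "\<dots> \<le> (\<integral>y. indicator S y * \<bar>g y\<bar> powr p + (p - 1) * l powr p * indicator S y \<partial>M)"
  proof (rule integral_mono)
    fix y
    show "p * l powr (p - 1) * (indicator S y * \<bar>g y\<bar>) \<le> indicator S y * \<bar>g y\<bar> powr p + (p - 1) * l powr p * indicator S y"
      using powr_tangent_le[OF p, of "\<bar>g y\<bar>" l] l by (auto simp: indicator_def)
  qed (use ip ig iS in auto)
  also have "\<dots> = J + (p - 1) * l powr p * m'"
    unfolding J_def m'_def using ip iS by (subst Bochner_Integration.integral_add) auto
  finally have "p * (l powr (p - 1) * l) * m' \<le> J + (p - 1) * l powr p * m'" using l by (simp add: mult_ac)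
  moreover have "l powr (p - 1) * l = l powr p"
    using l p by (cases "l = 0") (auto simp: powr_diff)
  ultimately have "p * l powr p * m' \<le> J + (p - 1) * l powr p * m'" by metis
  then have J: "m' * l powr p \<le> J" by (simp add: algebra_simps)
  have "I powr p = m' powr (p - 1) * (m' * l powr p)"
    using l m by (simp add: powr_mult m'_def powr_diff)
  also have "\<dots> \<le> m' powr (p - 1) * J" using J by (intro mult_left_mono) auto
  finally have "ennreal (I powr p) \<le> ennreal (m' powr (p - 1)) * ennreal J"
    by (simp add: ennreal_mult' [symmetric] ennreal_leI)
  also have "ennreal J = (\<integral>\<^sup>+y\<in>S. ennreal (\<bar>g y\<bar> powr p) \<partial>M)"
    unfolding eq J_def by (rule nn_integral_eq_integral[symmetric]) (use ip in auto)
  finally show ?thesis by (simp add: I_def m'_def)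
qed

section \<open>The screened seminorm\<close>

lemma powr_sum3_le:
  fixes a b c p :: real
  assumes "a \<ge> 0" "b \<ge> 0" "c \<ge> 0" "p > 0"
  shows "(a + b + c) powr p \<le> 3 powr p * (a powr p + b powr p + c powr p)"
proof -
  define m where "m = max a (max b c)"
  have "(a + b + c) powr p \<le> (3 * m) powr p"
    using assms by (intro powr_mono2) (auto simp: m_def)
  also have "\<dots> = 3 powr p * m powr p" using assms by (simp add: powr_mult m_def)
  also have "m powr p \<le> a powr p + b powr p + c powr p"
    using assms by (auto simp: m_def max_def)
  finally show ?thesis by simp
qed

lemma nn_integral_lborel_translate:
  fixes g :: "'a::euclidean_space \<Rightarrow> ennreal"
  assumes [measurable]: "g \<in> borel_measurable borel"
  shows "(\<integral>\<^sup>+y. g (c + y) \<partial>lborel) = (\<integral>\<^sup>+y. g y \<partial>lborel)"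
  using nn_integral_distr[of "(+) c" lborel borel g] lborel_distr_plus[of c] by simp

lemma nn_integral_lborel_Pair:
  fixes g :: "'a::euclidean_space \<times> 'b::euclidean_space \<Rightarrow> ennreal"
  assumes "g \<in> borel_measurable borel"
  shows "(\<integral>\<^sup>+z. g z \<partial>lborel) = (\<integral>\<^sup>+x. (\<integral>\<^sup>+t. g (x, t) \<partial>lborel) \<partial>lborel)"
  using assms by (subst lborel.nn_integral_fst) (simp_all add: lborel_prod borel_prod)

lemma open_strip: "open (strip b1 b2)"
  unfolding strip_def by (intro open_Collect_conj open_Collect_less continuous_intros)

lemma strip_measurable [measurable]: "strip b1 b2 \<in> sets borel"
  by (simp add: open_strip borel_open)

text \<open>The exponent is what remains when the p-th power of s^(-n-1) times an integral over the
  ball of radius s is treated by Jensen: - p (n + 1) + n (p - 1) = - (n + p). The ball appears as a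
  condition on \<open>norm h\<close>, so that the integrand is visibly jointly measurable in
  \<open>z\<close> and \<open>h\<close>.\<close>

definition diff_energy :: "real \<Rightarrow> ('a::euclidean_space \<Rightarrow> real) \<Rightarrow> 'a \<times> real \<Rightarrow> ennreal" where
  "diff_energy p f z = ennreal (snd z powr - (real DIM('a) + p)) *
     (\<integral>\<^sup>+h. (if norm h < snd z then ennreal (\<bar>f (fst z + h) - f (fst z)\<bar> powr p) else 0) \<partial>lborel)"

definition screened_energy :: "real \<Rightarrow> real \<Rightarrow> ('a::euclidean_space \<Rightarrow> real) \<Rightarrow> ennreal" where
  "screened_energy p a f = (\<integral>\<^sup>+x. (\<integral>\<^sup>+h\<in>ball 0 a.
        ennreal (\<bar>f (x + h) - f x\<bar> powr p / norm h powr (p + real DIM('a) - 1)) \<partial>lborel) \<partial>lborel)"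

text \<open>Since powers of infinity are set to infinity, the root and the p-th power cancel also
  when the double integral diverges. All estimates can therefore be made for the double integral
  itself.\<close>

lemma screened_seminorm_powr:
  assumes "p > 0"
  shows "ennreal_powr (screened_seminorm p a f) p = screened_energy p a f"
    and "screened_seminorm p a f < \<infinity> \<longleftrightarrow> screened_energy p a f < \<infinity>"
proof -
  have *: "screened_seminorm p a f = ennreal_powr (screened_energy p a f) (1 / p)"
    by (simp add: screened_seminorm_def screened_energy_def)
  show "ennreal_powr (screened_seminorm p a f) p = screened_energy p a f"
    unfolding * ennreal_powr_def using assms
    by (auto simp: powr_powr ennreal_enn2real_if)
  show "screened_seminorm p a f < \<infinity> \<longleftrightarrow> screened_energy p a f < \<infinity>"
    unfolding * ennreal_powr_def by (auto simp: top.not_eq_extremum)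
qed

lemma diff_energy_measurable [measurable]:
  fixes f :: "'a::euclidean_space \<Rightarrow> real"
  assumes [measurable]: "f \<in> borel_measurable borel"
  shows "diff_energy p f \<in> borel_measurable borel"
proof -
  have "diff_energy p f \<in> borel_measurable (borel \<Otimes>\<^sub>M borel)"
    unfolding diff_energy_def by measurable
  then show ?thesis by (simp add: borel_prod)
qed

lemma diff_energy_affine_measurable [measurable]:
  fixes f :: "'a::euclidean_space \<Rightarrow> real"
  assumes [measurable]: "f \<in> borel_measurable borel"
  shows "(\<lambda>z. diff_energy p f (fst z, c + k * snd z)) \<in> borel_measurable borel"
proof -
  have "(\<lambda>z::'a \<times> real. (fst z, c + k * snd z)) \<in> borel_measurable borel"
    by (intro borel_measurable_continuous_onI continuous_intros)
  then show ?thesis by (rule measurable_compose) measurable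
qed

text \<open>Subtracting the constant \<open>f x\<close> changes the mollification by that constant
  and leaves the gradient unchanged, so the L1 bounds apply to \<open>g = f - f x\<close>, whose
  integral over the ball is then raised to the power p by Jensen.\<close>

lemma mollify_Lp_bounds:
  fixes p :: real
  assumes p: "p > 1"
  shows "\<exists>C>0. \<forall>f (x::'a::euclidean_space) s. Lp_loc_on 1 UNIV f \<and> s > 0 \<longrightarrow>
     ennreal (\<bar>mollify f (x, s) - f x\<bar> powr p) \<le> ennreal (C * s powr p) * diff_energy p f (x, s) \<and>
     ennreal (norm (mollify_grad f (x, s)) powr p) \<le> ennreal C * diff_energy p f (x, s)"
proof -
  obtain C :: real where C: "C > 0" "\<And>f (x::'a) s. Lp_loc_on 1 UNIV f \<Longrightarrow> s > 0 \<Longrightarrow>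
     \<bar>mollify f (x, s)\<bar> \<le> C / s ^ DIM('a) * (LINT y:ball x s|lborel. \<bar>f y\<bar>) \<and>
     norm (mollify_grad f (x, s)) \<le> C / s ^ (DIM('a) + 1) * (LINT y:ball x s|lborel. \<bar>f y\<bar>)"
    using mollify_L1_bounds[where 'a='a] by blast
  define n where "n = DIM('a)"
  define \<omega> where "\<omega> = unit_ball_vol n"
  have \<omega>: "\<omega> > 0" by (simp add: \<omega>_def)
  define K where "K = C powr p * \<omega> powr (p - 1)"
  have K: "K > 0" using C \<omega> by (simp add: K_def)
  have "ennreal (\<bar>mollify f (x, s) - f x\<bar> powr p) \<le> ennreal (K * s powr p) * diff_energy p f (x, s) \<and>
     ennreal (norm (mollify_grad f (x, s)) powr p) \<le> ennreal K * diff_energy p f (x, s)"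
    if f: "Lp_loc_on 1 UNIV f" and s: "s > 0" for f and x :: 'a and s
  proof -
    note [measurable] = Lp_loc_on_UNIV_measurable[OF f]
    define g where "g = (\<lambda>y. f y - f x)"
    have g: "Lp_loc_on 1 UNIV g" unfolding g_def by (rule Lp_loc_on_1_diff_const[OF f])
    define I where "I = (LINT y:ball x s|lborel. \<bar>g y\<bar>)"
    have I0: "I \<ge> 0" unfolding I_def set_lebesgue_integral_def by (intro integral_nonneg_AE) auto
    define N where "N = (\<integral>\<^sup>+y\<in>ball x s. ennreal (\<bar>g y\<bar> powr p) \<partial>lborel)"
    have "set_integrable lborel (ball x s) g"
      by (rule set_integrable_subset[OF Lp_loc_on_1_set_integrable[OF g compact_cball[of x s]]]) auto
    then have "ennreal (I powr p) \<le> ennreal (measure lborel (ball x s) powr (p - 1)) * N"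
      unfolding I_def N_def using s p Lp_loc_on_UNIV_measurable[OF g]
      by (intro set_integral_powr_le) (auto simp: emeasure_ball)
    also have "measure lborel (ball x s) = \<omega> * s ^ n"
      using s by (simp add: content_ball \<omega>_def n_def)
    finally have J: "ennreal (I powr p) \<le> ennreal ((\<omega> * s ^ n) powr (p - 1)) * N" .
    have [measurable]: "ball x s \<in> sets borel" by simp
    have "N = (\<integral>\<^sup>+h. ennreal (\<bar>g (x + h)\<bar> powr p) * indicator (ball x s) (x + h) \<partial>lborel)"
      unfolding N_def g_def by (rule nn_integral_lborel_translate[symmetric]) measurable
    also have "\<dots> = (\<integral>\<^sup>+h. (if norm h < s then ennreal (\<bar>f (x + h) - f x\<bar> powr p) else 0) \<partial>lborel)"
      unfolding g_def by (intro nn_integral_cong) (auto simp: indicator_def dist_norm)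
    finally have E: "diff_energy p f (x, s) = ennreal (s powr - (real n + p)) * N"
      by (simp only: diff_energy_def n_def fst_conv snd_conv)
    \<comment> \<open>The two estimates differ only by a factor s before the p-th power is taken: r
      = 1 serves the mollification and r = 0 its gradient.\<close>
    have bd: "ennreal (A powr p) \<le> ennreal (K * s powr (p * r)) * diff_energy p f (x, s)"
      if A: "0 \<le> A" "A \<le> C * s powr (r - (real n + 1)) * I" for A r
    proof -
      have "A powr p \<le> (C * s powr (r - (real n + 1)) * I) powr p"
        using A p by (intro powr_mono2) auto
      also have "\<dots> = C powr p * s powr (p * (r - (real n + 1))) * I powr p"
        using C(1) I0 by (simp add: powr_mult powr_powr mult.commute)
      finally have "ennreal (A powr p) \<le> ennreal (C powr p * s powr (p * (r - (real n + 1)))) * ennreal (I powr p)"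
        by (simp add: ennreal_mult'[symmetric] ennreal_leI)
      also have "\<dots> \<le> ennreal (C powr p * s powr (p * (r - (real n + 1)))) * (ennreal ((\<omega> * s ^ n) powr (p - 1)) * N)"
        by (intro mult_left_mono J) auto
      also have "\<dots> = ennreal (C powr p * s powr (p * (r - (real n + 1))) * (\<omega> * s ^ n) powr (p - 1)) * N"
        by (simp add: ennreal_mult' mult.assoc)
      also have "C powr p * s powr (p * (r - (real n + 1))) * (\<omega> * s ^ n) powr (p - 1)
          = K * s powr (p * r) * s powr - (real n + p)"
      proof -
        have "s powr (p * (r - (real n + 1))) * (s ^ n) powr (p - 1) = s powr (p * r) * s powr - (real n + p)"
          using s by (simp add: powr_realpow[symmetric] powr_powr powr_add[symmetric] algebra_simps)
        then show ?thesis using \<omega> s by (simp add: K_def powr_mult mult_ac)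
      qed
      also have "ennreal (K * s powr (p * r) * s powr - (real n + p)) * N
          = ennreal (K * s powr (p * r)) * diff_energy p f (x, s)"
        unfolding E using K by (simp add: ennreal_mult' mult.assoc)
      finally show ?thesis .
    qed
    have "\<bar>mollify g (x, s)\<bar> \<le> C / s ^ n * I"
      using C(2)[OF g s, of x] by (simp add: I_def n_def)
    also have "C / s ^ n * I = C * s powr (1 - (real n + 1)) * I"
      using s by (simp add: powr_minus_divide powr_realpow)
    finally have 1: "ennreal (\<bar>mollify g (x, s)\<bar> powr p) \<le> ennreal (K * s powr (p * 1)) * diff_energy p f (x, s)"
      by (intro bd) auto
    have "norm (mollify_grad g (x, s)) \<le> C / s ^ (n + 1) * I"
      using C(2)[OF g s, of x] by (simp add: I_def n_def)
    also have "C / s ^ (n + 1) * I = C * s powr (0 - (real (n + 1))) * I"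
      using s by (simp only: diff_0 powr_minus_divide powr_realpow) simp
    finally have 2: "ennreal (norm (mollify_grad g (x, s)) powr p) \<le> ennreal (K * s powr (p * 0)) * diff_energy p f (x, s)"
      by (intro bd) (auto simp: add_ac)
    show ?thesis
      using 1 2 s mollify_diff_const[OF f, of "(x, s)" "f x"] mollify_grad_diff_const[OF f, of "(x, s)" "f x"]
      by (simp add: g_def)
  qed
  then show ?thesis using K by blast
qed

section \<open>Integrating out the scale\<close>

lemma nn_integral_powr_tail:
  fixes q r :: real
  assumes q: "q > 0" and r: "r > 0"
  shows "(\<integral>\<^sup>+s. ennreal (s powr - (q + 1)) * indicator {r..} s \<partial>lborel) = ennreal (r powr - q / q)"
proof -
  have "(\<integral>\<^sup>+s. ennreal (s powr - (q + 1)) * indicator {r..} s \<partial>lborel) = ennreal (0 - (- (r powr - q / q)))"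
  proof (rule nn_integral_FTC_atLeast)
    fix s assume s: "r \<le> s"
    show "((\<lambda>s. - (s powr - q / q)) has_real_derivative s powr - (q + 1)) (at s)"
      using s r q by (auto intro!: derivative_eq_intros)
  next
    have "((\<lambda>s::real. s powr - q) \<longlongrightarrow> 0) at_top"
      using q by (intro tendsto_neg_powr filterlim_ident) auto
    then have "((\<lambda>s. - (s powr - q / q)) \<longlongrightarrow> - (0 / q)) at_top"
      using q by (intro tendsto_intros) auto
    then show "((\<lambda>s. - (s powr - q / q)) \<longlongrightarrow> 0) at_top" by simp
  qed auto
  then show ?thesis by simp
qed

text \<open>After Tonelli, a fixed \<open>h\<close> is seen only at scales s > |h|, and the integral
  of s^(-q-1) over these is |h|^(-q) / q with q = p + n - 1, the weight of the screened seminorm.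
  Scales never exceed \<open>a\<close>, so only |h| < a occurs. The slope \<open>k\<close> may be
  negative, for scales that shrink towards the top; the substitution costs 1 / |k|.\<close>

lemma nn_integral_diff_energy_le:
  fixes f :: "'a::euclidean_space \<Rightarrow> real"
  assumes [measurable]: "f \<in> borel_measurable borel" and p: "p > 1" and k: "k \<noteq> 0"
    and \<sigma>: "\<And>t. b1 < t \<Longrightarrow> t < b2 \<Longrightarrow> 0 < c + k * t \<and> c + k * t \<le> a"
  shows "(\<integral>\<^sup>+z\<in>strip b1 b2. diff_energy p f (fst z, c + k * snd z) \<partial>lborel)
    \<le> ennreal (1 / (\<bar>k\<bar> * (p + real DIM('a) - 1))) * screened_energy p a f"
proof -
  define q where "q = p + real DIM('a) - 1"
  have q: "q > 0" using p by (simp add: q_def add_pos_nonneg)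
  have [measurable]: "ball (0::'a) a \<in> sets borel" by simp
  define D where "D x h = ennreal (\<bar>f (x + h) - f x\<bar> powr p)" for x h
  have [measurable]: "(\<lambda>z. D (fst z) (snd z)) \<in> borel_measurable (borel \<Otimes>\<^sub>M borel)"
    unfolding D_def by measurable
  define W where "W h t = (if b1 < t \<and> t < b2 \<and> norm h < c + k * t then ennreal ((c + k * t) powr - (q + 1)) else 0)"
    for h :: 'a and t
  have [measurable]: "(\<lambda>z. W (fst z) (snd z)) \<in> borel_measurable (borel \<Otimes>\<^sub>M borel)"
    unfolding W_def by measurable
  have inner: "(\<integral>\<^sup>+t. W h t * D x h \<partial>lborel)
      \<le> ennreal (1 / (\<bar>k\<bar> * q)) * (ennreal (\<bar>f (x + h) - f x\<bar> powr p / norm h powr q) * indicator (ball 0 a) h)" for x h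
  proof (cases "h = 0 \<or> norm h \<ge> a")
    case True
    \<comment> \<open>At h = 0 the tail integral would diverge, but the difference of
      \<open>f\<close> vanishes there; for |h| >= a no admissible scale exceeds |h|.\<close>
    have "W h t * D x h = 0" for t
      using True \<sigma>[of t] p by (auto simp: W_def D_def)
    then have "(\<integral>\<^sup>+t. W h t * D x h \<partial>lborel) = 0" by (simp only: nn_integral_const mult_zero_left)
    then show ?thesis by simp
  next
    case False
    then have h: "norm h > 0" "norm h < a" by auto
    have "ennreal \<bar>k\<bar> * (\<integral>\<^sup>+t. W h t \<partial>lborel) \<le> ennreal \<bar>k\<bar> * (\<integral>\<^sup>+t. ennreal ((c + k * t) powr - (q + 1)) * indicator {norm h..} (c + k * t) \<partial>lborel)"
      by (intro mult_left_mono nn_integral_mono) (auto simp: W_def)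
    also have "\<dots> = (\<integral>\<^sup>+s. ennreal (s powr - (q + 1)) * indicator {norm h..} s \<partial>lborel)"
      by (rule nn_integral_real_affine[symmetric]) (use k in auto)
    also have "\<dots> = ennreal (norm h powr - q / q)"
      by (rule nn_integral_powr_tail) (use q h in auto)
    finally have "ennreal (1 / \<bar>k\<bar>) * (ennreal \<bar>k\<bar> * (\<integral>\<^sup>+t. W h t \<partial>lborel)) \<le> ennreal (1 / \<bar>k\<bar>) * ennreal (norm h powr - q / q)"
      by (intro mult_left_mono) auto
    also have "ennreal (1 / \<bar>k\<bar>) * (ennreal \<bar>k\<bar> * (\<integral>\<^sup>+t. W h t \<partial>lborel)) = (\<integral>\<^sup>+t. W h t \<partial>lborel)"
      using k by (simp add: mult.assoc[symmetric] ennreal_mult'[symmetric])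
    finally have le: "(\<integral>\<^sup>+t. W h t \<partial>lborel) * D x h \<le> (ennreal (1 / \<bar>k\<bar>) * ennreal (norm h powr - q / q)) * D x h"
      by (intro mult_right_mono) auto
    note le
    also have "(ennreal (1 / \<bar>k\<bar>) * ennreal (norm h powr - q / q)) * D x h = ennreal (1 / (\<bar>k\<bar> * q)) * (ennreal (\<bar>f (x + h) - f x\<bar> powr p / norm h powr q) * indicator (ball 0 a) h)"
      using h q by (simp add: D_def ennreal_mult'[symmetric] powr_minus_divide)
    moreover have "W h \<in> borel_measurable lborel" unfolding W_def by measurable
    ultimately show ?thesis by (simp only: nn_integral_multc)
  qed
  have "(\<integral>\<^sup>+z\<in>strip b1 b2. diff_energy p f (fst z, c + k * snd z) \<partial>lborel)
    = (\<integral>\<^sup>+x. (\<integral>\<^sup>+t. diff_energy p f (x, c + k * t) * indicator (strip b1 b2) (x, t) \<partial>lborel) \<partial>lborel)"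
    by (subst nn_integral_lborel_Pair)
       (auto intro!: borel_measurable_times_ennreal diff_energy_affine_measurable borel_measurable_indicator)
  also have "\<dots> = (\<integral>\<^sup>+x. (\<integral>\<^sup>+t. (\<integral>\<^sup>+h. W h t * D x h \<partial>lborel) \<partial>lborel) \<partial>lborel)"
  proof (intro nn_integral_cong)
    fix x t
    have "diff_energy p f (x, c + k * t) * indicator (strip b1 b2) (x, t)
      = (ennreal ((c + k * t) powr - (q + 1)) * indicator (strip b1 b2) (x, t)) * (\<integral>\<^sup>+h. (if norm h < c + k * t then D x h else 0) \<partial>lborel)"
      unfolding diff_energy_def D_def q_def fst_conv snd_conv by (simp add: mult_ac add_ac)
    also have "\<dots> = (\<integral>\<^sup>+h. (ennreal ((c + k * t) powr - (q + 1)) * indicator (strip b1 b2) (x, t)) * (if norm h < c + k * t then D x h else 0) \<partial>lborel)"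
      unfolding D_def by (rule nn_integral_cmult[symmetric]) measurable
    also have "\<dots> = (\<integral>\<^sup>+h. W h t * D x h \<partial>lborel)"
      by (intro nn_integral_cong) (auto simp: W_def strip_def indicator_def)
    finally show "diff_energy p f (x, c + k * t) * indicator (strip b1 b2) (x, t) = (\<integral>\<^sup>+h. W h t * D x h \<partial>lborel)" .
  qed
  also have "\<dots> = (\<integral>\<^sup>+x. (\<integral>\<^sup>+h. (\<integral>\<^sup>+t. W h t * D x h \<partial>lborel) \<partial>lborel) \<partial>lborel)"
    by (intro nn_integral_cong lborel_pair.Fubini') (simp add: W_def D_def)
  also have "\<dots> \<le> (\<integral>\<^sup>+x. (\<integral>\<^sup>+h. ennreal (1 / (\<bar>k\<bar> * q)) * (ennreal (\<bar>f (x + h) - f x\<bar> powr p / norm h powr q) * indicator (ball 0 a) h) \<partial>lborel) \<partial>lborel)"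
    by (intro nn_integral_mono inner)
  also have "\<dots> = ennreal (1 / (\<bar>k\<bar> * q)) * screened_energy p a f"
  proof -
    have "(\<integral>\<^sup>+h. ennreal (1 / (\<bar>k\<bar> * q)) * (ennreal (\<bar>f (x + h) - f x\<bar> powr p / norm h powr q) * indicator (ball 0 a) h) \<partial>lborel)
        = ennreal (1 / (\<bar>k\<bar> * q)) * (\<integral>\<^sup>+h\<in>ball 0 a. ennreal (\<bar>f (x + h) - f x\<bar> powr p / norm h powr q) \<partial>lborel)" for x
      by (rule nn_integral_cmult) measurable
    then show ?thesis
      unfolding screened_energy_def q_def[symmetric] by (simp add: nn_integral_cmult)
  qed
  finally show ?thesis unfolding q_def .
qed

text \<open>\<open>has_trace\<close> demands boundary values in L^p_loc, whereas the data are only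
  assumed in L^1_loc. At the fixed scale \<open>a\<close>, \<open>f\<close> differs from a locally
  bounded mollification by a function whose p-th power is controlled by \<open>diff_energy\<close>;
  there |h| < a gives a^(-q-1) <= |h|^(-q) / a, so the screened energy dominates.\<close>

lemma Lp_loc_on_of_screened:
  fixes f :: "'a::euclidean_space \<Rightarrow> real"
  assumes f: "Lp_loc_on 1 UNIV f" and p: "p > 1" and a: "a > 0" and fin: "screened_energy p a f < \<infinity>"
  shows "Lp_loc_on p UNIV f"
proof -
  note [measurable] = Lp_loc_on_UNIV_measurable[OF f]
  obtain C0 :: real where C0: "C0 > 0" "\<And>(x::'a) s. s > 0 \<Longrightarrow>
     \<bar>mollify f (x, s)\<bar> \<le> C0 / s ^ DIM('a) * (LINT y:ball x s|lborel. \<bar>f y\<bar>)"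
    using mollify_L1_bounds[where 'a='a] f by blast
  obtain C :: real where C: "C > 0" "\<And>(x::'a) s. s > 0 \<Longrightarrow>
     ennreal (\<bar>mollify f (x, s) - f x\<bar> powr p) \<le> ennreal (C * s powr p) * diff_energy p f (x, s)"
    using mollify_Lp_bounds[where 'a='a, OF p] f by blast
  define q where "q = p + real DIM('a) - 1"
  have q: "q > 0" using p by (simp add: q_def add_pos_nonneg)
  have [measurable]: "ball (0::'a) a \<in> sets borel" by simp
  have "(\<integral>\<^sup>+x. diff_energy p f (x, a) \<partial>lborel) \<le> (\<integral>\<^sup>+x. ennreal (1 / a) * (\<integral>\<^sup>+h\<in>ball 0 a. ennreal (\<bar>f (x + h) - f x\<bar> powr p / norm h powr q) \<partial>lborel) \<partial>lborel)"
  proof (intro nn_integral_mono)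
    fix x
    have "diff_energy p f (x, a) = (\<integral>\<^sup>+h. ennreal (a powr - (q + 1)) * (if norm h < a then ennreal (\<bar>f (x + h) - f x\<bar> powr p) else 0) \<partial>lborel)"
      unfolding diff_energy_def fst_conv snd_conv by (subst nn_integral_cmult) (auto simp: q_def add_ac)
    also have "\<dots> \<le> (\<integral>\<^sup>+h. ennreal (1 / a) * (ennreal (\<bar>f (x + h) - f x\<bar> powr p / norm h powr q) * indicator (ball 0 a) h) \<partial>lborel)"
    proof (rule nn_integral_mono)
      fix h
      have "a powr - (q + 1) * \<bar>f (x + h) - f x\<bar> powr p \<le> 1 / a * (\<bar>f (x + h) - f x\<bar> powr p / norm h powr q)"
        if h: "norm h < a" "h \<noteq> 0"
      proof -
        have "a powr - (q + 1) = 1 / a * (1 / a powr q)" using a by (simp only: powr_minus_divide powr_add) simp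
        also have "\<dots> \<le> 1 / a * (1 / norm h powr q)"
          using h a q by (intro mult_left_mono divide_left_mono powr_mono2) auto
        finally have "a powr - (q + 1) * \<bar>f (x + h) - f x\<bar> powr p \<le> 1 / a * (1 / norm h powr q) * \<bar>f (x + h) - f x\<bar> powr p"
          by (intro mult_right_mono) auto
        then show ?thesis by simp
      qed
      then show "ennreal (a powr - (q + 1)) * (if norm h < a then ennreal (\<bar>f (x + h) - f x\<bar> powr p) else 0)
        \<le> ennreal (1 / a) * (ennreal (\<bar>f (x + h) - f x\<bar> powr p / norm h powr q) * indicator (ball 0 a) h)"
        using a p by (cases "h = 0") (auto simp: ennreal_mult'[symmetric] ennreal_leI)
    qed
    also have "\<dots> = ennreal (1 / a) * (\<integral>\<^sup>+h\<in>ball 0 a. ennreal (\<bar>f (x + h) - f x\<bar> powr p / norm h powr q) \<partial>lborel)"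
      by (rule nn_integral_cmult) measurable
    finally show "diff_energy p f (x, a) \<le> \<dots>" .
  qed
  also have "\<dots> = ennreal (1 / a) * screened_energy p a f"
    unfolding screened_energy_def q_def[symmetric] by (subst nn_integral_cmult) (auto simp: q_def)
  also have "\<dots> < \<infinity>" using fin by (simp add: ennreal_mult_less_top)
  finally have E: "(\<integral>\<^sup>+x. diff_energy p f (x, a) \<partial>lborel) < \<infinity>" .
  have "Lp_on p K f" if K: "compact K" for K
  proof -
    have [measurable]: "K \<in> sets borel" using K by (rule borel_compact)
    obtain R where R: "R > 0" "K \<subseteq> cball 0 R"
      using bounded_subset_ballD[OF compact_imp_bounded[OF K], of 0] by (meson ball_subset_cball order_trans)
    have iR: "set_integrable lborel (cball 0 (R + a)) f" by (rule Lp_loc_on_1_set_integrable[OF f]) auto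
    define M where "M = C0 / a ^ DIM('a) * (LINT y:cball 0 (R + a)|lborel. \<bar>f y\<bar>)"
    have M: "\<bar>mollify f (x, a)\<bar> \<le> M" if x: "x \<in> K" for x
    proof -
      have sub: "ball x a \<subseteq> cball 0 (R + a)"
      proof
        fix y assume "y \<in> ball x a"
        then have "norm (y - x) < a" by (simp add: dist_norm norm_minus_commute)
        moreover have "norm x \<le> R" using R x by auto
        ultimately show "y \<in> cball 0 (R + a)" using norm_triangle_ineq[of "y - x" x] by simp
      qed
      have "(LINT y:ball x a|lborel. \<bar>f y\<bar>) \<le> (LINT y:cball 0 (R + a)|lborel. \<bar>f y\<bar>)"
        unfolding set_lebesgue_integral_def
      proof (rule integral_mono)
        show "integrable lborel (\<lambda>y. indicator (cball 0 (R + a)) y *\<^sub>R \<bar>f y\<bar>)"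
          using set_integrable_abs[OF iR] by (simp add: set_integrable_def)
        show "integrable lborel (\<lambda>y. indicator (ball x a) y *\<^sub>R \<bar>f y\<bar>)"
          using set_integrable_subset[OF set_integrable_abs[OF iR] _ sub] by (simp add: set_integrable_def)
        show "indicator (ball x a) y *\<^sub>R \<bar>f y\<bar> \<le> indicator (cball 0 (R + a)) y *\<^sub>R \<bar>f y\<bar>" for y
          using sub by (auto simp: indicator_def)
      qed
      then have "C0 / a ^ DIM('a) * (LINT y:ball x a|lborel. \<bar>f y\<bar>) \<le> M"
        unfolding M_def using C0(1) a by (intro mult_left_mono) auto
      then show ?thesis using C0(2)[OF a, of x] by simp
    qed
    have pt: "ennreal (\<bar>f x\<bar> powr p) * indicator K x
      \<le> ennreal (3 powr p * M powr p) * indicator K x + ennreal (3 powr p) * (ennreal (C * a powr p) * diff_energy p f (x, a))" for x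
    proof (cases "x \<in> K")
      case True
      have "\<bar>f x\<bar> powr p \<le> (M + \<bar>mollify f (x, a) - f x\<bar> + 0) powr p"
        using M[OF True] p by (intro powr_mono2) auto
      also have "\<dots> \<le> 3 powr p * (M powr p + \<bar>mollify f (x, a) - f x\<bar> powr p + 0 powr p)"
        using M[OF True] p by (intro powr_sum3_le) auto
      finally have "ennreal (\<bar>f x\<bar> powr p) \<le> ennreal (3 powr p * M powr p) + ennreal (3 powr p) * ennreal (\<bar>mollify f (x, a) - f x\<bar> powr p)"
        by (simp add: ennreal_mult'[symmetric] ennreal_plus[symmetric] algebra_simps ennreal_leI del: ennreal_plus)
      also have "\<dots> \<le> ennreal (3 powr p * M powr p) + ennreal (3 powr p) * (ennreal (C * a powr p) * diff_energy p f (x, a))"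
        by (intro add_left_mono mult_left_mono C(2) a) auto
      finally show ?thesis using True by simp
    qed simp
    have "(\<integral>\<^sup>+x\<in>K. ennreal (\<bar>f x\<bar> powr p) \<partial>lborel)
      \<le> (\<integral>\<^sup>+x. ennreal (3 powr p * M powr p) * indicator K x + ennreal (3 powr p) * (ennreal (C * a powr p) * diff_energy p f (x, a)) \<partial>lborel)"
      by (intro nn_integral_mono pt)
    also have "\<dots> = ennreal (3 powr p * M powr p) * emeasure lborel K + ennreal (3 powr p) * (ennreal (C * a powr p) * (\<integral>\<^sup>+x. diff_energy p f (x, a) \<partial>lborel))"
      by (subst nn_integral_add) (auto simp: nn_integral_cmult nn_integral_cmult_indicator)
    also have "\<dots> < \<infinity>" using E emeasure_compact_finite[OF K] by (auto simp: ennreal_mult_less_top top.not_eq_extremum)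
    finally show ?thesis unfolding Lp_on_def set_borel_measurable_def by simp
  qed
  then show ?thesis unfolding Lp_loc_on_def set_borel_measurable_def by simp
qed

section \<open>Traces of functions satisfying a Hardy bound\<close>

text \<open>If l and \<alpha> differed, then |v t - \<alpha>| >= e near b. Rather than evaluating a
  divergent integral, the integrand is bounded below by the constant (e / \<tau>)^p on an interval
  of length \<tau>. This yields e^p \<tau>^(1-p), which is unbounded as \<tau> tends to 0 because p
  > 1.\<close>

lemma right_limit_of_Hardy_bound:
  fixes v :: "real \<Rightarrow> real"
  assumes lim: "(v \<longlongrightarrow> l) (at_right b)" and b: "b < b'" and p: "p > 1"
    and fin: "(\<integral>\<^sup>+t\<in>{b<..<b'}. ennreal ((\<bar>v t - \<alpha>\<bar> / (t - b)) powr p) \<partial>lborel) < \<infinity>"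
  shows "l = \<alpha>"
proof (rule ccontr)
  assume "l \<noteq> \<alpha>"
  define e where "e = \<bar>l - \<alpha>\<bar> / 2"
  have e: "e > 0" using \<open>l \<noteq> \<alpha>\<close> by (simp add: e_def)
  have e2: "\<bar>l - \<alpha>\<bar> = 2 * e" by (simp add: e_def)
  have "eventually (\<lambda>t. dist (v t) l < e) (at_right b)" using lim e by (rule tendstoD)
  then obtain d where d: "d > b" "\<And>t. b < t \<Longrightarrow> t < d \<Longrightarrow> dist (v t) l < e"
    unfolding eventually_at_right_field by blast
  define I where "I = (\<integral>\<^sup>+t\<in>{b<..<b'}. ennreal ((\<bar>v t - \<alpha>\<bar> / (t - b)) powr p) \<partial>lborel)"
  have lower: "ennreal (e powr p * \<tau> powr (1 - p)) \<le> I" if \<tau>: "\<tau> > 0" "b + \<tau> \<le> d" "b + \<tau> \<le> b'" for \<tau>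
  proof -
    have "ennreal (e powr p * \<tau> powr (1 - p)) = ennreal ((e / \<tau>) powr p) * ennreal \<tau>"
      using e \<tau> by (simp add: ennreal_mult'[symmetric] powr_divide powr_diff)
    also have "\<dots> = (\<integral>\<^sup>+t. ennreal ((e / \<tau>) powr p) * indicator {b<..<b + \<tau>} t \<partial>lborel)"
      using \<tau> by (simp add: nn_integral_cmult_indicator)
    also have "\<dots> \<le> I" unfolding I_def
    proof (rule nn_integral_mono)
      fix t
      have "e / \<tau> \<le> \<bar>v t - \<alpha>\<bar> / (t - b)" if t: "b < t" "t < b + \<tau>"
      proof (rule frac_le)
        have "\<bar>v t - l\<bar> < e" using d(2)[of t] t \<tau> by (simp add: dist_real_def)
        then show "e \<le> \<bar>v t - \<alpha>\<bar>" using e2 by linarith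
      qed (use t in auto)
      then show "ennreal ((e / \<tau>) powr p) * indicator {b<..<b + \<tau>} t
          \<le> ennreal ((\<bar>v t - \<alpha>\<bar> / (t - b)) powr p) * indicator {b<..<b'} t"
        using e \<tau> p by (auto simp: indicator_def intro!: ennreal_leI powr_mono2)
    qed
    finally show ?thesis .
  qed
  \<comment> \<open>Chosen so that e^p M exceeds the value of the integral by 1. Since 1 - p is
    negative, \<tau> <= M^(1/(1-p)) makes \<tau>^(1-p) at least M, a contradiction.\<close>
  define M where "M = (enn2real I + 1) / e powr p"
  have M: "M > 0" using e by (simp add: M_def add_nonneg_pos)
  define \<tau> where "\<tau> = min (min (d - b) (b' - b)) (M powr (1 / (1 - p)))"
  have \<tau>: "\<tau> > 0" using d b M by (simp add: \<tau>_def)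
  have "M = (M powr (1 / (1 - p))) powr (1 - p)" using p M by (simp add: powr_powr)
  also have "\<dots> \<le> \<tau> powr (1 - p)"
    using p \<tau> by (intro powr_mono2') (auto simp: \<tau>_def)
  finally have "enn2real I + 1 \<le> e powr p * \<tau> powr (1 - p)"
    using e by (simp add: M_def field_simps)
  moreover have "ennreal (e powr p * \<tau> powr (1 - p)) \<le> I"
    using \<tau> by (intro lower) (auto simp: \<tau>_def min_def)
  then have "ennreal (e powr p * \<tau> powr (1 - p)) \<le> ennreal (enn2real I)"
    using fin[folded I_def] by simp
  then have "e powr p * \<tau> powr (1 - p) \<le> enn2real I"
    by (subst (asm) ennreal_le_iff) auto
  ultimately show False by linarith
qed

text \<open>Reduction to the right-hand limit by the reflection t -> - t; \<open>m\<close> supplies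
  the measurability for the change of variables.\<close>

lemma left_limit_of_Hardy_bound:
  fixes v :: "real \<Rightarrow> real"
  assumes lim: "(v \<longlongrightarrow> l) (at_left b')" and b: "b < b'" and p: "p > 1"
    and m: "set_borel_measurable borel {b<..<b'} v"
    and fin: "(\<integral>\<^sup>+t\<in>{b<..<b'}. ennreal ((\<bar>v t - \<alpha>\<bar> / (b' - t)) powr p) \<partial>lborel) < \<infinity>"
  shows "l = \<alpha>"
proof (rule right_limit_of_Hardy_bound)
  show "((\<lambda>t. v (- t)) \<longlongrightarrow> l) (at_right (- b'))"
    using lim unfolding filterlim_at_left_to_right[of v _ b'] .
  define g where "g t = ennreal ((\<bar>v t - \<alpha>\<bar> / (b' - t)) powr p) * indicator {b<..<b'} t" for t
  have [measurable]: "(\<lambda>t. indicator {b<..<b'} t * v t) \<in> borel_measurable borel"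
    using m by (simp add: set_borel_measurable_def)
  have "g = (\<lambda>t. ennreal ((\<bar>indicator {b<..<b'} t * v t - \<alpha>\<bar> / (b' - t)) powr p) * indicator {b<..<b'} t)"
    by (auto simp: g_def indicator_def)
  then have g: "g \<in> borel_measurable borel" by simp
  have "(\<integral>\<^sup>+t\<in>{-b'<..<-b}. ennreal ((\<bar>v (-t) - \<alpha>\<bar> / (t - - b')) powr p) \<partial>lborel) = (\<integral>\<^sup>+t. g (- t) \<partial>lborel)"
    by (intro nn_integral_cong) (auto simp: g_def indicator_def add.commute)
  also have "\<dots> = (\<integral>\<^sup>+t. g t \<partial>lborel)"
    using nn_integral_real_affine[OF g, of "-1" 0] by simp
  finally show "(\<integral>\<^sup>+t\<in>{-b'<..<-b}. ennreal ((\<bar>v (-t) - \<alpha>\<bar> / (t - - b')) powr p) \<partial>lborel) < \<infinity>"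
    using fin by (simp add: g_def)
qed (use b p in auto)

text \<open>\<open>w\<close> is controlled only on the open interval. Integrability of
  \<open>w'\<close> provides a continuous extension \<open>W\<close> to the closed interval, and the
  Hardy bounds identify its end values as \<open>\<alpha>1\<close> and \<open>\<alpha>2\<close>; the
  fundamental theorem applied to \<open>W\<close> times \<open>\<eta>\<close> then gives the
  formula.\<close>

lemma integration_by_parts_Hardy:
  fixes w w' \<eta> \<eta>' :: "real \<Rightarrow> real"
  assumes b: "b1 < b2" and p: "p > 1"
    and w: "\<And>t. b1 < t \<Longrightarrow> t < b2 \<Longrightarrow> (w has_real_derivative w' t) (at t)"
    and iw': "set_integrable lborel {b1<..<b2} w'"
    and \<eta>: "\<And>t. (\<eta> has_real_derivative \<eta>' t) (at t)"
    and m: "set_borel_measurable borel {b1<..<b2} w"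
    and int: "set_integrable lborel {b1<..<b2} (\<lambda>t. w t * \<eta>' t + \<eta> t * w' t)"
    and H1: "(\<integral>\<^sup>+t\<in>{b1<..<b2}. ennreal ((\<bar>w t - \<alpha>1\<bar> / (t - b1)) powr p) \<partial>lborel) < \<infinity>"
    and H2: "(\<integral>\<^sup>+t\<in>{b1<..<b2}. ennreal ((\<bar>w t - \<alpha>2\<bar> / (b2 - t)) powr p) \<partial>lborel) < \<infinity>"
  shows "(LINT t:{b1<..<b2}|lborel. w t * \<eta>' t + \<eta> t * w' t) = \<alpha>2 * \<eta> b2 - \<alpha>1 * \<eta> b1"
proof -
  have io: "w' integrable_on {b1..b2}"
    using set_borel_integral_eq_integral(1)[OF iw'] by (simp add: integrable_on_open_interval_real)
  define J where "J t = integral {b1..t} w'" for t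
  have J: "continuous_on {b1..b2} J" unfolding J_def by (rule indefinite_integral_continuous_1[OF io])
  have diff: "w t2 - w t1 = J t2 - J t1" if t: "b1 < t1" "t1 \<le> t2" "t2 < b2" for t1 t2
  proof -
    have "(w' has_integral (w t2 - w t1)) {t1..t2}"
      using t by (intro fundamental_theorem_of_calculus[where f=w])
        (auto intro!: has_vector_derivative_at_within[OF w[unfolded has_real_derivative_iff_has_vector_derivative]])
    then have "integral {t1..t2} w' = w t2 - w t1" by (rule integral_unique)
    moreover have "w' integrable_on {b1..t2}"
      by (rule integrable_on_subinterval[OF io]) (use t in auto)
    then have "integral {b1..t1} w' + integral {t1..t2} w' = integral {b1..t2} w'"
      by (intro Henstock_Kurzweil_Integration.integral_combine) (use t in auto)
    ultimately show ?thesis by (simp add: J_def)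
  qed
  define c where "c = (b1 + b2) / 2"
  have c: "b1 < c" "c < b2" using b by (auto simp: c_def)
  \<comment> \<open>The indefinite integral, shifted by the constant that makes it agree with
    \<open>w\<close> at the midpoint and hence on the whole open interval.\<close>
  define W where "W t = J t + (w c - J c)" for t
  have W: "continuous_on {b1..b2} W" unfolding W_def by (intro continuous_intros J)
  have wW: "w t = W t" if "b1 < t" "t < b2" for t
    using diff[of t c] diff[of c t] that c unfolding W_def by (cases "t \<le> c") auto
  have "(W \<longlongrightarrow> W b1) (at_right b1)"
    using W b by (simp add: continuous_on_Icc_at_rightD)
  then have "(w \<longlongrightarrow> W b1) (at_right b1)"
    by (rule Lim_transform_eventually)
       (use b wW in \<open>auto simp: eventually_at_right_field intro!: exI[of _ b2]\<close>)
  then have W1: "W b1 = \<alpha>1" by (rule right_limit_of_Hardy_bound[OF _ b p H1])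
  have "(W \<longlongrightarrow> W b2) (at_left b2)"
    using W b by (simp add: continuous_on_Icc_at_leftD)
  then have "(w \<longlongrightarrow> W b2) (at_left b2)"
    by (rule Lim_transform_eventually)
       (use b wW in \<open>auto simp: eventually_at_left_field intro!: exI[of _ b1]\<close>)
  then have W2: "W b2 = \<alpha>2" by (rule left_limit_of_Hardy_bound[OF _ b p m H2])
  have \<eta>c: "continuous_on A \<eta>" for A
    using \<eta> by (meson DERIV_continuous continuous_at_imp_continuous_on)
  have "((\<lambda>t. w t * \<eta>' t + \<eta> t * w' t) has_integral (W b2 * \<eta> b2 - W b1 * \<eta> b1)) {b1..b2}"
  proof (rule fundamental_theorem_of_calculus_interior)
    show "continuous_on {b1..b2} (\<lambda>t. W t * \<eta> t)" by (intro continuous_intros W \<eta>c)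
    fix t assume t: "t \<in> {b1<..<b2}"
    have "(W has_real_derivative w' t) (at t)"
      by (rule has_field_derivative_transform_within_open[OF w, of t "{b1<..<b2}"]) (use t wW in auto)
    then have "((\<lambda>t. W t * \<eta> t) has_real_derivative w' t * \<eta> t + \<eta>' t * W t) (at t)"
      by (rule DERIV_mult[OF _ \<eta>])
    then show "((\<lambda>t. W t * \<eta> t) has_vector_derivative w t * \<eta>' t + \<eta> t * w' t) (at t)"
      using wW[of t] t by (simp add: has_real_derivative_iff_has_vector_derivative[symmetric] mult.commute add.commute)
  qed (use b in auto)
  then have "integral {b1..b2} (\<lambda>t. w t * \<eta>' t + \<eta> t * w' t) = \<alpha>2 * \<eta> b2 - \<alpha>1 * \<eta> b1"
    unfolding W1 W2 by (rule integral_unique)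
  then show ?thesis
    using set_borel_integral_eq_integral(2)[OF int] by (simp add: integral_open_interval_real)
qed

text \<open>By translation invariance h (z + i) - h z has integral 0, and this difference is the
  integral of h' over the unit segment from z in direction i; Fubini then gives the claim.
  Differentiability is used along \<open>i\<close> alone, so \<open>h\<close> may jump across
  hyperplanes parallel to \<open>i\<close>, as a function cut off by the indicator of the strip
  does.\<close>

lemma integral_directional_derivative_eq_0:
  fixes h h' :: "'e::euclidean_space \<Rightarrow> real"
  assumes h: "integrable lborel h" and h': "integrable lborel h'"
    and der: "\<And>z \<tau>. ((\<lambda>\<tau>. h (z + \<tau> *\<^sub>R i)) has_real_derivative h' (z + \<tau> *\<^sub>R i)) (at \<tau>)"
  shows "(\<integral>z. h' z \<partial>lborel) = 0"
proof -
  have [measurable]: "h \<in> borel_measurable borel" "h' \<in> borel_measurable borel" using h h' by auto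
  have shift: "integrable lborel (\<lambda>z. g (z + c))" "(\<integral>z. g (z + c) \<partial>lborel) = (\<integral>z. g z \<partial>lborel)"
    if "integrable lborel g" for g :: "'e \<Rightarrow> real" and c
  proof -
    have [measurable]: "g \<in> borel_measurable borel" using that by auto
    have eq: "distr lborel borel (\<lambda>z. z + c) = lborel"
      using lborel_distr_plus[of c] unfolding add.commute[of _ c] .
    show "integrable lborel (\<lambda>z. g (z + c))"
      using that integrable_distr[of "\<lambda>z. z + c" lborel borel g] eq by simp
    show "(\<integral>z. g (z + c) \<partial>lborel) = (\<integral>z. g z \<partial>lborel)"
      using integral_distr[of "\<lambda>z. z + c" lborel borel g] eq by simp
  qed
  define F where "F = (\<lambda>(\<tau>::real, z). indicator {0..1} \<tau> * h' (z + \<tau> *\<^sub>R i))"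
  have "(\<lambda>w. snd w + fst w *\<^sub>R i) \<in> borel_measurable (borel :: (real \<times> 'e) measure)"
    by (intro borel_measurable_continuous_onI continuous_intros)
  then have "(\<lambda>w. h' (snd w + fst w *\<^sub>R i)) \<in> borel_measurable (borel :: (real \<times> 'e) measure)"
    by (rule measurable_compose) measurable
  then have [measurable]: "(\<lambda>w. h' (snd w + fst w *\<^sub>R i)) \<in> borel_measurable (lborel \<Otimes>\<^sub>M lborel)"
    by (simp add: lborel_prod)
  have Fm: "F \<in> borel_measurable (lborel \<Otimes>\<^sub>M lborel)"
    unfolding F_def case_prod_unfold by measurable
  have "(\<integral>\<^sup>+w. ennreal (norm (F w)) \<partial>(lborel \<Otimes>\<^sub>M lborel)) = (\<integral>\<^sup>+\<tau>. \<integral>\<^sup>+z. ennreal (norm (F (\<tau>, z))) \<partial>lborel \<partial>lborel)"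
    using Fm by (subst lborel.nn_integral_fst) auto
  also have "\<dots> = (\<integral>\<^sup>+\<tau>. ennreal (indicator {0..1::real} \<tau> * (\<integral>z. \<bar>h' z\<bar> \<partial>lborel)) \<partial>lborel)"
  proof (intro nn_integral_cong)
    fix \<tau> :: real
    have "(\<integral>\<^sup>+z. ennreal (norm (F (\<tau>, z))) \<partial>lborel) = (\<integral>z. norm (F (\<tau>, z)) \<partial>lborel)"
      using shift(1)[OF h', of "\<tau> *\<^sub>R i"]
      by (intro nn_integral_eq_integral) (auto simp: F_def intro!: integrable_norm integrable_mult_right)
    then show "(\<integral>\<^sup>+z. ennreal (norm (F (\<tau>, z))) \<partial>lborel) = ennreal (indicator {0..1} \<tau> * (\<integral>z. \<bar>h' z\<bar> \<partial>lborel))"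
      using shift(2)[OF integrable_abs[OF h'], of "\<tau> *\<^sub>R i"] by (simp add: F_def abs_mult)
  qed
  also have "\<dots> = (\<integral>\<^sup>+\<tau>. ennreal (\<integral>z. \<bar>h' z\<bar> \<partial>lborel) * indicator {0..1::real} \<tau> \<partial>lborel)"
    by (intro nn_integral_cong) (auto simp: indicator_def)
  also have "\<dots> < \<infinity>" by (simp add: nn_integral_cmult_indicator)
  finally have Fi: "integrable (lborel \<Otimes>\<^sub>M lborel) F"
    using Fm by (intro integrableI_bounded) auto
  then have Fi': "integrable (lborel \<Otimes>\<^sub>M lborel) (case_prod (\<lambda>\<tau> z. F (\<tau>, z)))" by simp
  have "(\<integral>z. h' z \<partial>lborel) = (\<integral>\<tau>. indicator {0..1::real} \<tau> * (\<integral>z. h' z \<partial>lborel) \<partial>lborel)" by simp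
  also have "\<dots> = (\<integral>\<tau>. (\<integral>z. F (\<tau>, z) \<partial>lborel) \<partial>lborel)"
    using shift(2)[OF h'] by (simp add: F_def)
  also have "\<dots> = (\<integral>z. (\<integral>\<tau>. F (\<tau>, z) \<partial>lborel) \<partial>lborel)"
    by (rule lborel_pair.Fubini_integral[OF Fi', symmetric])
  also have "\<dots> = (\<integral>z. h (z + i) - h z \<partial>lborel)"
  proof (rule integral_cong_AE)
    show "(\<lambda>z. \<integral>\<tau>. F (\<tau>, z) \<partial>lborel) \<in> borel_measurable lborel"
      by (rule borel_measurable_integrable[OF lborel_pair.integrable_snd[OF Fi']])
    show "(\<lambda>z. h (z + i) - h z) \<in> borel_measurable lborel" by measurable
    have "AE z in lborel. integrable lborel (\<lambda>\<tau>. F (\<tau>, z))"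
      by (rule lborel_pair.AE_integrable_snd[OF Fi'])
    then show "AE z in lborel. (\<integral>\<tau>. F (\<tau>, z) \<partial>lborel) = h (z + i) - h z"
    proof eventually_elim
      fix z assume "integrable lborel (\<lambda>\<tau>. F (\<tau>, z))"
      then have si: "set_integrable lborel {0..1} (\<lambda>\<tau>. h' (z + \<tau> *\<^sub>R i))"
        by (simp add: set_integrable_def F_def)
      have "(\<integral>\<tau>. F (\<tau>, z) \<partial>lborel) = (LINT \<tau>:{0..1}|lborel. h' (z + \<tau> *\<^sub>R i))"
        by (simp add: set_lebesgue_integral_def F_def)
      also have "\<dots> = integral {0..1} (\<lambda>\<tau>. h' (z + \<tau> *\<^sub>R i))"
        by (rule set_borel_integral_eq_integral(2)[OF si])
      also have "\<dots> = h (z + 1 *\<^sub>R i) - h (z + 0 *\<^sub>R i)"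
        by (intro integral_unique fundamental_theorem_of_calculus[where f="\<lambda>\<tau>. h (z + \<tau> *\<^sub>R i)"])
           (simp_all add: has_vector_derivative_at_within[OF der[unfolded has_real_derivative_iff_has_vector_derivative]])
      finally show "(\<integral>\<tau>. F (\<tau>, z) \<partial>lborel) = h (z + i) - h z" by simp
    qed
  qed
  also have "\<dots> = 0" using shift[OF h, of i] h by simp
  finally show ?thesis .
qed

section \<open>Test functions and restriction to slices\<close>

lemma C1_c_has_derivative:
  "\<psi> \<in> C1_c \<Longrightarrow> (\<psi> has_derivative frechet_derivative \<psi> (at x)) (at x)"
  unfolding C1_c_def by (auto simp: frechet_derivative_works)

lemma C1_c_continuous: "\<psi> \<in> C1_c \<Longrightarrow> continuous_on A \<psi>"
  by (meson C1_c_has_derivative continuous_at_imp_continuous_on has_derivative_continuous)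

lemma C1_c_measurable:
  assumes "\<psi> \<in> C1_c"
  shows "\<psi> \<in> borel_measurable borel" "(\<lambda>x. frechet_derivative \<psi> (at x) v) \<in> borel_measurable borel"
  using assms C1_c_continuous[OF assms] unfolding C1_c_def
  by (auto intro: borel_measurable_continuous_onI)

lemma C1_c_bound:
  fixes \<psi> :: "'e::euclidean_space \<Rightarrow> real"
  assumes \<psi>: "\<psi> \<in> C1_c"
  obtains M R where "\<And>x. \<bar>\<psi> x\<bar> \<le> M * indicator (cball 0 R) x"
    "\<And>x. \<bar>frechet_derivative \<psi> (at x) v\<bar> \<le> M * indicator (cball 0 R) x"
proof -
  define S where "S = closure {x. \<psi> x \<noteq> 0}"
  have S: "compact S" using \<psi> by (simp add: C1_c_def S_def)
  obtain R where R: "S \<subseteq> ball 0 R" using bounded_subset_ballD[OF compact_imp_bounded[OF S], of 0] by blast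
  have z: "\<psi> x = 0" if "x \<notin> S" for x
    using that closure_subset[of "{x. \<psi> x \<noteq> 0}"] by (auto simp: S_def)
  have dz: "frechet_derivative \<psi> (at x) v = 0" if x: "x \<notin> S" for x
  proof -
    have "open (- S)" by (simp add: S_def open_Compl)
    then have "(\<psi> has_derivative (\<lambda>_. 0)) (at x)"
      by (rule has_derivative_transform_within_open[OF has_derivative_const]) (use x z in auto)
    then show ?thesis using fun_cong[OF frechet_derivative_at, of \<psi> "\<lambda>_. 0" x v] by simp
  qed
  have "continuous_on S (\<lambda>x. frechet_derivative \<psi> (at x) v)"
    using \<psi> unfolding C1_c_def by (blast intro: continuous_on_subset)
  then have "bounded (\<psi> ` S)" "bounded ((\<lambda>x. frechet_derivative \<psi> (at x) v) ` S)"
    using S C1_c_continuous[OF \<psi>] by (blast intro: compact_imp_bounded compact_continuous_image)+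
  then obtain M1 M2 where M: "\<And>x. x \<in> S \<Longrightarrow> \<bar>\<psi> x\<bar> \<le> M1" "\<And>x. x \<in> S \<Longrightarrow> \<bar>frechet_derivative \<psi> (at x) v\<bar> \<le> M2"
    unfolding bounded_iff by (simp add: image_iff) meson
  show ?thesis
  proof (rule that[of "max 0 (max M1 M2)" R])
    fix x
    show "\<bar>\<psi> x\<bar> \<le> max 0 (max M1 M2) * indicator (cball 0 R) x"
      using M(1)[of x] z[of x] R by (cases "x \<in> S") (auto simp: indicator_def)
    show "\<bar>frechet_derivative \<psi> (at x) v\<bar> \<le> max 0 (max M1 M2) * indicator (cball 0 R) x"
      using M(2)[of x] dz[of x] R by (cases "x \<in> S") (auto simp: indicator_def)
  qed
qed

lemma C_infinity_c_subset_C1_c: "C_infinity_c S \<subseteq> C1_c"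
proof
  fix \<phi> :: "'a \<Rightarrow> real" assume \<phi>: "\<phi> \<in> C_infinity_c S"
  then have d: "iter_deriv vs \<phi> differentiable (at x)" for vs x by (auto simp: C_infinity_c_def)
  have "continuous_on UNIV (\<lambda>x. frechet_derivative \<phi> (at x) v)" for v
    using d[of "[v]"] by (auto intro!: continuous_at_imp_continuous_on differentiable_imp_continuous_within)
  moreover have "\<phi> differentiable (at x)" for x using d[of "[]"] by simp
  ultimately show "\<phi> \<in> C1_c" using \<phi> by (auto simp: C1_c_def C_infinity_c_def)
qed

lemma has_real_derivative_along_line:
  fixes g :: "'e::real_normed_vector \<Rightarrow> real"
  assumes "(g has_derivative D) (at (z + \<tau> *\<^sub>R i))"
  shows "((\<lambda>\<tau>. g (z + \<tau> *\<^sub>R i)) has_real_derivative D i) (at \<tau>)"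
proof -
  have "((\<lambda>\<tau>. z + \<tau> *\<^sub>R i) has_derivative (\<lambda>s. s *\<^sub>R i)) (at \<tau>)"
    by (auto intro!: derivative_eq_intros)
  then have "((\<lambda>\<tau>. g (z + \<tau> *\<^sub>R i)) has_derivative (\<lambda>s. D (s *\<^sub>R i))) (at \<tau>)"
    using assms by (rule has_derivative_compose)
  moreover have "D (s *\<^sub>R i) = D i * s" for s
    using linear_scale[OF has_derivative_linear[OF assms], of s i] by simp
  ultimately show ?thesis by (simp add: has_field_derivative_def)
qed

lemma set_integrable_mult_bounded_support:
  fixes g k :: "'e::euclidean_space \<Rightarrow> real"
  assumes g: "set_integrable lborel (S \<inter> cball 0 R) g"
    and [measurable]: "g \<in> borel_measurable borel" "k \<in> borel_measurable borel" "S \<in> sets borel"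
    and k: "\<And>x. \<bar>k x\<bar> \<le> M * indicator (cball 0 R) x"
  shows "set_integrable lborel S (\<lambda>x. g x * k x)"
  unfolding set_integrable_def
proof (rule Bochner_Integration.integrable_bound)
  show "integrable lborel (\<lambda>x. M * \<bar>indicator (S \<inter> cball 0 R) x *\<^sub>R g x\<bar>)"
    using g unfolding set_integrable_def by (intro integrable_mult_right integrable_abs)
  show "AE x in lborel. norm (indicator S x *\<^sub>R (g x * k x)) \<le> norm (M * \<bar>indicator (S \<inter> cball 0 R) x *\<^sub>R g x\<bar>)"
  proof (rule AE_I2)
    fix x
    have "\<bar>g x\<bar> * \<bar>k x\<bar> \<le> \<bar>g x\<bar> * (M * indicator (cball 0 R) x)" by (intro mult_left_mono k) auto
    then show "norm (indicator S x *\<^sub>R (g x * k x)) \<le> norm (M * \<bar>indicator (S \<inter> cball 0 R) x *\<^sub>R g x\<bar>)"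
      using k[of x] by (auto simp: indicator_def abs_mult mult_ac)
  qed
qed measurable

lemma AE_slice_finite:
  fixes g :: "'a::euclidean_space \<times> 'b::euclidean_space \<Rightarrow> ennreal"
  assumes g: "g \<in> borel_measurable borel" and fin: "(\<integral>\<^sup>+z. g z \<partial>lborel) < \<infinity>"
  shows "AE x in lborel. (\<integral>\<^sup>+t. g (x, t) \<partial>lborel) < \<infinity>"
proof -
  have m: "(\<lambda>x. \<integral>\<^sup>+t. g (x, t) \<partial>lborel) \<in> borel_measurable lborel"
    using g by (intro lborel.borel_measurable_nn_integral_fst) (simp add: lborel_prod)
  have "(\<integral>\<^sup>+x. (\<integral>\<^sup>+t. g (x, t) \<partial>lborel) \<partial>lborel) \<noteq> \<infinity>"
    using fin unfolding nn_integral_lborel_Pair[OF g] by simp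
  from nn_integral_noteq_infinite[OF m this] show ?thesis by (auto simp: less_top)
qed

lemma segment_subset_closure_strip:
  assumes "b1 < b2"
  shows "Pair x ` {b1..b2} \<subseteq> closure (strip b1 b2)"
proof -
  have "Pair x ` closure {b1<..<b2} \<subseteq> closure (strip b1 b2)"
    using closure_subset[of "strip b1 b2"]
    by (intro image_closure_subset) (auto intro!: continuous_intros simp: strip_def)
  then show ?thesis using assms by simp
qed

lemma slice_measurable:
  fixes g :: "'a::euclidean_space \<times> 'b::euclidean_space \<Rightarrow> 'c::topological_space"
  assumes "g \<in> borel_measurable borel"
  shows "(\<lambda>t. g (x, t)) \<in> borel_measurable borel" "(\<lambda>y. g (y, t)) \<in> borel_measurable borel"
  by (rule measurable_compose[OF borel_measurable_continuous_onI assms], intro continuous_intros)+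

text \<open>Collects what the trace argument uses of the extension: a classical gradient in L^p on
  the open strip and a Hardy bound at each hyperplane. The Hardy bounds stand in for any statement
  about limits at the boundary.\<close>

locale strip_function =
  fixes p b1 b2 :: real and u :: "'a::euclidean_space \<times> real \<Rightarrow> real" and G :: "'a \<times> real \<Rightarrow> 'a \<times> real"
    and f1 f2 :: "'a \<Rightarrow> real"
  assumes b: "b1 < b2" and p: "1 < p"
    and u_measurable [measurable]: "u \<in> borel_measurable borel"
    and G_measurable [measurable]: "G \<in> borel_measurable borel"
    and deriv: "\<And>z. z \<in> strip b1 b2 \<Longrightarrow> (u has_derivative (\<lambda>v. G z \<bullet> v)) (at z)"
    and G_Lp: "(\<integral>\<^sup>+z\<in>strip b1 b2. ennreal (norm (G z) powr p) \<partial>lborel) < \<infinity>"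
    and f1: "Lp_loc_on 1 UNIV f1" and f2: "Lp_loc_on 1 UNIV f2"
    and Hardy1: "(\<integral>\<^sup>+z\<in>strip b1 b2. ennreal ((\<bar>u z - f1 (fst z)\<bar> / (snd z - b1)) powr p) \<partial>lborel) < \<infinity>"
    and Hardy2: "(\<integral>\<^sup>+z\<in>strip b1 b2. ennreal ((\<bar>u z - f2 (fst z)\<bar> / (b2 - snd z)) powr p) \<partial>lborel) < \<infinity>"
begin

text \<open>Takes the place of Hoelder's inequality on bounded sets: a function whose p-th power is
  integrable over a set of finite measure is integrable there.\<close>

lemma le_1_plus_powr: "t \<ge> 0 \<Longrightarrow> t \<le> 1 + t powr p"
proof (cases "t \<le> 1")
  case False
  then have "t powr 1 \<le> t powr p" using p by (intro powr_mono) auto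
  then show ?thesis using False by simp
qed (simp add: add_increasing2)

lemma f1_measurable [measurable]: "f1 \<in> borel_measurable borel"
  and f2_measurable [measurable]: "f2 \<in> borel_measurable borel"
  using f1 f2 by (auto intro: Lp_loc_on_UNIV_measurable)

lemma fst_snd_measurable [measurable]:
  "(fst :: 'a \<times> real \<Rightarrow> 'a) \<in> borel_measurable borel"
  "(snd :: 'a \<times> real \<Rightarrow> real) \<in> borel_measurable borel"
  by (auto intro!: borel_measurable_continuous_onI continuous_intros)

text \<open>Integrability is needed up to the boundary, since functions in \<open>C1_c\<close> need
  not vanish on the hyperplanes. Writing |u - f1| as the Hardy quotient times the distance, which is
  at most the width, bounds u by locally integrable terms across the entire strip.\<close>

lemma u_integrable: "set_integrable lborel (strip b1 b2 \<inter> cball 0 R) u"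
proof -
  define C where "C = cball (0::'a \<times> real) R"
  have [measurable]: "C \<in> sets borel" "cball (0::'a) R \<in> sets borel" by (auto simp: C_def)
  have finC: "emeasure lborel C < \<infinity>" unfolding C_def by (rule emeasure_compact_finite) simp
  define q where "q z = (\<bar>u z - f1 (fst z)\<bar> / (snd z - b1)) powr p" for z
  have "(\<integral>\<^sup>+x. ennreal \<bar>f1 x\<bar> * indicator (cball 0 R) x \<partial>lborel) = (\<integral>\<^sup>+x. ennreal (norm (indicator (cball 0 R) x *\<^sub>R f1 x)) \<partial>lborel)"
    by (intro nn_integral_cong) (auto simp: indicator_def)
  also have "\<dots> < \<infinity>"
    using Lp_loc_on_1_set_integrable[OF f1, of "cball 0 R"] unfolding set_integrable_def integrable_iff_bounded by simp
  finally have if1: "(\<integral>\<^sup>+x. ennreal \<bar>f1 x\<bar> * indicator (cball 0 R) x \<partial>lborel) < \<infinity>" .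
  have "(\<integral>\<^sup>+z. ennreal \<bar>f1 (fst z)\<bar> * indicator (cball 0 R) (fst z) * indicator {b1<..<b2} (snd z) \<partial>lborel)
      = (\<integral>\<^sup>+x. (\<integral>\<^sup>+t. ennreal \<bar>f1 x\<bar> * indicator (cball 0 R) x * indicator {b1<..<b2} t \<partial>lborel) \<partial>lborel)"
    by (subst nn_integral_lborel_Pair) auto
  also have "\<dots> = (\<integral>\<^sup>+x. ennreal \<bar>f1 x\<bar> * indicator (cball 0 R) x \<partial>lborel) * ennreal (b2 - b1)"
    using b by (simp add: nn_integral_cmult_indicator nn_integral_multc)
  also have "\<dots> < \<infinity>" using if1 by (simp add: ennreal_mult_less_top)
  finally have F: "(\<integral>\<^sup>+z. ennreal \<bar>f1 (fst z)\<bar> * indicator (cball 0 R) (fst z) * indicator {b1<..<b2} (snd z) \<partial>lborel) < \<infinity>" .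
  have pt: "ennreal (norm (indicator (strip b1 b2 \<inter> C) z *\<^sub>R u z)) \<le>
      ennreal \<bar>f1 (fst z)\<bar> * indicator (cball 0 R) (fst z) * indicator {b1<..<b2} (snd z)
      + (ennreal (b2 - b1) * indicator C z + ennreal (b2 - b1) * (ennreal (q z) * indicator (strip b1 b2) z))" for z
  proof (cases "z \<in> strip b1 b2 \<inter> C")
    case True
    then have t: "b1 < snd z" "snd z < b2" by (auto simp: strip_def)
    have "norm (fst z) \<le> R" using True norm_fst_le[of "fst z" "snd z"] by (auto simp: C_def)
    define r where "r = \<bar>u z - f1 (fst z)\<bar> / (snd z - b1)"
    have "\<bar>u z\<bar> \<le> \<bar>f1 (fst z)\<bar> + \<bar>u z - f1 (fst z)\<bar>" by linarith
    also have "\<bar>u z - f1 (fst z)\<bar> = r * (snd z - b1)" using t by (simp add: r_def)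
    also have "\<dots> \<le> (1 + r powr p) * (b2 - b1)"
      using t le_1_plus_powr[of r] by (intro mult_mono) (auto simp: r_def)
    finally have "\<bar>u z\<bar> \<le> \<bar>f1 (fst z)\<bar> + ((b2 - b1) + (b2 - b1) * q z)"
      by (simp add: q_def r_def algebra_simps)
    then have "ennreal \<bar>u z\<bar> \<le> ennreal (\<bar>f1 (fst z)\<bar> + ((b2 - b1) + (b2 - b1) * q z))"
      by (rule ennreal_leI)
    also have "\<dots> = ennreal \<bar>f1 (fst z)\<bar> + (ennreal (b2 - b1) + ennreal (b2 - b1) * ennreal (q z))"
      using b by (simp add: ennreal_plus ennreal_mult' q_def)
    finally show ?thesis using True t \<open>norm (fst z) \<le> R\<close> by simp
  qed simp
  have "(\<integral>\<^sup>+z. ennreal (norm (indicator (strip b1 b2 \<inter> C) z *\<^sub>R u z)) \<partial>lborel) \<le>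
      (\<integral>\<^sup>+z. ennreal \<bar>f1 (fst z)\<bar> * indicator (cball 0 R) (fst z) * indicator {b1<..<b2} (snd z)
      + (ennreal (b2 - b1) * indicator C z + ennreal (b2 - b1) * (ennreal (q z) * indicator (strip b1 b2) z)) \<partial>lborel)"
    by (intro nn_integral_mono pt)
  also have "\<dots> = (\<integral>\<^sup>+z. ennreal \<bar>f1 (fst z)\<bar> * indicator (cball 0 R) (fst z) * indicator {b1<..<b2} (snd z) \<partial>lborel)
     + (ennreal (b2 - b1) * emeasure lborel C + ennreal (b2 - b1) * (\<integral>\<^sup>+z\<in>strip b1 b2. ennreal (q z) \<partial>lborel))"
    unfolding q_def by (simp add: nn_integral_add nn_integral_cmult nn_integral_cmult_indicator)
  also have "\<dots> < \<infinity>" using F finC Hardy1 by (simp add: ennreal_mult_less_top q_def)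
  finally have "(\<integral>\<^sup>+z. ennreal (norm (indicator (strip b1 b2 \<inter> C) z *\<^sub>R u z)) \<partial>lborel) < \<infinity>" .
  then show ?thesis unfolding set_integrable_def C_def[symmetric] by (intro integrableI_bounded) auto
qed

lemma G_le: "\<bar>G z \<bullet> v\<bar> \<le> norm v * (1 + norm (G z) powr p)"
proof -
  have "\<bar>G z \<bullet> v\<bar> \<le> norm (G z) * norm v" by (rule Cauchy_Schwarz_ineq2)
  also have "\<dots> \<le> (1 + norm (G z) powr p) * norm v" by (intro mult_right_mono le_1_plus_powr) auto
  finally show ?thesis by (simp add: mult.commute)
qed

lemma G_integrable: "set_integrable lborel (strip b1 b2 \<inter> cball 0 R) (\<lambda>z. G z \<bullet> v)"
proof -
  define C where "C = cball (0::'a \<times> real) R"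
  have [measurable]: "C \<in> sets borel" by (auto simp: C_def)
  have finC: "emeasure lborel C < \<infinity>" unfolding C_def by (rule emeasure_compact_finite) simp
  have "(\<integral>\<^sup>+z. ennreal (norm (indicator (strip b1 b2 \<inter> C) z *\<^sub>R (G z \<bullet> v))) \<partial>lborel) \<le>
      (\<integral>\<^sup>+z. ennreal (norm v) * indicator C z + ennreal (norm v) * (ennreal (norm (G z) powr p) * indicator (strip b1 b2) z) \<partial>lborel)"
  proof (rule nn_integral_mono)
    fix z
    have "ennreal \<bar>G z \<bullet> v\<bar> \<le> ennreal (norm v) + ennreal (norm v) * ennreal (norm (G z) powr p)"
      using ennreal_leI[OF G_le[of z v]] by (simp add: distrib_left ennreal_plus ennreal_mult')
    then show "ennreal (norm (indicator (strip b1 b2 \<inter> C) z *\<^sub>R (G z \<bullet> v))) \<le>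
      ennreal (norm v) * indicator C z + ennreal (norm v) * (ennreal (norm (G z) powr p) * indicator (strip b1 b2) z)"
      by (auto simp: indicator_def)
  qed
  also have "\<dots> = ennreal (norm v) * emeasure lborel C + ennreal (norm v) * (\<integral>\<^sup>+z\<in>strip b1 b2. ennreal (norm (G z) powr p) \<partial>lborel)"
    by (simp add: nn_integral_add nn_integral_cmult nn_integral_cmult_indicator)
  also have "\<dots> < \<infinity>" using G_Lp finC by (simp add: ennreal_mult_less_top)
  finally have "(\<integral>\<^sup>+z. ennreal (norm (indicator (strip b1 b2 \<inter> C) z *\<^sub>R (G z \<bullet> v))) \<partial>lborel) < \<infinity>" .
  then show ?thesis unfolding set_integrable_def C_def[symmetric] by (intro integrableI_bounded) auto
qed

lemma AE_slice_Hardy: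
  "AE x in lborel. (\<integral>\<^sup>+t\<in>{b1<..<b2}. ennreal ((\<bar>u (x, t) - f1 x\<bar> / (t - b1)) powr p) \<partial>lborel) < \<infinity>"
  "AE x in lborel. (\<integral>\<^sup>+t\<in>{b1<..<b2}. ennreal ((\<bar>u (x, t) - f2 x\<bar> / (b2 - t)) powr p) \<partial>lborel) < \<infinity>"
  "AE x in lborel. (\<integral>\<^sup>+t\<in>{b1<..<b2}. ennreal (norm (G (x, t)) powr p) \<partial>lborel) < \<infinity>"
proof -
  have i: "indicator (strip b1 b2) (x, t) = indicator {b1<..<b2} t" for x :: 'a and t
    by (auto simp: strip_def indicator_def)
  show "AE x in lborel. (\<integral>\<^sup>+t\<in>{b1<..<b2}. ennreal ((\<bar>u (x, t) - f1 x\<bar> / (t - b1)) powr p) \<partial>lborel) < \<infinity>"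
    using AE_slice_finite[OF _ Hardy1] by (simp add: i)
  show "AE x in lborel. (\<integral>\<^sup>+t\<in>{b1<..<b2}. ennreal ((\<bar>u (x, t) - f2 x\<bar> / (b2 - t)) powr p) \<partial>lborel) < \<infinity>"
    using AE_slice_finite[OF _ Hardy2] by (simp add: i)
  show "AE x in lborel. (\<integral>\<^sup>+t\<in>{b1<..<b2}. ennreal (norm (G (x, t)) powr p) \<partial>lborel) < \<infinity>"
    using AE_slice_finite[OF _ G_Lp] by (simp add: i)
qed

section \<open>Green's formula in the strip\<close>

lemma product_integrable:
  assumes \<psi>: "\<psi> \<in> C1_c"
  shows "set_integrable lborel (strip b1 b2) (\<lambda>z. u z * frechet_derivative \<psi> (at z) i)"
    and "set_integrable lborel (strip b1 b2) (\<lambda>z. \<psi> z * (G z \<bullet> i))"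
    and "set_integrable lborel (strip b1 b2) (\<lambda>z. u z * \<psi> z)"
proof -
  obtain M R where M: "\<And>x. \<bar>\<psi> x\<bar> \<le> M * indicator (cball 0 R) x"
    "\<And>x. \<bar>frechet_derivative \<psi> (at x) i\<bar> \<le> M * indicator (cball 0 R) x"
    using C1_c_bound[OF \<psi>, of i] by blast
  note [measurable] = C1_c_measurable[OF \<psi>]
  show "set_integrable lborel (strip b1 b2) (\<lambda>z. u z * frechet_derivative \<psi> (at z) i)"
    by (rule set_integrable_mult_bounded_support[OF u_integrable[of R], where M=M]) (use M in auto)
  show "set_integrable lborel (strip b1 b2) (\<lambda>z. u z * \<psi> z)"
    by (rule set_integrable_mult_bounded_support[OF u_integrable[of R], where M=M]) (use M in auto)
  have "set_integrable lborel (strip b1 b2) (\<lambda>z. (G z \<bullet> i) * \<psi> z)"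
    by (rule set_integrable_mult_bounded_support[OF G_integrable[of R], where M=M]) (use M in auto)
  then show "set_integrable lborel (strip b1 b2) (\<lambda>z. \<psi> z * (G z \<bullet> i))" by (simp add: mult.commute)
qed

lemma boundary_integrable:
  assumes \<psi>: "\<psi> \<in> C1_c"
  shows "integrable lborel (\<lambda>x. \<psi> (x, t) * f1 x)" "integrable lborel (\<lambda>x. \<psi> (x, t) * f2 x)"
proof -
  obtain M R where M: "\<And>x. \<bar>\<psi> x\<bar> \<le> M * indicator (cball 0 R) x"
    using C1_c_bound[OF \<psi>] by blast
  have "norm (\<psi> (x, t)) \<le> M * indicator (cball 0 R) x" for x
    using M[of "(x, t)"] M[of 0] norm_fst_le[of x t] norm_ge_zero[of x]
    by (cases "norm (x, t) \<le> R"; cases "norm x \<le> R") auto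
  note * = Lp_loc_on_1_integrable_mult[OF _ slice_measurable(2)[OF C1_c_measurable(1)[OF \<psi>]] this]
  show "integrable lborel (\<lambda>x. \<psi> (x, t) * f1 x)" "integrable lborel (\<lambda>x. \<psi> (x, t) * f2 x)"
    using *[OF f1] *[OF f2] by (simp_all add: mult.commute)
qed

text \<open>A horizontal line lies entirely inside or entirely outside the strip, so the product cut
  off by the indicator remains differentiable along it and no boundary term arises.\<close>

lemma Green_horizontal:
  assumes \<psi>: "\<psi> \<in> C1_c"
  shows "(LINT z:strip b1 b2|lborel. u z * frechet_derivative \<psi> (at z) (j, 0) + \<psi> z * (G z \<bullet> (j, 0))) = 0"
  unfolding set_lebesgue_integral_def
proof (rule integral_directional_derivative_eq_0[where i="(j, 0)"])
  show "integrable lborel (\<lambda>z. indicator (strip b1 b2) z *\<^sub>R (u z * \<psi> z))"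
    using product_integrable(3)[OF \<psi>] by (simp add: set_integrable_def)
  show "integrable lborel (\<lambda>z. indicator (strip b1 b2) z *\<^sub>R (u z * frechet_derivative \<psi> (at z) (j, 0) + \<psi> z * (G z \<bullet> (j, 0))))"
    using set_integral_add(1)[OF product_integrable(1,2)[OF \<psi>]] by (simp add: set_integrable_def)
  fix z :: "'a \<times> real" and \<tau> :: real
  have i: "indicator (strip b1 b2) (z + \<tau> *\<^sub>R (j, 0)) = (indicator (strip b1 b2) z :: real)" for \<tau>
    by (auto simp: strip_def indicator_def)
  show "((\<lambda>\<tau>. indicator (strip b1 b2) (z + \<tau> *\<^sub>R (j, 0)) *\<^sub>R (u (z + \<tau> *\<^sub>R (j, 0)) * \<psi> (z + \<tau> *\<^sub>R (j, 0)))) has_real_derivative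
     indicator (strip b1 b2) (z + \<tau> *\<^sub>R (j, 0)) *\<^sub>R
     (u (z + \<tau> *\<^sub>R (j, 0)) * frechet_derivative \<psi> (at (z + \<tau> *\<^sub>R (j, 0))) (j, 0) + \<psi> (z + \<tau> *\<^sub>R (j, 0)) * (G (z + \<tau> *\<^sub>R (j, 0)) \<bullet> (j, 0)))) (at \<tau>)"
  proof (cases "z \<in> strip b1 b2")
    case True
    then have z': "z + \<tau> *\<^sub>R (j, 0) \<in> strip b1 b2" by (auto simp: strip_def)
    show ?thesis unfolding i
      using True DERIV_mult[OF has_real_derivative_along_line[OF deriv[OF z']]
          has_real_derivative_along_line[OF C1_c_has_derivative[OF \<psi>], where z=z and i="(j, 0)"]]
      by (simp add: mult.commute add.commute)
  next
    case False
    then show ?thesis unfolding i by simp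
  qed
qed

text \<open>Fubini reduces the claim to almost every vertical segment, on which both Hardy integrals
  and the p-th power of the gradient are finite; \<open>integration_by_parts_Hardy\<close> then
  produces the boundary terms.\<close>

lemma Green_vertical:
  assumes \<psi>: "\<psi> \<in> C1_c"
  shows "(LINT z:strip b1 b2|lborel. u z * frechet_derivative \<psi> (at z) (0, 1) + \<psi> z * (G z \<bullet> (0, 1)))
     = (\<integral>x. \<psi> (x, b2) * f2 x \<partial>lborel) - (\<integral>x. \<psi> (x, b1) * f1 x \<partial>lborel)"
proof -
  define h where "h z = indicator (strip b1 b2) z *\<^sub>R (u z * frechet_derivative \<psi> (at z) (0, 1) + \<psi> z * (G z \<bullet> (0, 1)))" for z
  have h: "integrable (lborel \<Otimes>\<^sub>M lborel) h"
    using set_integral_add(1)[OF product_integrable(1,2)[OF \<psi>]] unfolding h_def[abs_def]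
    by (simp add: set_integrable_def lborel_prod)
  have hxt: "h (x, t) = indicator {b1<..<b2} t *\<^sub>R (u (x, t) * frechet_derivative \<psi> (at (x, t)) (0, 1) + \<psi> (x, t) * (G (x, t) \<bullet> (0, 1)))" for x t
    by (auto simp: h_def strip_def indicator_def)
  have line: "(x, t) = (x, 0) + t *\<^sub>R (0, 1)" for x :: 'a and t :: real by simp
  have "(LINT z:strip b1 b2|lborel. u z * frechet_derivative \<psi> (at z) (0, 1) + \<psi> z * (G z \<bullet> (0, 1))) = integral\<^sup>L (lborel \<Otimes>\<^sub>M lborel) h"
    by (simp add: set_lebesgue_integral_def h_def[abs_def] lborel_prod)
  also have "\<dots> = (\<integral>x. (\<integral>t. h (x, t) \<partial>lborel) \<partial>lborel)"
    by (rule lborel_pair.integral_fst'[OF h, symmetric])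
  also have "\<dots> = (\<integral>x. \<psi> (x, b2) * f2 x - \<psi> (x, b1) * f1 x \<partial>lborel)"
  proof (rule integral_cong_AE)
    show "(\<lambda>x. \<integral>t. h (x, t) \<partial>lborel) \<in> borel_measurable lborel"
      by (rule borel_measurable_integrable[OF lborel_pair.integrable_fst'[OF h]])
    show "(\<lambda>x. \<psi> (x, b2) * f2 x - \<psi> (x, b1) * f1 x) \<in> borel_measurable lborel"
      using boundary_integrable[OF \<psi>] by (intro borel_measurable_diff borel_measurable_integrable)
    show "AE x in lborel. (\<integral>t. h (x, t) \<partial>lborel) = \<psi> (x, b2) * f2 x - \<psi> (x, b1) * f1 x"
      using lborel_pair.AE_integrable_fst'[OF h] AE_slice_Hardy
    proof eventually_elim
      fix x
      assume hx: "integrable lborel (\<lambda>t. h (x, t))"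
        and H1: "(\<integral>\<^sup>+t\<in>{b1<..<b2}. ennreal ((\<bar>u (x, t) - f1 x\<bar> / (t - b1)) powr p) \<partial>lborel) < \<infinity>"
        and H2: "(\<integral>\<^sup>+t\<in>{b1<..<b2}. ennreal ((\<bar>u (x, t) - f2 x\<bar> / (b2 - t)) powr p) \<partial>lborel) < \<infinity>"
        and HG: "(\<integral>\<^sup>+t\<in>{b1<..<b2}. ennreal (norm (G (x, t)) powr p) \<partial>lborel) < \<infinity>"
      note [measurable] = slice_measurable(1)[OF u_measurable, of x] slice_measurable(1)[OF G_measurable, of x]
      have "(\<integral>\<^sup>+t. ennreal (norm (indicator {b1<..<b2} t *\<^sub>R (G (x, t) \<bullet> (0, 1)))) \<partial>lborel)
        \<le> (\<integral>\<^sup>+t. indicator {b1<..<b2} t + ennreal (norm (G (x, t)) powr p) * indicator {b1<..<b2} t \<partial>lborel)"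
      proof (rule nn_integral_mono)
        fix t
        have "ennreal \<bar>G (x, t) \<bullet> (0, 1)\<bar> \<le> 1 + ennreal (norm (G (x, t)) powr p)"
          using ennreal_leI[OF G_le[of "(x, t)" "(0, 1)"]] by (simp add: ennreal_plus)
        then show "ennreal (norm (indicator {b1<..<b2} t *\<^sub>R (G (x, t) \<bullet> (0, 1))))
          \<le> indicator {b1<..<b2} t + ennreal (norm (G (x, t)) powr p) * indicator {b1<..<b2} t"
          by (auto simp: indicator_def)
      qed
      also have "\<dots> < \<infinity>" using HG b by (simp add: nn_integral_add)
      finally have iG: "set_integrable lborel {b1<..<b2} (\<lambda>t. G (x, t) \<bullet> (0, 1))"
        unfolding set_integrable_def by (intro integrableI_bounded) auto
      have "(LINT t:{b1<..<b2}|lborel. u (x, t) * frechet_derivative \<psi> (at (x, t)) (0, 1) + \<psi> (x, t) * (G (x, t) \<bullet> (0, 1)))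
        = f2 x * \<psi> (x, b2) - f1 x * \<psi> (x, b1)"
      proof (rule integration_by_parts_Hardy[OF b p _ iG _ _ _ H1 H2])
        fix t assume "b1 < t" "t < b2"
        then have "(x, t) \<in> strip b1 b2" by (simp add: strip_def)
        from has_real_derivative_along_line[OF deriv[OF this, unfolded line[of x t]]]
        show "((\<lambda>t. u (x, t)) has_real_derivative G (x, t) \<bullet> (0, 1)) (at t)" by simp
      next
        fix t
        from has_real_derivative_along_line[OF C1_c_has_derivative[OF \<psi>], where z="(x, 0)" and \<tau>=t and i="(0, 1)"]
        show "((\<lambda>t. \<psi> (x, t)) has_real_derivative frechet_derivative \<psi> (at (x, t)) (0, 1)) (at t)" by simp
      next
        show "set_borel_measurable borel {b1<..<b2} (\<lambda>t. u (x, t))"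
          unfolding set_borel_measurable_def by measurable
        show "set_integrable lborel {b1<..<b2} (\<lambda>t. u (x, t) * frechet_derivative \<psi> (at (x, t)) (0, 1) + \<psi> (x, t) * (G (x, t) \<bullet> (0, 1)))"
          using hx by (simp add: set_integrable_def hxt)
      qed
      then show "(\<integral>t. h (x, t) \<partial>lborel) = \<psi> (x, b2) * f2 x - \<psi> (x, b1) * f1 x"
        by (simp add: set_lebesgue_integral_def hxt mult.commute)
    qed
  qed
  also have "\<dots> = (\<integral>x. \<psi> (x, b2) * f2 x \<partial>lborel) - (\<integral>x. \<psi> (x, b1) * f1 x \<partial>lborel)"
    using boundary_integrable[OF \<psi>] by (rule_tac Bochner_Integration.integral_diff) auto
  finally show ?thesis .
qed

lemma Green:
  assumes \<psi>: "\<psi> \<in> C1_c" and i: "i \<in> Basis"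
  shows "(LINT x:strip b1 b2|lborel. u x * frechet_derivative \<psi> (at x) i)
             = - (LINT x:strip b1 b2|lborel. \<psi> x * (G x \<bullet> i))
               + ((LINT x'|lborel. \<psi> (x', b1) * f1 x' * ((0, -1) \<bullet> i))
                  + (LINT x'|lborel. \<psi> (x', b2) * f2 x' * ((0, 1) \<bullet> i)))"
proof -
  have sum: "(LINT z:strip b1 b2|lborel. u z * frechet_derivative \<psi> (at z) i + \<psi> z * (G z \<bullet> i))
     = (LINT x:strip b1 b2|lborel. u x * frechet_derivative \<psi> (at x) i) + (LINT x:strip b1 b2|lborel. \<psi> x * (G x \<bullet> i))"
    by (rule set_integral_add(2)[OF product_integrable(1,2)[OF \<psi>]])
  from i consider j where "i = (j, 0)" | "i = (0, 1)" by (auto simp: Basis_prod_def)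
  then show ?thesis
  proof cases
    case 1
    then show ?thesis using sum Green_horizontal[OF \<psi>, of j] by simp
  next
    case 2
    then show ?thesis using sum Green_vertical[OF \<psi>] by simp
  qed
qed

section \<open>Weak gradient, Sobolev membership and trace\<close>

lemma weak_gradient: "weak_gradient (strip b1 b2) u G"
  unfolding weak_gradient_def
proof (intro conjI ballI)
  have loc: "Lp_loc_on 1 (strip b1 b2) g"
    if g [measurable]: "g \<in> borel_measurable borel" and int: "\<And>R. set_integrable lborel (strip b1 b2 \<inter> cball 0 R) g"
    for g :: "'a \<times> real \<Rightarrow> real"
    unfolding Lp_loc_on_def set_borel_measurable_def
  proof (intro conjI allI impI)
    fix K :: "('a \<times> real) set" assume K: "compact K \<and> K \<subseteq> strip b1 b2"
    obtain R where "K \<subseteq> ball 0 R" using bounded_subset_ballD[OF compact_imp_bounded, of K 0] K by blast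
    then have "K \<subseteq> strip b1 b2 \<inter> cball 0 R" using K by force
    then show "Lp_on 1 K g"
      using K set_integrable_subset[OF int[of R]] by (intro Lp_on_1_of_set_integrable) (auto intro: borel_compact)
  qed measurable
  show "Lp_loc_on 1 (strip b1 b2) u" by (rule loc[OF u_measurable u_integrable])
  fix i :: "'a \<times> real" assume i: "i \<in> Basis"
  show "Lp_loc_on 1 (strip b1 b2) (\<lambda>x. G x \<bullet> i)" by (rule loc[OF _ G_integrable]) measurable
  fix \<phi> :: "'a \<times> real \<Rightarrow> real" assume \<phi>: "\<phi> \<in> C_infinity_c (strip b1 b2)"
  then have c1: "\<phi> \<in> C1_c" using C_infinity_c_subset_C1_c by blast
  \<comment> \<open>The support lies in the open strip, so both boundary integrals of Green's
    formula drop out.\<close>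
  have "\<phi> (x, b1) = 0 \<and> \<phi> (x, b2) = 0" for x
    using \<phi> closure_subset[of "{x. \<phi> x \<noteq> 0}"] by (auto simp: C_infinity_c_def strip_def)
  then show "(LINT x:strip b1 b2|lborel. u x * frechet_derivative \<phi> (at x) i)
             = - (LINT x:strip b1 b2|lborel. (G x \<bullet> i) * \<phi> x)"
    using Green[OF c1 i] by (simp add: mult.commute)
qed

lemma hom_sobolev: "u \<in> hom_sobolev p (strip b1 b2)"
  unfolding hom_sobolev_def
proof (intro CollectI exI[of _ G] conjI ballI weak_gradient)
  fix i :: "'a \<times> real" assume i: "i \<in> Basis"
  have "(\<integral>\<^sup>+z\<in>strip b1 b2. ennreal (\<bar>G z \<bullet> i\<bar> powr p) \<partial>lborel) \<le> (\<integral>\<^sup>+z\<in>strip b1 b2. ennreal (norm (G z) powr p) \<partial>lborel)"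
    using p Basis_le_norm[OF i] by (intro nn_integral_mono mult_right_mono ennreal_leI powr_mono2) auto
  then show "Lp_on p (strip b1 b2) (\<lambda>x. G x \<bullet> i)"
    using G_Lp unfolding Lp_on_def set_borel_measurable_def by auto
qed

text \<open>On almost every vertical line \<open>v\<close> agrees with \<open>u\<close> almost
  everywhere and so inherits the Hardy bounds. As \<open>v\<close> has limits at both ends of the
  line, these bounds force the limits to be the values of \<open>f1\<close> and
  \<open>f2\<close>.\<close>

lemma continuous_extension_boundary_values:
  assumes v: "continuous_on (closure (strip b1 b2)) v" and uv: "AE x in lborel. x \<in> strip b1 b2 \<longrightarrow> u x = v x"
  shows "(AE x' in lborel. f1 x' = v (x', b1)) \<and> (AE x' in lborel. f2 x' = v (x', b2))"
proof -
  have cont: "continuous_on {b1..b2} (\<lambda>t. v (x, t))" for x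
    by (rule continuous_on_compose2[OF v, of _ "Pair x"])
       (use segment_subset_closure_strip[OF b] in \<open>auto intro!: continuous_intros\<close>)
  have lim: "((\<lambda>t. v (x, t)) \<longlongrightarrow> v (x, b1)) (at_right b1)" "((\<lambda>t. v (x, t)) \<longlongrightarrow> v (x, b2)) (at_left b2)" for x
    using continuous_on_Icc_at_rightD[OF cont b] continuous_on_Icc_at_leftD[OF cont b] by auto
  have m: "set_borel_measurable borel {b1<..<b2} (\<lambda>t. v (x, t))" for x
    unfolding set_borel_measurable_def
    by (rule borel_measurable_continuous_on_indicator)
       (auto intro: continuous_on_subset[OF cont[of x]])
  have "AE x in lborel. AE t in lborel. (x, t) \<in> strip b1 b2 \<longrightarrow> u (x, t) = v (x, t)"
    using uv unfolding lborel_prod[symmetric] by (rule lborel_pair.AE_pair)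
  then have slice: "AE x in lborel. AE t in lborel. b1 < t \<and> t < b2 \<longrightarrow> u (x, t) = v (x, t)"
    by (simp add: strip_def)
  have 1: "AE x in lborel. f1 x = v (x, b1)"
    using slice AE_slice_Hardy(1)
  proof eventually_elim
    fix x assume ae: "AE t in lborel. b1 < t \<and> t < b2 \<longrightarrow> u (x, t) = v (x, t)"
      and H: "(\<integral>\<^sup>+t\<in>{b1<..<b2}. ennreal ((\<bar>u (x, t) - f1 x\<bar> / (t - b1)) powr p) \<partial>lborel) < \<infinity>"
    have "(\<integral>\<^sup>+t\<in>{b1<..<b2}. ennreal ((\<bar>u (x, t) - f1 x\<bar> / (t - b1)) powr p) \<partial>lborel)
      = (\<integral>\<^sup>+t\<in>{b1<..<b2}. ennreal ((\<bar>v (x, t) - f1 x\<bar> / (t - b1)) powr p) \<partial>lborel)"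
      using ae by (intro nn_integral_cong_AE) (auto simp: indicator_def elim!: eventually_mono)
    note H[unfolded this]
    from right_limit_of_Hardy_bound[OF lim(1) b p this] show "f1 x = v (x, b1)" by (rule sym)
  qed
  have 2: "AE x in lborel. f2 x = v (x, b2)"
    using slice AE_slice_Hardy(2)
  proof eventually_elim
    fix x assume ae: "AE t in lborel. b1 < t \<and> t < b2 \<longrightarrow> u (x, t) = v (x, t)"
      and H: "(\<integral>\<^sup>+t\<in>{b1<..<b2}. ennreal ((\<bar>u (x, t) - f2 x\<bar> / (b2 - t)) powr p) \<partial>lborel) < \<infinity>"
    have "(\<integral>\<^sup>+t\<in>{b1<..<b2}. ennreal ((\<bar>u (x, t) - f2 x\<bar> / (b2 - t)) powr p) \<partial>lborel)
      = (\<integral>\<^sup>+t\<in>{b1<..<b2}. ennreal ((\<bar>v (x, t) - f2 x\<bar> / (b2 - t)) powr p) \<partial>lborel)"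
      using ae by (intro nn_integral_cong_AE) (auto simp: indicator_def elim!: eventually_mono)
    note H[unfolded this]
    from left_limit_of_Hardy_bound[OF lim(2) b p m this] show "f2 x = v (x, b2)" by (rule sym)
  qed
  show ?thesis using 1 2 ..
qed

lemma has_trace:
  assumes "Lp_loc_on p UNIV f1" "Lp_loc_on p UNIV f2"
  shows "has_trace p b1 b2 u f1 f2"
  unfolding has_trace_def
  using assms hom_sobolev continuous_extension_boundary_values weak_gradient Green by blast

end

section \<open>The extension operator\<close>

lemma bump_avg_measurable [measurable]:
  fixes f :: "'a::euclidean_space \<Rightarrow> real"
  assumes [measurable]: "f \<in> borel_measurable borel"
  shows "bump_avg f \<in> borel_measurable borel" "bump_avg_grad f \<in> borel_measurable borel"
proof -
  have "(\<lambda>z::('a \<times> real) \<times> 'a. (4 * bump (fst z) (snd z)) *\<^sub>R (snd z - fst (fst z), snd (fst z))) \<in> borel_measurable borel"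
    unfolding bump_def by (intro borel_measurable_continuous_onI continuous_intros)
  then have [measurable]: "(\<lambda>z::('a \<times> real) \<times> 'a. (4 * bump (fst z) (snd z)) *\<^sub>R (snd z - fst (fst z), snd (fst z))) \<in> borel_measurable (borel \<Otimes>\<^sub>M lborel)"
    by (subst measurable_cong_sets[OF sets_pair_measure_cong[OF refl sets_lborel] refl]) (simp only: borel_prod)
  show "bump_avg f \<in> borel_measurable borel"
    unfolding bump_avg_def by (intro lborel.borel_measurable_lebesgue_integral) (simp add: case_prod_unfold)
  show "bump_avg_grad f \<in> borel_measurable borel"
    unfolding bump_avg_grad_def
    by (intro lborel.borel_measurable_lebesgue_integral, unfold case_prod_unfold) measurable
qed

lemma mollify_measurable [measurable]:
  fixes f :: "'a::euclidean_space \<Rightarrow> real"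
  assumes [measurable]: "f \<in> borel_measurable borel"
  shows "mollify f \<in> borel_measurable borel" "mollify_grad f \<in> borel_measurable borel"
  unfolding mollify_def[abs_def] mollify_grad_def[abs_def] by measurable

text \<open>With (c, k) equal to (- \<epsilon> b1, \<epsilon>) or (\<epsilon> b2, - \<epsilon>) the
  new last coordinate is \<epsilon> times the distance to the bottom or to the top
  hyperplane.\<close>

definition rescale :: "real \<Rightarrow> real \<Rightarrow> 'a::euclidean_space \<times> real \<Rightarrow> 'a \<times> real" where
  "rescale c k z = (fst z, c + k * snd z)"

lemma rescale_measurable [measurable]: "rescale c k \<in> borel_measurable borel"
  unfolding rescale_def[abs_def] by (intro borel_measurable_continuous_onI continuous_intros)

text \<open>The adjoint of the linear part of \<open>rescale c k\<close>, so it carries gradients to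
  gradients under the chain rule.\<close>

definition rescaled_grad :: "real \<Rightarrow> 'a::euclidean_space \<times> real \<Rightarrow> 'a \<times> real" where
  "rescaled_grad k g = (fst g, k * snd g)"

lemma rescaled_grad_measurable [measurable]: "rescaled_grad k \<in> borel_measurable borel"
  unfolding rescaled_grad_def[abs_def] by (intro borel_measurable_continuous_onI continuous_intros)

lemma norm_rescaled_grad: "norm (rescaled_grad k g) \<le> (1 + \<bar>k\<bar>) * norm g"
proof -
  have "norm (rescaled_grad k g) \<le> norm (fst g) + \<bar>k\<bar> * norm (snd g)"
    unfolding rescaled_grad_def by (rule order_trans[OF norm_Pair_le]) (simp add: abs_mult)
  also have "\<dots> \<le> norm g + \<bar>k\<bar> * norm g"
    using norm_fst_le[of "fst g" "snd g"] norm_snd_le[of "snd g" "fst g"] by (intro add_mono mult_left_mono) auto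
  finally show ?thesis by (simp add: algebra_simps)
qed

lemma mollify_rescale_has_derivative:
  assumes f: "Lp_loc_on 1 UNIV f" and z: "c + k * snd z > 0"
  shows "((\<lambda>z. mollify f (rescale c k z)) has_derivative
    (\<lambda>v. rescaled_grad k (mollify_grad f (rescale c k z)) \<bullet> v)) (at z)"
proof -
  have "(rescale c k has_derivative (\<lambda>v. (fst v, k * snd v))) (at z)"
    unfolding rescale_def[abs_def] by (auto intro!: derivative_eq_intros)
  moreover have "(mollify f has_derivative (\<lambda>v. mollify_grad f (rescale c k z) \<bullet> v)) (at (rescale c k z))"
    by (rule mollify_has_derivative[OF f]) (use z in \<open>simp add: rescale_def\<close>)
  ultimately have "((\<lambda>z. mollify f (rescale c k z)) has_derivative
      (\<lambda>v. mollify_grad f (rescale c k z) \<bullet> (fst v, k * snd v))) (at z)"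
    by (rule has_derivative_compose)
  then show ?thesis by (simp add: rescaled_grad_def inner_prod_def mult_ac)
qed

section \<open>The extension and its pointwise majorant\<close>

definition strip_extension ::
  "real \<Rightarrow> real \<Rightarrow> real \<Rightarrow> ('a::euclidean_space \<Rightarrow> real) \<Rightarrow> ('a \<Rightarrow> real) \<Rightarrow> 'a \<times> real \<Rightarrow> real" where
  "strip_extension \<epsilon> b1 b2 f1 f2 z =
     (b2 - snd z) / (b2 - b1) * mollify f1 (rescale (- \<epsilon> * b1) \<epsilon> z)
     + (snd z - b1) / (b2 - b1) * mollify f2 (rescale (\<epsilon> * b2) (- \<epsilon>) z)"

definition strip_extension_grad ::
  "real \<Rightarrow> real \<Rightarrow> real \<Rightarrow> ('a::euclidean_space \<Rightarrow> real) \<Rightarrow> ('a \<Rightarrow> real) \<Rightarrow> 'a \<times> real \<Rightarrow> 'a \<times> real" where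
  "strip_extension_grad \<epsilon> b1 b2 f1 f2 z =
     ((b2 - snd z) / (b2 - b1)) *\<^sub>R rescaled_grad \<epsilon> (mollify_grad f1 (rescale (- \<epsilon> * b1) \<epsilon> z))
     + ((snd z - b1) / (b2 - b1)) *\<^sub>R rescaled_grad (- \<epsilon>) (mollify_grad f2 (rescale (\<epsilon> * b2) (- \<epsilon>) z))
     + ((mollify f2 (rescale (\<epsilon> * b2) (- \<epsilon>) z) - mollify f1 (rescale (- \<epsilon> * b1) \<epsilon> z)) / (b2 - b1)) *\<^sub>R (0, 1)"

lemma strip_extension_lincomb:
  assumes "Lp_loc_on 1 UNIV f1" "Lp_loc_on 1 UNIV f2" "Lp_loc_on 1 UNIV g1" "Lp_loc_on 1 UNIV g2"
    and "\<epsilon> > 0" "z \<in> strip b1 b2"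
  shows "strip_extension \<epsilon> b1 b2 (\<lambda>y. \<alpha> * f1 y + \<beta> * g1 y) (\<lambda>y. \<alpha> * f2 y + \<beta> * g2 y) z
    = \<alpha> * strip_extension \<epsilon> b1 b2 f1 f2 z + \<beta> * strip_extension \<epsilon> b1 b2 g1 g2 z"
proof -
  have "snd (rescale (- \<epsilon> * b1) \<epsilon> z) \<ge> 0" "snd (rescale (\<epsilon> * b2) (- \<epsilon>) z) \<ge> 0"
    using assms(5,6) by (auto simp: rescale_def strip_def)
  note mollify_lincomb[OF assms(1,3) this(1)] mollify_lincomb[OF assms(2,4) this(2)]
  then show ?thesis unfolding strip_extension_def by (simp add: algebra_simps)
qed

lemma strip_extension_has_derivative:
  assumes "Lp_loc_on 1 UNIV f1" "Lp_loc_on 1 UNIV f2" and \<epsilon>: "\<epsilon> > 0" and z: "z \<in> strip b1 b2"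
  shows "(strip_extension \<epsilon> b1 b2 f1 f2 has_derivative (\<lambda>v. strip_extension_grad \<epsilon> b1 b2 f1 f2 z \<bullet> v)) (at z)"
proof -
  have d: "b2 - b1 > 0" using z by (auto simp: strip_def)
  have "- \<epsilon> * b1 + \<epsilon> * snd z > 0" "\<epsilon> * b2 + (- \<epsilon>) * snd z > 0" using z \<epsilon> by (auto simp: strip_def)
  note M1 = mollify_rescale_has_derivative[OF assms(1) this(1)] and M2 = mollify_rescale_has_derivative[OF assms(2) this(2)]
  have 1: "((\<lambda>z. (b2 - snd z) / (b2 - b1)) has_derivative (\<lambda>v. - snd v / (b2 - b1))) (at z)"
    using d by (auto intro!: derivative_eq_intros)
  have 2: "((\<lambda>z. (snd z - b1) / (b2 - b1)) has_derivative (\<lambda>v. snd v / (b2 - b1))) (at z)"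
    using d by (auto intro!: derivative_eq_intros)
  show ?thesis
    unfolding strip_extension_def[abs_def]
    by (rule has_derivative_eq_rhs[OF has_derivative_add[OF has_derivative_mult[OF 1 M1] has_derivative_mult[OF 2 M2]]])
       (auto simp: strip_extension_grad_def fun_eq_iff inner_add_left inner_prod_def[of "(0, 1)"] diff_divide_distrib algebra_simps)
qed

lemma strip_extension_measurable:
  assumes [measurable]: "f1 \<in> borel_measurable borel" "f2 \<in> borel_measurable borel"
  shows "strip_extension \<epsilon> b1 b2 f1 f2 \<in> borel_measurable borel"
    "strip_extension_grad \<epsilon> b1 b2 f1 f2 \<in> borel_measurable borel"
proof -
  have [measurable]: "(snd :: 'a \<times> real \<Rightarrow> real) \<in> borel_measurable borel"
    by (intro borel_measurable_continuous_onI continuous_intros)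
  show "strip_extension \<epsilon> b1 b2 f1 f2 \<in> borel_measurable borel"
    unfolding strip_extension_def[abs_def] by measurable
  show "strip_extension_grad \<epsilon> b1 b2 f1 f2 \<in> borel_measurable borel"
    unfolding strip_extension_grad_def[abs_def] by measurable
qed

text \<open>A single function dominates the gradient and both Hardy quotients, so that one integral
  estimate delivers the energy bound together with the finiteness hypotheses of
  \<open>strip_function\<close>.\<close>

definition energy_majorant ::
  "real \<Rightarrow> real \<Rightarrow> real \<Rightarrow> real \<Rightarrow> real \<Rightarrow> ('a::euclidean_space \<Rightarrow> real) \<Rightarrow> ('a \<Rightarrow> real) \<Rightarrow> 'a \<times> real \<Rightarrow> ennreal" where
  "energy_majorant K p \<epsilon> b1 b2 f1 f2 z =
     ennreal (3 powr p * K) * (diff_energy p f1 (fst z, - \<epsilon> * b1 + \<epsilon> * snd z) + diff_energy p f2 (fst z, \<epsilon> * b2 + (- \<epsilon>) * snd z))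
     + ennreal (3 powr p) * ennreal ((\<bar>f2 (fst z) - f1 (fst z)\<bar> / (b2 - b1)) powr p)"

lemma strip_extension_majorant:
  fixes p \<epsilon> :: real
  assumes p: "p > 1" and \<epsilon>: "\<epsilon> > 0"
  shows "\<exists>K>0. \<forall>(f1 :: 'a::euclidean_space \<Rightarrow> real) f2 b1 b2. \<forall>z\<in>strip b1 b2.
    Lp_loc_on 1 UNIV f1 \<and> Lp_loc_on 1 UNIV f2 \<longrightarrow>
      ennreal (norm (strip_extension_grad \<epsilon> b1 b2 f1 f2 z) powr p) \<le> energy_majorant K p \<epsilon> b1 b2 f1 f2 z \<and>
      ennreal ((\<bar>strip_extension \<epsilon> b1 b2 f1 f2 z - f1 (fst z)\<bar> / (snd z - b1)) powr p) \<le> energy_majorant K p \<epsilon> b1 b2 f1 f2 z \<and>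
      ennreal ((\<bar>strip_extension \<epsilon> b1 b2 f1 f2 z - f2 (fst z)\<bar> / (b2 - snd z)) powr p) \<le> energy_majorant K p \<epsilon> b1 b2 f1 f2 z"
proof -
  obtain C :: real where C: "C > 0" "\<And>f (x::'a) s. Lp_loc_on 1 UNIV f \<Longrightarrow> s > 0 \<Longrightarrow>
     ennreal (\<bar>mollify f (x, s) - f x\<bar> powr p) \<le> ennreal (C * s powr p) * diff_energy p f (x, s) \<and>
     ennreal (norm (mollify_grad f (x, s)) powr p) \<le> ennreal C * diff_energy p f (x, s)"
    using mollify_Lp_bounds[where 'a='a, OF p] by blast
  \<comment> \<open>(1 + \<epsilon>)^p is the cost of rescaling the gradient, \<epsilon>^p that of
    dividing by the distance r = s / \<epsilon> instead of the scale s, and 3^p that of splitting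
    the sum.\<close>
  define K where "K = 3 powr p * ((1 + \<epsilon>) powr p + \<epsilon> powr p) * C"
  have K: "K > 0" using C \<epsilon> by (simp add: K_def add_pos_pos)
  have half: "ennreal (((1 + \<epsilon>) * norm (mollify_grad f (x, s)) + \<bar>mollify f (x, s) - f x\<bar> / r) powr p) \<le> ennreal K * diff_energy p f (x, s)"
    if f: "Lp_loc_on 1 UNIV f" and s: "s = \<epsilon> * r" "r > 0" for f and x :: 'a and s r
  proof -
    have s0: "s > 0" using s \<epsilon> by simp
    have "((1 + \<epsilon>) * norm (mollify_grad f (x, s)) + \<bar>mollify f (x, s) - f x\<bar> / r) powr p
       = ((1 + \<epsilon>) * norm (mollify_grad f (x, s)) + \<bar>mollify f (x, s) - f x\<bar> / r + 0) powr p" by simp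
    also have "\<dots> \<le> 3 powr p * (((1 + \<epsilon>) * norm (mollify_grad f (x, s))) powr p + (\<bar>mollify f (x, s) - f x\<bar> / r) powr p + 0 powr p)"
      using \<epsilon> s p by (intro powr_sum3_le) auto
    also have "\<dots> = 3 powr p * (1 + \<epsilon>) powr p * norm (mollify_grad f (x, s)) powr p + 3 powr p / r powr p * \<bar>mollify f (x, s) - f x\<bar> powr p"
      using \<epsilon> s by (simp add: powr_mult powr_divide distrib_left)
    finally have "ennreal (((1 + \<epsilon>) * norm (mollify_grad f (x, s)) + \<bar>mollify f (x, s) - f x\<bar> / r) powr p)
      \<le> ennreal (3 powr p * (1 + \<epsilon>) powr p) * ennreal (norm (mollify_grad f (x, s)) powr p)
        + ennreal (3 powr p / r powr p) * ennreal (\<bar>mollify f (x, s) - f x\<bar> powr p)"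
      by (simp add: ennreal_mult'[symmetric] ennreal_plus[symmetric] ennreal_leI del: ennreal_plus)
    also have "\<dots> \<le> ennreal (3 powr p * (1 + \<epsilon>) powr p) * (ennreal C * diff_energy p f (x, s))
        + ennreal (3 powr p / r powr p) * (ennreal (C * s powr p) * diff_energy p f (x, s))"
      using C(2)[OF f s0] by (intro add_mono mult_left_mono) auto
    also have "\<dots> = (ennreal (3 powr p * (1 + \<epsilon>) powr p * C) + ennreal (3 powr p / r powr p * (C * s powr p))) * diff_energy p f (x, s)"
      using C(1) by (simp only: distrib_right mult.assoc[symmetric])
        (simp add: ennreal_mult'[symmetric] mult.assoc)
    also have "ennreal (3 powr p * (1 + \<epsilon>) powr p * C) + ennreal (3 powr p / r powr p * (C * s powr p))
        = ennreal (3 powr p * (1 + \<epsilon>) powr p * C + 3 powr p / r powr p * (C * s powr p))"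
      using C(1) by (intro ennreal_plus[symmetric]) auto
    also have "3 powr p * (1 + \<epsilon>) powr p * C + 3 powr p / r powr p * (C * s powr p) = K"
      using s \<epsilon> by (simp add: K_def powr_mult algebra_simps)
    finally show ?thesis .
  qed
  show ?thesis
  proof (intro exI[of _ K] conjI K allI ballI impI)
    fix f1 f2 :: "'a \<Rightarrow> real" and b1 b2 :: real and z :: "'a \<times> real"
    assume z: "z \<in> strip b1 b2" and "Lp_loc_on 1 UNIV f1 \<and> Lp_loc_on 1 UNIV f2"
    then have f: "Lp_loc_on 1 UNIV f1" "Lp_loc_on 1 UNIV f2" by auto
    obtain x t where xt: "z = (x, t)" by force
    have t: "b1 < t" "t < b2" using z xt by (auto simp: strip_def)
    define d where "d = b2 - b1"
    define \<theta> where "\<theta> = (t - b1) / d"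
    have d: "d > 0" "t - b1 \<le> d" "b2 - t \<le> d" "t - b1 > 0" "b2 - t > 0" using t by (auto simp: d_def)
    have \<theta>: "0 \<le> \<theta>" "\<theta> \<le> 1" "(b2 - t) / d = 1 - \<theta>" using d by (auto simp: \<theta>_def d_def field_simps)
    have r: "rescale (- \<epsilon> * b1) \<epsilon> z = (x, \<epsilon> * (t - b1))" "rescale (\<epsilon> * b2) (- \<epsilon>) z = (x, \<epsilon> * (b2 - t))"
      by (auto simp: rescale_def xt algebra_simps)
    define m1 where "m1 = mollify f1 (x, \<epsilon> * (t - b1))"
    define m2 where "m2 = mollify f2 (x, \<epsilon> * (b2 - t))"
    define g1 where "g1 = mollify_grad f1 (x, \<epsilon> * (t - b1))"
    define g2 where "g2 = mollify_grad f2 (x, \<epsilon> * (b2 - t))"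
    define e1 where "e1 = \<bar>m1 - f1 x\<bar> / (t - b1)"
    define e2 where "e2 = \<bar>m2 - f2 x\<bar> / (b2 - t)"
    define X1 where "X1 = (1 + \<epsilon>) * norm g1 + e1"
    define X2 where "X2 = (1 + \<epsilon>) * norm g2 + e2"
    define \<delta> where "\<delta> = \<bar>f2 x - f1 x\<bar> / d"
    have nn: "e1 \<ge> 0" "e2 \<ge> 0" "\<delta> \<ge> 0" "X1 \<ge> 0" "X2 \<ge> 0" "e1 \<le> X1" "e2 \<le> X2"
      using d \<epsilon> by (auto simp: e1_def e2_def \<delta>_def X1_def X2_def)
    have X: "ennreal (X1 powr p) \<le> ennreal K * diff_energy p f1 (x, \<epsilon> * (t - b1))"
      "ennreal (X2 powr p) \<le> ennreal K * diff_energy p f2 (x, \<epsilon> * (b2 - t))"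
      unfolding X1_def X2_def e1_def e2_def m1_def m2_def g1_def g2_def
      by (rule half[OF f(1)] half[OF f(2)]; use d in simp)+
    \<comment> \<open>Each of the three claims is thereby reduced to bounding its quantity by X1 +
      X2 + \<delta>.\<close>
    have main: "ennreal (y powr p) \<le> energy_majorant K p \<epsilon> b1 b2 f1 f2 z" if y: "0 \<le> y" "y \<le> X1 + X2 + \<delta>" for y
    proof -
      have "y powr p \<le> (X1 + X2 + \<delta>) powr p" using y p by (intro powr_mono2) auto
      also have "\<dots> \<le> 3 powr p * (X1 powr p + X2 powr p + \<delta> powr p)"
        using nn p by (intro powr_sum3_le) auto
      finally have "ennreal (y powr p) \<le> ennreal (3 powr p) * (ennreal (X1 powr p) + ennreal (X2 powr p) + ennreal (\<delta> powr p))"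
        by (simp add: ennreal_mult'[symmetric] ennreal_plus[symmetric] ennreal_leI del: ennreal_plus)
      also have "\<dots> \<le> ennreal (3 powr p) * (ennreal K * diff_energy p f1 (x, \<epsilon> * (t - b1)) + ennreal K * diff_energy p f2 (x, \<epsilon> * (b2 - t)) + ennreal (\<delta> powr p))"
        by (intro mult_left_mono add_mono X) auto
      also have "\<dots> = energy_majorant K p \<epsilon> b1 b2 f1 f2 z"
        using K by (simp add: energy_majorant_def xt \<delta>_def d_def distrib_left ennreal_mult' mult.assoc algebra_simps)
      finally show ?thesis .
    qed
    have e1d: "\<bar>m1 - f1 x\<bar> / d \<le> e1" and e2d: "\<bar>m2 - f2 x\<bar> / d \<le> e2"
      unfolding e1_def e2_def using d by (auto intro!: divide_left_mono)
    have u: "strip_extension \<epsilon> b1 b2 f1 f2 z = (1 - \<theta>) * m1 + \<theta> * m2"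
      unfolding strip_extension_def r m1_def m2_def \<theta>(3)[symmetric] by (simp add: xt \<theta>_def d_def)
    have G: "strip_extension_grad \<epsilon> b1 b2 f1 f2 z = (1 - \<theta>) *\<^sub>R rescaled_grad \<epsilon> g1 + \<theta> *\<^sub>R rescaled_grad (- \<epsilon>) g2 + ((m2 - m1) / d) *\<^sub>R (0, 1)"
      unfolding strip_extension_grad_def r m1_def m2_def g1_def g2_def \<theta>(3)[symmetric] by (simp add: xt \<theta>_def d_def)
    show "ennreal (norm (strip_extension_grad \<epsilon> b1 b2 f1 f2 z) powr p) \<le> energy_majorant K p \<epsilon> b1 b2 f1 f2 z"
    proof (rule main)
      have "norm (strip_extension_grad \<epsilon> b1 b2 f1 f2 z)
        \<le> norm ((1 - \<theta>) *\<^sub>R rescaled_grad \<epsilon> g1) + norm (\<theta> *\<^sub>R rescaled_grad (- \<epsilon>) g2) + norm (((m2 - m1) / d) *\<^sub>R (0::'a, 1::real))"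
        unfolding G by (intro norm_triangle_le add_mono) auto
      also have "norm ((1 - \<theta>) *\<^sub>R rescaled_grad \<epsilon> g1) \<le> (1 + \<epsilon>) * norm g1"
        using mult_mono[of "1 - \<theta>" 1 "norm (rescaled_grad \<epsilon> g1)" "(1 + \<epsilon>) * norm g1"] norm_rescaled_grad[of \<epsilon> g1] \<theta> \<epsilon> by simp
      also have "norm (\<theta> *\<^sub>R rescaled_grad (- \<epsilon>) g2) \<le> (1 + \<epsilon>) * norm g2"
        using mult_mono[of \<theta> 1 "norm (rescaled_grad (- \<epsilon>) g2)" "(1 + \<epsilon>) * norm g2"] norm_rescaled_grad[of "- \<epsilon>" g2] \<theta> \<epsilon> by simp
      also have "norm (((m2 - m1) / d) *\<^sub>R (0::'a, 1::real)) = \<bar>m2 - m1\<bar> / d"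
        using d by (simp add: norm_Pair)
      \<comment> \<open>This term stems from differentiating the interpolation weights. It is split
        through f2 x and f1 x; the distances to the hyperplanes are at most d, so the two
        mollification errors over d are below e2 and e1.\<close>
      also have "\<bar>m2 - m1\<bar> / d \<le> (\<bar>m2 - f2 x\<bar> + \<bar>f2 x - f1 x\<bar> + \<bar>m1 - f1 x\<bar>) / d"
        using d by (intro divide_right_mono) auto
      also have "\<dots> \<le> e2 + \<delta> + e1" using e1d e2d by (simp add: add_divide_distrib \<delta>_def)
      finally show "norm (strip_extension_grad \<epsilon> b1 b2 f1 f2 z) \<le> X1 + X2 + \<delta>" by (simp add: X1_def X2_def)
    qed simp
    show "ennreal ((\<bar>strip_extension \<epsilon> b1 b2 f1 f2 z - f1 (fst z)\<bar> / (snd z - b1)) powr p) \<le> energy_majorant K p \<epsilon> b1 b2 f1 f2 z"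
    proof (rule main)
      have "strip_extension \<epsilon> b1 b2 f1 f2 z - f1 x = (1 - \<theta>) * (m1 - f1 x) + \<theta> * (m2 - f2 x) + \<theta> * (f2 x - f1 x)"
        unfolding u by (simp add: algebra_simps)
      then have "\<bar>strip_extension \<epsilon> b1 b2 f1 f2 z - f1 x\<bar> \<le> (1 - \<theta>) * \<bar>m1 - f1 x\<bar> + \<theta> * \<bar>m2 - f2 x\<bar> + \<theta> * \<bar>f2 x - f1 x\<bar>"
        using \<theta> abs_triangle_ineq[of "(1 - \<theta>) * (m1 - f1 x) + \<theta> * (m2 - f2 x)" "\<theta> * (f2 x - f1 x)"]
          abs_triangle_ineq[of "(1 - \<theta>) * (m1 - f1 x)" "\<theta> * (m2 - f2 x)"] by (simp add: abs_mult)
      also have "\<dots> \<le> \<bar>m1 - f1 x\<bar> + \<theta> * \<bar>m2 - f2 x\<bar> + \<theta> * \<bar>f2 x - f1 x\<bar>"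
        using \<theta> by (simp add: mult_left_le_one_le)
      finally have "\<bar>strip_extension \<epsilon> b1 b2 f1 f2 z - f1 x\<bar> / (t - b1)
        \<le> (\<bar>m1 - f1 x\<bar> + \<theta> * \<bar>m2 - f2 x\<bar> + \<theta> * \<bar>f2 x - f1 x\<bar>) / (t - b1)"
        using d by (intro divide_right_mono) auto
      \<comment> \<open>The weight of the top mollification vanishes on the bottom hyperplane:
        \<theta> / (t - b1) = 1 / d. Only the bottom error is really divided by the
        distance.\<close>
      also have "\<dots> = e1 + \<bar>m2 - f2 x\<bar> / d + \<delta>"
        using d by (simp add: \<theta>_def e1_def \<delta>_def add_divide_distrib)
      also have "\<dots> \<le> X1 + X2 + \<delta>" using e2d nn by simp
      finally show "\<bar>strip_extension \<epsilon> b1 b2 f1 f2 z - f1 (fst z)\<bar> / (snd z - b1) \<le> X1 + X2 + \<delta>" by (simp add: xt)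
    qed (use d xt in simp)
    show "ennreal ((\<bar>strip_extension \<epsilon> b1 b2 f1 f2 z - f2 (fst z)\<bar> / (b2 - snd z)) powr p) \<le> energy_majorant K p \<epsilon> b1 b2 f1 f2 z"
    proof (rule main)
      have "strip_extension \<epsilon> b1 b2 f1 f2 z - f2 x = (1 - \<theta>) * (m1 - f1 x) + \<theta> * (m2 - f2 x) - (1 - \<theta>) * (f2 x - f1 x)"
        unfolding u by (simp add: algebra_simps)
      then have "\<bar>strip_extension \<epsilon> b1 b2 f1 f2 z - f2 x\<bar> \<le> (1 - \<theta>) * \<bar>m1 - f1 x\<bar> + \<theta> * \<bar>m2 - f2 x\<bar> + (1 - \<theta>) * \<bar>f2 x - f1 x\<bar>"
        using \<theta> abs_triangle_ineq4[of "(1 - \<theta>) * (m1 - f1 x) + \<theta> * (m2 - f2 x)" "(1 - \<theta>) * (f2 x - f1 x)"]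
          abs_triangle_ineq[of "(1 - \<theta>) * (m1 - f1 x)" "\<theta> * (m2 - f2 x)"] by (simp add: abs_mult)
      also have "\<dots> \<le> (1 - \<theta>) * \<bar>m1 - f1 x\<bar> + \<bar>m2 - f2 x\<bar> + (1 - \<theta>) * \<bar>f2 x - f1 x\<bar>"
        using \<theta> by (simp add: mult_left_le_one_le)
      finally have "\<bar>strip_extension \<epsilon> b1 b2 f1 f2 z - f2 x\<bar> / (b2 - t)
        \<le> ((1 - \<theta>) * \<bar>m1 - f1 x\<bar> + \<bar>m2 - f2 x\<bar> + (1 - \<theta>) * \<bar>f2 x - f1 x\<bar>) / (b2 - t)"
        using d by (intro divide_right_mono) auto
      also have "\<dots> = \<bar>m1 - f1 x\<bar> / d + e2 + \<delta>"
        using d unfolding \<theta>(3)[symmetric] by (simp add: e2_def \<delta>_def add_divide_distrib)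
      also have "\<dots> \<le> X1 + X2 + \<delta>" using e1d nn by simp
      finally show "\<bar>strip_extension \<epsilon> b1 b2 f1 f2 z - f2 (fst z)\<bar> / (b2 - snd z) \<le> X1 + X2 + \<delta>" by (simp add: xt)
    qed (use d xt in simp)
  qed
qed

text \<open>The condition on \<open>a\<close> keeps both scales below \<open>a\<close>, as the
  integration over scales requires. The term with f2 - f1 is constant in the last variable: d^(-p)
  times the slice length d is the source of the power - (p - 1) of the width.\<close>

lemma nn_integral_energy_majorant:
  fixes f1 f2 :: "'a::euclidean_space \<Rightarrow> real"
  assumes [measurable]: "f1 \<in> borel_measurable borel" "f2 \<in> borel_measurable borel"
    and p: "p > 1" and \<epsilon>: "\<epsilon> > 0" and K: "K > 0" and b: "b1 < b2" and a: "\<epsilon> * (b2 - b1) \<le> a"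
    and c: "3 powr p * K / (\<epsilon> * (p + real DIM('a) - 1)) \<le> c" "3 powr p \<le> c"
  shows "(\<integral>\<^sup>+z\<in>strip b1 b2. energy_majorant K p \<epsilon> b1 b2 f1 f2 z \<partial>lborel)
     \<le> ennreal (c * (b2 - b1) powr (- (p - 1))) * (\<integral>\<^sup>+x. ennreal (\<bar>f2 x - f1 x\<bar> powr p) \<partial>lborel)
       + ennreal c * screened_energy p a f1 + ennreal c * screened_energy p a f2"
proof -
  define F where "F = (\<integral>\<^sup>+x. ennreal (\<bar>f2 x - f1 x\<bar> powr p) \<partial>lborel)"
  define d where "d = b2 - b1"
  define q where "q = p + real DIM('a) - 1"
  have d: "d > 0" using b by (simp add: d_def)
  have q: "q > 0" using p by (simp add: q_def add_pos_nonneg)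
  have [measurable]: "(fst :: 'a \<times> real \<Rightarrow> 'a) \<in> borel_measurable borel"
    by (intro borel_measurable_continuous_onI continuous_intros)
  define D1 where "D1 z = diff_energy p f1 (fst z, - \<epsilon> * b1 + \<epsilon> * snd z) * indicator (strip b1 b2) z" for z
  define D2 where "D2 z = diff_energy p f2 (fst z, \<epsilon> * b2 + (- \<epsilon>) * snd z) * indicator (strip b1 b2) z" for z
  define D3 where "D3 z = ennreal ((\<bar>f2 (fst z) - f1 (fst z)\<bar> / d) powr p) * indicator (strip b1 b2) z" for z
  have [measurable]: "D1 \<in> borel_measurable borel" "D2 \<in> borel_measurable borel" "D3 \<in> borel_measurable borel"
    unfolding D1_def[abs_def] D2_def[abs_def] D3_def[abs_def]
    by (intro borel_measurable_times_ennreal diff_energy_affine_measurable borel_measurable_indicator; simp)+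
  have le: "\<epsilon> * (t - b1) \<le> a" "\<epsilon> * (b2 - t) \<le> a" if "b1 < t" "t < b2" for t
    using that \<epsilon> by (auto intro!: order_trans[OF _ a] mult_left_mono)
  have I1: "(\<integral>\<^sup>+z. D1 z \<partial>lborel) \<le> ennreal (1 / (\<epsilon> * q)) * screened_energy p a f1"
    unfolding D1_def using nn_integral_diff_energy_le[of f1 p \<epsilon> b1 b2 "- \<epsilon> * b1" a] p \<epsilon> le
    by (simp add: q_def algebra_simps)
  have I2: "(\<integral>\<^sup>+z. D2 z \<partial>lborel) \<le> ennreal (1 / (\<epsilon> * q)) * screened_energy p a f2"
    unfolding D2_def using nn_integral_diff_energy_le[of f2 p "- \<epsilon>" b1 b2 "\<epsilon> * b2" a] p \<epsilon> le
    by (simp add: q_def algebra_simps)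
  have "(\<integral>\<^sup>+z. D3 z \<partial>lborel) = (\<integral>\<^sup>+x. (\<integral>\<^sup>+t. ennreal ((\<bar>f2 x - f1 x\<bar> / d) powr p) * indicator {b1<..<b2} t \<partial>lborel) \<partial>lborel)"
    by (subst nn_integral_lborel_Pair) (auto simp: D3_def strip_def indicator_def intro!: nn_integral_cong)
  also have "\<dots> = (\<integral>\<^sup>+x. ennreal (d powr (- (p - 1))) * ennreal (\<bar>f2 x - f1 x\<bar> powr p) \<partial>lborel)"
    using d b by (intro nn_integral_cong)
      (simp add: nn_integral_cmult_indicator d_def[symmetric] ennreal_mult'[symmetric] powr_divide powr_diff)
  also have "\<dots> = ennreal (d powr (- (p - 1))) * F" unfolding F_def by (rule nn_integral_cmult) simp
  finally have I3: "(\<integral>\<^sup>+z. D3 z \<partial>lborel) = ennreal (d powr (- (p - 1))) * F" .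
  have "(\<integral>\<^sup>+z\<in>strip b1 b2. energy_majorant K p \<epsilon> b1 b2 f1 f2 z \<partial>lborel)
    = (\<integral>\<^sup>+z. ennreal (3 powr p * K) * (D1 z + D2 z) + ennreal (3 powr p) * D3 z \<partial>lborel)"
    by (intro nn_integral_cong) (simp add: energy_majorant_def D1_def D2_def D3_def d_def indicator_def)
  also have "\<dots> = ennreal (3 powr p * K) * ((\<integral>\<^sup>+z. D1 z \<partial>lborel) + (\<integral>\<^sup>+z. D2 z \<partial>lborel)) + ennreal (3 powr p) * (\<integral>\<^sup>+z. D3 z \<partial>lborel)"
    by (simp add: nn_integral_add nn_integral_cmult)
  also have "\<dots> \<le> ennreal (3 powr p * K) * (ennreal (1 / (\<epsilon> * q)) * screened_energy p a f1 + ennreal (1 / (\<epsilon> * q)) * screened_energy p a f2)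
      + ennreal (3 powr p) * (ennreal (d powr (- (p - 1))) * F)"
    unfolding I3 by (intro add_mono mult_left_mono I1 I2) auto
  also have "\<dots> = ennreal (3 powr p * K / (\<epsilon> * q)) * screened_energy p a f1 + ennreal (3 powr p * K / (\<epsilon> * q)) * screened_energy p a f2
      + ennreal (3 powr p * d powr (- (p - 1))) * F"
    using K \<epsilon> q by (simp add: distrib_left mult.assoc[symmetric] ennreal_mult'[symmetric])
  also have "\<dots> \<le> ennreal c * screened_energy p a f1 + ennreal c * screened_energy p a f2 + ennreal (c * d powr (- (p - 1))) * F"
    using c by (intro add_mono mult_right_mono ennreal_leI) (auto simp: q_def)
  finally show ?thesis by (simp add: F_def d_def add_ac)
qed

theorem theorem1p3:
  fixes a p L :: real
  assumes "a > 0" and "1 < p" and "L > 0"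
  shows "\<exists>c>0. \<forall>b1 b2. b1 < b2 \<and> b2 - b1 \<le> L \<longrightarrow>
    (\<exists>T :: ('a::euclidean_space \<Rightarrow> real) \<Rightarrow> ('a \<Rightarrow> real) \<Rightarrow> ('a \<times> real \<Rightarrow> real).
      (\<forall>f1 f2. (f1, f2) \<in> boundary_data p a \<longrightarrow>
        T f1 f2 \<in> hom_sobolev p (strip b1 b2) \<and>
        has_trace p b1 b2 (T f1 f2) f1 f2 \<and>
        (\<exists>G. weak_gradient (strip b1 b2) (T f1 f2) G \<and>
          (\<integral>\<^sup>+x\<in>strip b1 b2. ennreal (norm (G x) powr p) \<partial>lborel)
            \<le> ennreal (c * (b2 - b1) powr (- (p - 1))) * (\<integral>\<^sup>+x. ennreal (\<bar>f2 x - f1 x\<bar> powr p) \<partial>lborel)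
              + ennreal c * ennreal_powr (screened_seminorm p a f1) p
              + ennreal c * ennreal_powr (screened_seminorm p a f2) p)) \<and>
      (\<forall>f1 f2 g1 g2 \<alpha> \<beta>. (f1, f2) \<in> boundary_data p a \<and> (g1, g2) \<in> boundary_data p a \<longrightarrow>
        (AE x in lborel. x \<in> strip b1 b2 \<longrightarrow>
          T (\<lambda>y. \<alpha> * f1 y + \<beta> * g1 y) (\<lambda>y. \<alpha> * f2 y + \<beta> * g2 y) x = \<alpha> * T f1 f2 x + \<beta> * T g1 g2 x)))"
proof -
  \<comment> \<open>With this slope \<epsilon> times the width is at most \<open>a\<close> for all
    strips under consideration, so \<epsilon>, \<open>K\<close> and \<open>c\<close> are fixed
    before \<open>b1\<close> and \<open>b2\<close>.\<close>
  define \<epsilon> where "\<epsilon> = a / L"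
  have \<epsilon>: "\<epsilon> > 0" using assms by (simp add: \<epsilon>_def)
  obtain K :: real where K: "K > 0" and maj: "\<And>(f1 :: 'a \<Rightarrow> real) f2 b1 b2 z. z \<in> strip b1 b2 \<Longrightarrow>
    Lp_loc_on 1 UNIV f1 \<Longrightarrow> Lp_loc_on 1 UNIV f2 \<Longrightarrow>
      ennreal (norm (strip_extension_grad \<epsilon> b1 b2 f1 f2 z) powr p) \<le> energy_majorant K p \<epsilon> b1 b2 f1 f2 z \<and>
      ennreal ((\<bar>strip_extension \<epsilon> b1 b2 f1 f2 z - f1 (fst z)\<bar> / (snd z - b1)) powr p) \<le> energy_majorant K p \<epsilon> b1 b2 f1 f2 z \<and>
      ennreal ((\<bar>strip_extension \<epsilon> b1 b2 f1 f2 z - f2 (fst z)\<bar> / (b2 - snd z)) powr p) \<le> energy_majorant K p \<epsilon> b1 b2 f1 f2 z"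
    using strip_extension_majorant[where 'a='a, OF \<open>1 < p\<close> \<epsilon>] by blast
  define c where "c = max (3 powr p * K / (\<epsilon> * (p + real DIM('a) - 1))) (3 powr p)"
  have c: "c > 0" "3 powr p * K / (\<epsilon> * (p + real DIM('a) - 1)) \<le> c" "3 powr p \<le> c"
    by (auto simp: c_def less_max_iff_disj)
  show ?thesis
  proof (intro exI[of _ c] conjI allI impI c(1))
    fix b1 b2 :: real assume "b1 < b2 \<and> b2 - b1 \<le> L"
    moreover from this have "\<epsilon> * (b2 - b1) \<le> \<epsilon> * L" using \<epsilon> by (intro mult_left_mono) auto
    ultimately have b: "b1 < b2" "\<epsilon> * (b2 - b1) \<le> a"
      using assms by (auto simp: \<epsilon>_def)
    show "\<exists>T :: ('a \<Rightarrow> real) \<Rightarrow> ('a \<Rightarrow> real) \<Rightarrow> ('a \<times> real \<Rightarrow> real).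
      (\<forall>f1 f2. (f1, f2) \<in> boundary_data p a \<longrightarrow>
        T f1 f2 \<in> hom_sobolev p (strip b1 b2) \<and>
        has_trace p b1 b2 (T f1 f2) f1 f2 \<and>
        (\<exists>G. weak_gradient (strip b1 b2) (T f1 f2) G \<and>
          (\<integral>\<^sup>+x\<in>strip b1 b2. ennreal (norm (G x) powr p) \<partial>lborel)
            \<le> ennreal (c * (b2 - b1) powr (- (p - 1))) * (\<integral>\<^sup>+x. ennreal (\<bar>f2 x - f1 x\<bar> powr p) \<partial>lborel)
              + ennreal c * ennreal_powr (screened_seminorm p a f1) p
              + ennreal c * ennreal_powr (screened_seminorm p a f2) p)) \<and>
      (\<forall>f1 f2 g1 g2 \<alpha> \<beta>. (f1, f2) \<in> boundary_data p a \<and> (g1, g2) \<in> boundary_data p a \<longrightarrow>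
        (AE x in lborel. x \<in> strip b1 b2 \<longrightarrow>
          T (\<lambda>y. \<alpha> * f1 y + \<beta> * g1 y) (\<lambda>y. \<alpha> * f2 y + \<beta> * g2 y) x = \<alpha> * T f1 f2 x + \<beta> * T g1 g2 x))"
    proof (intro exI[of _ "strip_extension \<epsilon> b1 b2"] conjI allI impI)
      fix f1 f2 g1 g2 :: "'a \<Rightarrow> real" and \<alpha> \<beta> :: real
      assume "(f1, f2) \<in> boundary_data p a \<and> (g1, g2) \<in> boundary_data p a"
      then show "AE x in lborel. x \<in> strip b1 b2 \<longrightarrow>
          strip_extension \<epsilon> b1 b2 (\<lambda>y. \<alpha> * f1 y + \<beta> * g1 y) (\<lambda>y. \<alpha> * f2 y + \<beta> * g2 y) x
            = \<alpha> * strip_extension \<epsilon> b1 b2 f1 f2 x + \<beta> * strip_extension \<epsilon> b1 b2 g1 g2 x"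
        \<comment> \<open>No null set is discarded: linearity holds at every point of the strip,
          where both scales are positive.\<close>
        using \<epsilon> by (intro AE_I2 impI strip_extension_lincomb) (auto simp: boundary_data_def)
    next
      fix f1 f2 :: "'a \<Rightarrow> real" assume "(f1, f2) \<in> boundary_data p a"
      then have f: "Lp_loc_on 1 UNIV f1" "Lp_loc_on 1 UNIV f2"
        and F: "(\<integral>\<^sup>+x. ennreal (\<bar>f2 x - f1 x\<bar> powr p) \<partial>lborel) < \<infinity>"
        and S: "screened_energy p a f1 < \<infinity>" "screened_energy p a f2 < \<infinity>"
        using screened_seminorm_powr(2)[of p a] assms by (auto simp: boundary_data_def)
      note fm = Lp_loc_on_UNIV_measurable[OF f(1)] Lp_loc_on_UNIV_measurable[OF f(2)]
      let ?u = "strip_extension \<epsilon> b1 b2 f1 f2" and ?G = "strip_extension_grad \<epsilon> b1 b2 f1 f2"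
      let ?R = "ennreal (c * (b2 - b1) powr (- (p - 1))) * (\<integral>\<^sup>+x. ennreal (\<bar>f2 x - f1 x\<bar> powr p) \<partial>lborel)
              + ennreal c * screened_energy p a f1 + ennreal c * screened_energy p a f2"
      note I = nn_integral_energy_majorant[OF fm \<open>1 < p\<close> \<epsilon> K b c(2,3)]
      have fin: "?R < \<infinity>" using F S by (simp add: ennreal_mult_less_top)
      \<comment> \<open>Used for the gradient, where it is the asserted estimate, and for the two
        Hardy quotients, where only finiteness of the right-hand side matters.\<close>
      have bound: "(\<integral>\<^sup>+z\<in>strip b1 b2. ennreal (h z) \<partial>lborel) \<le> ?R"
        if "\<And>z. z \<in> strip b1 b2 \<Longrightarrow> ennreal (h z) \<le> energy_majorant K p \<epsilon> b1 b2 f1 f2 z" for h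
        by (rule order_trans[OF nn_integral_mono I]) (use that in \<open>auto simp: indicator_def\<close>)
      have G: "(\<integral>\<^sup>+z\<in>strip b1 b2. ennreal (norm (?G z) powr p) \<partial>lborel) \<le> ?R"
        using maj f by (intro bound) blast
      have H1: "(\<integral>\<^sup>+z\<in>strip b1 b2. ennreal ((\<bar>?u z - f1 (fst z)\<bar> / (snd z - b1)) powr p) \<partial>lborel) \<le> ?R"
        using maj f by (intro bound) blast
      have H2: "(\<integral>\<^sup>+z\<in>strip b1 b2. ennreal ((\<bar>?u z - f2 (fst z)\<bar> / (b2 - snd z)) powr p) \<partial>lborel) \<le> ?R"
        using maj f by (intro bound) blast
      interpret strip_function p b1 b2 ?u ?G f1 f2
        using b(1) \<open>1 < p\<close> strip_extension_measurable[OF fm] strip_extension_has_derivative[OF f \<epsilon>] f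
          le_less_trans[OF G fin] le_less_trans[OF H1 fin] le_less_trans[OF H2 fin]
        by unfold_locales
      show "?u \<in> hom_sobolev p (strip b1 b2)" by (rule hom_sobolev)
      show "has_trace p b1 b2 ?u f1 f2"
        using Lp_loc_on_of_screened[OF f(1) assms(2,1) S(1)] Lp_loc_on_of_screened[OF f(2) assms(2,1) S(2)]
        by (rule has_trace)
      show "\<exists>G. weak_gradient (strip b1 b2) ?u G \<and>
          (\<integral>\<^sup>+x\<in>strip b1 b2. ennreal (norm (G x) powr p) \<partial>lborel)
            \<le> ennreal (c * (b2 - b1) powr (- (p - 1))) * (\<integral>\<^sup>+x. ennreal (\<bar>f2 x - f1 x\<bar> powr p) \<partial>lborel)
              + ennreal c * ennreal_powr (screened_seminorm p a f1) p
              + ennreal c * ennreal_powr (screened_seminorm p a f2) p"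
      proof (intro exI conjI)
        have "p > 0" using assms by simp
        then show "(\<integral>\<^sup>+x\<in>strip b1 b2. ennreal (norm (?G x) powr p) \<partial>lborel)
            \<le> ennreal (c * (b2 - b1) powr (- (p - 1))) * (\<integral>\<^sup>+x. ennreal (\<bar>f2 x - f1 x\<bar> powr p) \<partial>lborel)
              + ennreal c * ennreal_powr (screened_seminorm p a f1) p
              + ennreal c * ennreal_powr (screened_seminorm p a f2) p"
          using G by (simp only: screened_seminorm_powr(1))
      qed (rule weak_gradient)
    qed
  qed
qed

end
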